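(* Let $n,d$ be positive integers with $2d<n<3d$, fix $x\in\binom{[n]}{d}$, and let $\mathcal{T}$ be the Terwilliger algebra of the Johnson scheme $J(n,d)$ with respect to $x$. Then, as $\mathbb{C}$-algebras, $$\mathcal{T}\simeq\bigoplus_{r=0}^{\lfloor d/2\rfloor}\ \bigoplus_{s=0}^{\lfloor (n-d)/2\rfloor}\mathrm{Mat}_{d_{r,s}+1}(\mathbb{C}).$$
   Context: Johnson scheme and Terwilliger algebra. $[n]=\{1,\dots,n\}$, and $X=\binom{[n]}{d}$ is the set of $d$-subsets of $[n]$. $\mathrm{Mat}_X(\mathbb{C})$ is the algebra of complex matrices with rows and columns indexed by $X$. For $0\le i\le d$ let $R_i=\{(y,z)\in X\times X: |y\cap z|=d-i\}$ and let $A_i\in\mathrm{Mat}_X(\mathbb{C})$ be the $0/1$ matrix with $(y,z)$-entry $1$ iff $(y,z)\in R_i$; $J(n,d)=(X,\{R_i\}_{i=0}^d)$. For fixed $x\in X$ let $E_i^*$ be the diagonal matrix with $(y,y)$-entry $1$ if $(x,y)\in R_i$ and $0$ otherwise. The Terwilliger algebra $\mathcal{T}$ (with respect to $x$) is the subalgebra of $\mathrm{Mat}_X(\mathbb{C})$ generated by $A_0,\dots,A_d,E_0^*,\dots,E_d^*$. Idempotents. For $0\le k\le v$, let $A_1^{(v,k)}$ be the $0/1$ matrix indexed by $\binom{[v]}{k}$ with $(\alpha,\beta)$-entry $1$ iff $|\alpha\cap\beta|=k-1$ (the adjacency matrix of $J(v,k)$; it is $0$ if $k\in\{0,v\}$).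 $E^{(v,k)}_j$, $0\le j\le\min(k,v-k)$, denotes the primitive idempotent of the Bose–Mesner algebra of $J(v,k)$ with $A_1^{(v,k)}E^{(v,k)}_j=\big((k-j)(v-k-j)-j\big)E^{(v,k)}_j$, i.e. the orthogonal projection onto the corresponding eigenspace of $A_1^{(v,k)}$. Convention: $E^{(v,k)}_j=0$ if $j>\min(k,v-k)$. The numbers $d_{r,s}$. For $0\le r\le\lfloor d/2\rfloor$ and $0\le s\le\lfloor (n-d)/2\rfloor$, $$d_{r,s}=\big|\{i\in\{0,1,\dots,d\}: E^{(d,d-i)}_r\otimes E^{(n-d,i)}_s\ne0\}\big|-1 .$$ $\mathrm{Mat}_m(\mathbb{C})$ is the algebra of $m\times m$ complex matrices, with $\mathrm{Mat}_0(\mathbb{C})=0$ (this occurs when the set defining $d_{r,s}$ is empty, so that $d_{r,s}=-1$). *)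

theory Defs
  imports Complex_Main "HOL-Library.FuncSet" "HOL-Algebra.Module"
    "Jordan_Normal_Form.Matrix"
begin

section \<open>Complex algebras\<close>

text \<open>
  A \<open>\<complex>\<close>-algebra is represented by a \<open>module\<close> record over the scalars
  \<^typ>\<open>complex\<close>. Since \<^const>\<open>ring_hom\<close> preserves the unit element,
  all homomorphisms and subalgebras below are unital.
\<close>

type_synonym 'a calgebra = "(complex, 'a) module"

definition calg_iso :: "'a calgebra \<Rightarrow> 'b calgebra \<Rightarrow> ('a \<Rightarrow> 'b) set" where
  "calg_iso A B = {h \<in> ring_hom A B.
     bij_betw h (carrier A) (carrier B) \<and>
     (\<forall>c. \<forall>a \<in> carrier A. h (c \<odot>\<^bsub>A\<^esub> a) = c \<odot>\<^bsub>B\<^esub> h a)}"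

definition calg_isomorphic :: "'a calgebra \<Rightarrow> 'b calgebra \<Rightarrow> bool" (infix "\<simeq>\<^sub>\<complex>" 50) where
  "A \<simeq>\<^sub>\<complex> B \<longleftrightarrow> calg_iso A B \<noteq> {}"

definition is_subalgebra :: "'a calgebra \<Rightarrow> 'a set \<Rightarrow> bool" where
  "is_subalgebra A S \<longleftrightarrow> S \<subseteq> carrier A \<and> \<one>\<^bsub>A\<^esub> \<in> S \<and>
     (\<forall>a \<in> S. \<forall>b \<in> S. a \<oplus>\<^bsub>A\<^esub> b \<in> S \<and> a \<otimes>\<^bsub>A\<^esub> b \<in> S) \<and>
     (\<forall>c. \<forall>a \<in> S. c \<odot>\<^bsub>A\<^esub> a \<in> S)"

definition generated_subalgebra :: "'a calgebra \<Rightarrow> 'a set \<Rightarrow> 'a calgebra" where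
  "generated_subalgebra A G =
     A\<lparr>carrier := \<Inter>{S. is_subalgebra A S \<and> G \<subseteq> S}\<rparr>"

text \<open>Direct sum over a finite index set, with componentwise operations.\<close>

definition direct_sum :: "'i set \<Rightarrow> ('i \<Rightarrow> 'a calgebra) \<Rightarrow> ('i \<Rightarrow> 'a) calgebra" where
  "direct_sum I A = \<lparr>
     carrier = (\<Pi>\<^sub>E i\<in>I. carrier (A i)),
     mult = (\<lambda>f g. \<lambda>i\<in>I. f i \<otimes>\<^bsub>A i\<^esub> g i),
     one = (\<lambda>i\<in>I. \<one>\<^bsub>A i\<^esub>),
     zero = (\<lambda>i\<in>I. \<zero>\<^bsub>A i\<^esub>),
     add = (\<lambda>f g. \<lambda>i\<in>I. f i \<oplus>\<^bsub>A i\<^esub> g i),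
     smult = (\<lambda>c f. \<lambda>i\<in>I. c \<odot>\<^bsub>A i\<^esub> f i)\<rparr>"

text \<open>\<open>Mat m\<close> is the algebra of \<open>m \<times> m\<close> matrices; \<open>Mat 0\<close> has a single element.\<close>

abbreviation Mat :: "nat \<Rightarrow> complex mat calgebra" where
  "Mat m \<equiv> module_mat TYPE(complex) m m"

section \<open>Matrices and vectors indexed by a finite set\<close>

text \<open>
  A matrix with rows and columns indexed by \<open>X\<close> is a function of two arguments that
  vanishes outside \<open>X \<times> X\<close>; likewise a vector indexed by \<open>X\<close> vanishes outside \<open>X\<close>.
\<close>

type_synonym 'a matrix_on = "'a \<Rightarrow> 'a \<Rightarrow> complex"

definition matrices_on :: "'a set \<Rightarrow> 'a matrix_on set" where
  "matrices_on X = {M. \<forall>y z. y \<notin> X \<or> z \<notin> X \<longrightarrow> M y z = 0}"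

definition vectors_on :: "'a set \<Rightarrow> ('a \<Rightarrow> complex) set" where
  "vectors_on X = {u. \<forall>y. y \<notin> X \<longrightarrow> u y = 0}"

definition Mat_on :: "'a set \<Rightarrow> 'a matrix_on calgebra" where
  "Mat_on X = \<lparr>
     carrier = matrices_on X,
     mult = (\<lambda>M N y z. \<Sum>w\<in>X. M y w * N w z),
     one = (\<lambda>y z. if y \<in> X \<and> y = z then 1 else 0),
     zero = (\<lambda>y z. 0),
     add = (\<lambda>M N y z. M y z + N y z),
     smult = (\<lambda>c M y z. c * M y z)\<rparr>"

definition mat_vec :: "'a set \<Rightarrow> 'a matrix_on \<Rightarrow> ('a \<Rightarrow> complex) \<Rightarrow> 'a \<Rightarrow> complex" where
  "mat_vec X M u = (\<lambda>y. \<Sum>z\<in>X. M y z * u z)"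

definition inner_on :: "'a set \<Rightarrow> ('a \<Rightarrow> complex) \<Rightarrow> ('a \<Rightarrow> complex) \<Rightarrow> complex" where
  "inner_on X u w = (\<Sum>y\<in>X. u y * cnj (w y))"

definition eigenspace_on :: "'a set \<Rightarrow> 'a matrix_on \<Rightarrow> complex \<Rightarrow> ('a \<Rightarrow> complex) set" where
  "eigenspace_on X M \<theta> = {u \<in> vectors_on X. mat_vec X M u = (\<lambda>y. \<theta> * u y)}"

definition is_orth_projection ::
    "'a set \<Rightarrow> ('a \<Rightarrow> complex) set \<Rightarrow> 'a matrix_on \<Rightarrow> bool" where
  "is_orth_projection X W P \<longleftrightarrow> P \<in> matrices_on X \<and>
     (\<forall>u \<in> vectors_on X. mat_vec X P u \<in> W \<and>
        (\<forall>w \<in> W. inner_on X (\<lambda>y. u y - mat_vec X P u y) w = 0))"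

definition orth_projection :: "'a set \<Rightarrow> ('a \<Rightarrow> complex) set \<Rightarrow> 'a matrix_on" where
  "orth_projection X W = (THE P. is_orth_projection X W P)"

definition tensor :: "'a matrix_on \<Rightarrow> 'b matrix_on \<Rightarrow> ('a \<times> 'b) matrix_on" where
  "tensor M N = (\<lambda>(a, b) (a', b'). M a a' * N b b')"

section \<open>The Johnson scheme and its Terwilliger algebra\<close>

definition johnson_points :: "nat \<Rightarrow> nat \<Rightarrow> nat set set" where
  "johnson_points n d = {y. y \<subseteq> {1..n} \<and> card y = d}"

definition johnson_rel :: "nat \<Rightarrow> nat \<Rightarrow> nat \<Rightarrow> (nat set \<times> nat set) set" where
  "johnson_rel n d i =
     {(y, z) \<in> johnson_points n d \<times> johnson_points n d. card (y \<inter> z) = d - i}"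

definition assoc_matrix :: "nat \<Rightarrow> nat \<Rightarrow> nat \<Rightarrow> nat set matrix_on" where
  "assoc_matrix n d i = (\<lambda>y z. if (y, z) \<in> johnson_rel n d i then 1 else 0)"

definition dual_idempotent :: "nat \<Rightarrow> nat \<Rightarrow> nat set \<Rightarrow> nat \<Rightarrow> nat set matrix_on" where
  "dual_idempotent n d x i =
     (\<lambda>y z. if y = z \<and> (x, y) \<in> johnson_rel n d i then 1 else 0)"

definition terwilliger_algebra :: "nat \<Rightarrow> nat \<Rightarrow> nat set \<Rightarrow> nat set matrix_on calgebra" where
  "terwilliger_algebra n d x = generated_subalgebra (Mat_on (johnson_points n d))
     (assoc_matrix n d ` {0..d} \<union> dual_idempotent n d x ` {0..d})"

section \<open>Primitive idempotents and the block sizes\<close>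

text \<open>
  The condition is written \<open>card (\<alpha> \<inter> \<beta>) + 1 = k\<close> because natural-number subtraction
  would make \<open>k - 1 = 0\<close> for \<open>k = 0\<close>.
\<close>

definition johnson_adjacency :: "nat \<Rightarrow> nat \<Rightarrow> nat set matrix_on" where
  "johnson_adjacency v k = (\<lambda>\<alpha> \<beta>.
     if \<alpha> \<in> johnson_points v k \<and> \<beta> \<in> johnson_points v k \<and> card (\<alpha> \<inter> \<beta>) + 1 = k
     then 1 else 0)"

definition johnson_eigenvalue :: "nat \<Rightarrow> nat \<Rightarrow> nat \<Rightarrow> int" where
  "johnson_eigenvalue v k j = (int k - int j) * (int v - int k - int j) - int j"

definition johnson_idempotent :: "nat \<Rightarrow> nat \<Rightarrow> nat \<Rightarrow> nat set matrix_on" where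
  "johnson_idempotent v k j =
     (if j \<le> min k (v - k)
      then orth_projection (johnson_points v k)
        (eigenspace_on (johnson_points v k) (johnson_adjacency v k)
          (of_int (johnson_eigenvalue v k j)))
      else (\<lambda>\<alpha> \<beta>. 0))"

text \<open>The value is \<open>-1\<close> when no index \<open>i\<close> contributes.\<close>

definition d_num :: "nat \<Rightarrow> nat \<Rightarrow> nat \<Rightarrow> nat \<Rightarrow> int" where
  "d_num n d r s =
     int (card {i \<in> {0..d}.
       tensor (johnson_idempotent d (d - i) r) (johnson_idempotent (n - d) i s)
         \<noteq> (\<lambda>_ _. 0)}) - 1"

end

theory Submission
  imports Defs "HOL-Computational_Algebra.Polynomial"
begin

text \<open>
  Let \<open>x'\<close> be the complement of the base point \<open>x\<close> and \<open>m = n - d\<close> its size. A \<open>d\<close>-subset \<open>y\<close> of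
  \<open>{1..n}\<close> splits into \<open>y \<inter> x\<close> and \<open>y \<inter> x'\<close>, and the operators that add or remove one point of a
  fixed set make the functions on all subsets a representation of two commuting copies of \<open>sl(2)\<close>,
  one for \<open>x\<close> and one for \<open>x'\<close>. For each copy, a Casimir element is annihilated by a polynomial
  with simple roots, and Lagrange interpolation gives the projections onto its isotypic components
  (\<open>isotypic\<close>). The products \<open>G (r, s)\<close> of such projections for \<open>x\<close> and \<open>x'\<close> cut out the
  components \<open>(r, s)\<close> of the decomposition; on the \<open>d\<close>-subsets with \<open>i\<close> points in \<open>x'\<close> the
  component is nonzero exactly if \<open>max r s \<le> i \<le> min (d - r) (m - s)\<close>.

  Let \<open>R\<close> move one point from \<open>x\<close> to \<open>x'\<close> and \<open>L\<close> move one back. On a component, \<open>L * R\<close> and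
  \<open>R * L\<close> act on every layer by scalars, which vanish only at the ends of the range of layers.
  Hence \<open>R ^ i * G (r, s) * L ^ j\<close>, cut to the lowest layer in the middle and rescaled, form
  matrix units (\<open>F_mult\<close>), one block for each \<open>(r, s)\<close>, of size the number of layers of the component.
  That number is \<open>d\<^sub>r\<^sub>,\<^sub>s + 1\<close>, because the primitive idempotents of the Johnson scheme \<open>J(v, k)\<close>
  are nonzero exactly in the expected range (\<open>johnson_idempotent_nonzero_iff\<close>, \<open>d_num_eq\<close>); for this
  one needs explicit lowest weight vectors, products of differences over disjoint pairs of points
  (\<open>pair_state\<close>, \<open>exists_state\<close>).

  It remains to see that the Terwilliger algebra is the span of the matrix units. It is contained in
  the span: this is clear for the dual idempotents and for \<open>A\<^sub>1\<close>, and the other association matrices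
  are polynomials in \<open>A\<^sub>1\<close> (\<open>units_span_assoc\<close>). Conversely (\<open>generates\<close>), cutting \<open>A\<^sub>1\<close> by
  the dual idempotents gives \<open>R\<close>, \<open>L\<close> and the sum of the two Casimir elements on every layer. The
  commutator of \<open>L\<close> and \<open>R\<close> is a second affine combination of the two Casimir elements, with
  coefficients \<open>m - 2 i\<close> and \<open>d - 2 i\<close> on layer \<open>i\<close>. Since \<open>m \<noteq> d\<close>, both Casimir elements, and with
  them all projections \<open>G (r, s)\<close>, lie in the Terwilliger algebra.
\<close>

section \<open>The ring of row-finite complex matrices\<close>

text \<open>Matrices over an arbitrary, possibly infinite, index type, with finitely many nonzero entries
  in every row. They form a ring with unit, so all matrices below, whatever the ground set, live in
  one type.\<close>

typedef 'a rfmat = "{M :: 'a \<Rightarrow> 'a \<Rightarrow> complex. \<forall>y. finite {z. M y z \<noteq> 0}}"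
  morphisms entry Rfmat
  by (rule exI[of _ "\<lambda>_ _. 0"]) simp

lemma finite_row: "finite {z. entry M y z \<noteq> 0}"
  using entry[of M] by simp

lemma rfmat_eqI: "(\<And>y z. entry M y z = entry N y z) \<Longrightarrow> M = N"
  by (metis entry_inject ext)

lemma entry_Rfmat: "(\<And>y. finite {z. M y z \<noteq> 0}) \<Longrightarrow> entry (Rfmat M) = M"
  by (simp add: Rfmat_inverse)

text \<open>The matrix product; the sum runs over the finite support of row \<open>y\<close> of \<open>M\<close>.\<close>

definition row_mult :: "'a rfmat \<Rightarrow> 'a rfmat \<Rightarrow> 'a \<Rightarrow> 'a \<Rightarrow> complex" where
  "row_mult M N y z = (\<Sum>w | entry M y w \<noteq> 0. entry M y w * entry N w z)"

lemma row_mult_superset: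
  assumes "finite W" "{w. entry M y w \<noteq> 0} \<subseteq> W"
  shows "row_mult M N y z = (\<Sum>w\<in>W. entry M y w * entry N w z)"
  unfolding row_mult_def using assms by (intro sum.mono_neutral_left) auto

lemma finite_row_mult: "finite {z. row_mult M N y z \<noteq> 0}"
proof (rule finite_subset)
  show "{z. row_mult M N y z \<noteq> 0} \<subseteq> (\<Union>w\<in>{w. entry M y w \<noteq> 0}. {z. entry N w z \<noteq> 0})"
    unfolding row_mult_def by (force elim: sum.not_neutral_contains_not_neutral)
  show "finite (\<Union>w\<in>{w. entry M y w \<noteq> 0}. {z. entry N w z \<noteq> 0})"
    by (intro finite_UN_I finite_row)
qed

text \<open>Multiplication by a complex scalar.\<close>

definition cscale :: "complex \<Rightarrow> 'a rfmat \<Rightarrow> 'a rfmat" (infixr "*\<^sub>c" 75) where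
  "c *\<^sub>c M = Rfmat (\<lambda>y z. c * entry M y z)"

lemma entry_cscale [simp]: "entry (c *\<^sub>c M) y z = c * entry M y z"
  unfolding cscale_def
  by (subst entry_Rfmat) (auto intro: finite_subset[OF _ finite_row[of M]])

instantiation rfmat :: (type) ring_1
begin

definition "0 = Rfmat (\<lambda>_ _. 0)"
definition "1 = Rfmat (\<lambda>y z. of_bool (y = z))"
definition "M + N = Rfmat (\<lambda>y z. entry M y z + entry N y z)"
definition "- M = Rfmat (\<lambda>y z. - entry M y z)" for M :: "'a rfmat"
definition "M - N = Rfmat (\<lambda>y z. entry M y z - entry N y z)"
definition "M * N = Rfmat (row_mult M N)"

lemma entry_ops:
  "entry (0 :: 'a rfmat) y z = 0"
  "entry (1 :: 'a rfmat) y z = of_bool (y = z)"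
  "entry (M + N) y z = entry M y z + entry N y z"
  "entry (- M) y z = - entry M y z"
  "entry (M - N) y z = entry M y z - entry N y z"
  "entry (M * N) = row_mult M N" for M N :: "'a rfmat"
proof -
  have fin: "finite {z. f (entry M y z) (entry N y z) \<noteq> 0}"
    if "f 0 0 = 0" for f :: "complex \<Rightarrow> complex \<Rightarrow> complex" and y
    by (rule finite_subset[OF _ finite_UnI[OF finite_row[of M y] finite_row[of N y]]])
      (use that in auto)
  show "entry (0 :: 'a rfmat) y z = 0"
    unfolding zero_rfmat_def by (simp add: entry_Rfmat)
  show "entry (1 :: 'a rfmat) y z = of_bool (y = z)"
    unfolding one_rfmat_def by (simp add: entry_Rfmat)
  show "entry (M + N) y z = entry M y z + entry N y z"
    unfolding plus_rfmat_def by (subst entry_Rfmat) (use fin[of "(+)"] in auto)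
  show "entry (- M) y z = - entry M y z"
    unfolding uminus_rfmat_def by (subst entry_Rfmat) (use finite_row[of M] in auto)
  show "entry (M - N) y z = entry M y z - entry N y z"
    unfolding minus_rfmat_def by (subst entry_Rfmat) (use fin[of "(-)"] in auto)
  show "entry (M * N) = row_mult M N"
    unfolding times_rfmat_def by (subst entry_Rfmat) (use finite_row_mult in auto)
qed

instance
proof
  fix A B C :: "'a rfmat"
  show "A * B * C = A * (B * C)"
  proof (rule rfmat_eqI)
    fix y z
    define V where "V = {w. entry A y w \<noteq> 0}"
    define W where "W = (\<Union>w\<in>V. {z. entry B w z \<noteq> 0})"
    have fin: "finite V" "finite W"
      unfolding V_def W_def by (auto simp: finite_row)
    have AB: "row_mult A B y u = (\<Sum>w\<in>V. entry A y w * entry B w u)" for u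
      using fin by (intro row_mult_superset) (auto simp: V_def)
    have "{u. entry (A * B) y u \<noteq> 0} \<subseteq> W"
      unfolding W_def AB entry_ops by (force elim: sum.not_neutral_contains_not_neutral)
    then have "entry (A * B * C) y z = (\<Sum>u\<in>W. entry (A * B) y u * entry C u z)"
      unfolding entry_ops(6)[of "A * B" C] using fin by (intro row_mult_superset) auto
    also have "\<dots> = (\<Sum>u\<in>W. \<Sum>w\<in>V. entry A y w * entry B w u * entry C u z)"
      by (simp add: entry_ops AB sum_distrib_right)
    also have "\<dots> = (\<Sum>w\<in>V. entry A y w * (\<Sum>u\<in>W. entry B w u * entry C u z))"
      by (subst sum.swap) (simp add: sum_distrib_left mult.assoc)
    also have "\<dots> = (\<Sum>w\<in>V. entry A y w * row_mult B C w z)"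
      by (intro sum.cong refl arg_cong2[where f = "(*)"] row_mult_superset[symmetric] fin)
        (auto simp: W_def)
    also have "\<dots> = entry (A * (B * C)) y z"
      unfolding entry_ops(6) row_mult_def[of A] V_def by simp
    finally show "entry (A * B * C) y z = entry (A * (B * C)) y z" .
  qed
  show "(A + B) * C = A * C + B * C"
  proof (rule rfmat_eqI)
    fix y z
    define W where "W = {w. entry A y w \<noteq> 0} \<union> {w. entry B y w \<noteq> 0}"
    have "finite W" unfolding W_def by (auto simp: finite_row)
    then show "entry ((A + B) * C) y z = entry (A * C + B * C) y z"
      unfolding entry_ops
      by (subst (1 2 3) row_mult_superset[of W])
        (auto simp: W_def entry_ops ring_distribs sum.distrib)
  qed
  show "A * (B + C) = A * B + A * C"
    by (rule rfmat_eqI) (simp add: entry_ops row_mult_def ring_distribs sum.distrib)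
  show "1 * A = A"
  proof (rule rfmat_eqI)
    fix y z
    show "entry (1 * A) y z = entry A y z"
      unfolding entry_ops by (subst row_mult_superset[of "{y}"]) (auto simp: entry_ops)
  qed
  show "A * 1 = A"
  proof (rule rfmat_eqI)
    fix y z
    show "entry (A * 1) y z = entry A y z"
      unfolding entry_ops
      by (subst row_mult_superset[of "insert z {w. entry A y w \<noteq> 0}"])
        (auto simp: entry_ops finite_row if_distrib[of "(*) _"] of_bool_def cong: if_cong)
  qed
  show "(0 :: 'a rfmat) \<noteq> 1"
    by (metis entry_ops(1,2) of_bool_eq(2) zero_neq_one)
qed (rule rfmat_eqI, simp add: entry_ops)+

end

lemmas entry_simps [simp] = entry_ops(1-5)

lemma entry_sum [simp]: "entry (\<Sum>i\<in>I. f i) y z = (\<Sum>i\<in>I. entry (f i) y z)"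
  by (induction I rule: infinite_finite_induct) auto

lemma entry_mult:
  assumes "finite W" "\<And>w. entry M y w \<noteq> 0 \<Longrightarrow> w \<in> W"
  shows "entry (M * N) y z = (\<Sum>w\<in>W. entry M y w * entry N w z)"
  unfolding entry_ops using assms by (intro row_mult_superset) auto

lemma cscale_simps [simp]:
  "c *\<^sub>c d *\<^sub>c M = (c * d) *\<^sub>c M"
  "1 *\<^sub>c M = M"
  "0 *\<^sub>c M = 0"
  "c *\<^sub>c 0 = (0 :: 'a rfmat)"
  "c *\<^sub>c M * N = c *\<^sub>c (M * N)"
  "M * (c *\<^sub>c N) = c *\<^sub>c (M * N)"
  for M N :: "'a rfmat"
proof -
  show "c *\<^sub>c M * N = c *\<^sub>c (M * N)"
  proof (rule rfmat_eqI)
    fix y z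
    show "entry (c *\<^sub>c M * N) y z = entry (c *\<^sub>c (M * N)) y z"
      by (simp, subst (1 2) entry_mult[OF finite_row[of M y]]) (auto simp: sum_distrib_left mult_ac)
  qed
  show "M * (c *\<^sub>c N) = c *\<^sub>c (M * N)"
    by (rule rfmat_eqI) (simp add: entry_ops(6) row_mult_def sum_distrib_left mult_ac)
qed (rule rfmat_eqI, simp)+

lemma cscale_distrib:
  "c *\<^sub>c (M + N) = c *\<^sub>c M + c *\<^sub>c N"
  "c *\<^sub>c (M - N) = c *\<^sub>c M - c *\<^sub>c N"
  "(c + d) *\<^sub>c M = c *\<^sub>c M + d *\<^sub>c M"
  "(c - d) *\<^sub>c M = c *\<^sub>c M - d *\<^sub>c M"
  "(- c) *\<^sub>c M = - (c *\<^sub>c M)"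
  "c *\<^sub>c (- M) = - (c *\<^sub>c M)"
  by (rule rfmat_eqI, simp add: ring_distribs)+

lemma cscale_sum: "c *\<^sub>c (\<Sum>i\<in>I. f i) = (\<Sum>i\<in>I. c *\<^sub>c f i)"
  by (rule rfmat_eqI) (simp add: sum_distrib_left)

lemma cscale_eq_0_iff [simp]: "c *\<^sub>c M = 0 \<longleftrightarrow> c = 0 \<or> M = 0"
proof
  assume *: "c *\<^sub>c M = 0"
  show "c = 0 \<or> M = 0"
  proof (cases "c = 0")
    case False
    have "M = inverse c *\<^sub>c c *\<^sub>c M" using False by simp
    also have "\<dots> = 0" unfolding * by simp
    finally show ?thesis ..
  qed simp
qed auto

subsection \<open>Diagonal matrices\<close>

definition diag :: "('a \<Rightarrow> complex) \<Rightarrow> 'a rfmat" where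
  "diag f = Rfmat (\<lambda>y z. if y = z then f y else 0)"

lemma entry_diag [simp]: "entry (diag f) y z = (if y = z then f y else 0)"
  unfolding diag_def by (subst entry_Rfmat) auto

lemma entry_diag_mult [simp]: "entry (diag f * M) y z = f y * entry M y z"
  by (subst entry_mult[of "{y}"]) (auto split: if_splits)

lemma entry_mult_diag [simp]: "entry (M * diag f) y z = entry M y z * f z"
  by (subst entry_mult[of "insert z {w. entry M y w \<noteq> 0}"])
    (auto simp: finite_row if_distrib[of "(*) _"] cong: if_cong)

lemma diag_mult: "diag f * diag g = diag (\<lambda>y. f y * g y)"
  by (rule rfmat_eqI) simp

lemma diag_commute: "diag f * diag g = diag g * diag f"
  by (simp add: diag_mult mult.commute)

subsection \<open>Polynomials in a matrix\<close>

text \<open>The value \<open>p(C)\<close> of a polynomial at a matrix. The library function \<open>poly\<close> does not apply,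
  since the ring of matrices is not commutative.\<close>

definition poly_at :: "complex poly \<Rightarrow> 'a rfmat \<Rightarrow> 'a rfmat" where
  "poly_at p C = fold_coeffs (\<lambda>a M. a *\<^sub>c 1 + C * M) p 0"

lemma poly_at_0 [simp]: "poly_at 0 C = 0"
  by (simp add: poly_at_def)

lemma poly_at_pCons: "poly_at (pCons a p) C = a *\<^sub>c 1 + C * poly_at p C"
  by (cases "p = 0 \<and> a = 0") (auto simp: poly_at_def)

lemma poly_at_add: "poly_at (p + q) C = poly_at p C + poly_at q C"
proof (induction p arbitrary: q)
  case (pCons a p)
  then show ?case
    by (cases q) (simp add: poly_at_pCons cscale_distrib algebra_simps)
qed simp

lemma poly_at_smult: "poly_at (smult c p) C = c *\<^sub>c poly_at p C"
  by (induction p) (simp_all add: poly_at_pCons cscale_distrib)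

lemma poly_at_mult: "poly_at (p * q) C = poly_at p C * poly_at q C"
  by (induction p) (simp_all add: poly_at_pCons poly_at_add poly_at_smult algebra_simps)

lemma poly_at_one [simp]: "poly_at 1 C = 1"
  by (simp add: one_pCons poly_at_pCons)

lemma poly_at_diff: "poly_at (p - q) C = poly_at p C - poly_at q C"
  using poly_at_add[of "p - q" q C] by simp

lemma poly_at_sum: "poly_at (\<Sum>i\<in>I. p i) C = (\<Sum>i\<in>I. poly_at (p i) C)"
  by (induction I rule: infinite_finite_induct) (auto simp: poly_at_add)

lemma poly_at_commute:
  assumes "C * M = M * C"
  shows "poly_at p C * M = M * poly_at p C"
proof (induction p)
  case (pCons a p)
  have "C * poly_at p C * M = C * M * poly_at p C"
    by (simp add: mult.assoc pCons)
  then show ?case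
    by (simp add: poly_at_pCons ring_distribs assms mult.assoc)
qed simp

lemma poly_at_eigen:
  assumes "C * M = \<theta> *\<^sub>c M"
  shows "poly_at p C * M = poly p \<theta> *\<^sub>c M"
  by (induction p)
    (simp_all add: poly_at_pCons ring_distribs assms mult.assoc cscale_distrib mult.commute)

section \<open>Raising and lowering operators on subsets\<close>

text \<open>Matrices indexed by sets. In terms of columns, \<open>creation a\<close> sends the unit vector of a set
  not containing \<open>a\<close> to that of the set with \<open>a\<close> added, and the unit vectors of all other sets to
  zero; \<open>annihilation a\<close> is its transpose.\<close>

definition creation :: "'a \<Rightarrow> 'a set rfmat" where
  "creation a = Rfmat (\<lambda>y z. of_bool (a \<in> y \<and> z = y - {a}))"

definition annihilation :: "'a \<Rightarrow> 'a set rfmat" where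
  "annihilation a = Rfmat (\<lambda>y z. of_bool (a \<notin> y \<and> z = insert a y))"

lemma entry_creation: "entry (creation a) y z = of_bool (a \<in> y \<and> z = y - {a})"
  unfolding creation_def by (subst entry_Rfmat) (auto intro: finite_subset[of _ "{y - {a}}" for y])

lemma entry_annihilation: "entry (annihilation a) y z = of_bool (a \<notin> y \<and> z = insert a y)"
  unfolding annihilation_def
  by (subst entry_Rfmat) (auto intro: finite_subset[of _ "{insert a y}" for y])

lemma entry_creation_mult [simp]:
  "entry (creation a * M) y z = (if a \<in> y then entry M (y - {a}) z else 0)"
  by (subst entry_mult[of "{y - {a}}"]) (auto simp: entry_creation)

lemma entry_annihilation_mult [simp]:
  "entry (annihilation a * M) y z = (if a \<notin> y then entry M (insert a y) z else 0)"
  by (subst entry_mult[of "{insert a y}"]) (auto simp: entry_annihilation)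

lemma rfmat_eqI_left: "(\<And>M y z. entry (A * M) y z = entry (B * M) y z) \<Longrightarrow> A = B"
  by (rule rfmat_eqI) (metis mult_1_right)

lemma creation_commute: "creation a * creation b = creation b * creation a"
  by (rule rfmat_eqI_left) (auto simp: mult.assoc insert_commute Diff_insert[symmetric])

lemma annihilation_commute: "annihilation a * annihilation b = annihilation b * annihilation a"
  by (rule rfmat_eqI_left) (auto simp: mult.assoc insert_commute)

lemma annihilation_creation_commute:
  "a \<noteq> b \<Longrightarrow> annihilation a * creation b = creation b * annihilation a"
  by (rule rfmat_eqI_left) (auto simp: mult.assoc insert_Diff_if)

lemma annihilation_creation_same:
  "annihilation a * creation a - creation a * annihilation a
     = diag (\<lambda>y. if a \<in> y then -1 else 1)"
  by (rule rfmat_eqI_left) (auto simp: mult.assoc left_diff_distrib insert_absorb)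

text \<open>The inclusion matrices restricted to a finite set \<open>x\<close>: they sum over all ways to add, or to
  remove, one element of \<open>x\<close>.\<close>

definition up :: "'a set \<Rightarrow> 'a set rfmat" where
  "up x = (\<Sum>a\<in>x. creation a)"

definition down :: "'a set \<Rightarrow> 'a set rfmat" where
  "down x = (\<Sum>a\<in>x. annihilation a)"

text \<open>The diagonal matrix whose entry at \<open>y\<close> is \<open>f\<close> evaluated at \<open>|y \<inter> x|\<close>.\<close>

definition level :: "'a set \<Rightarrow> (nat \<Rightarrow> complex) \<Rightarrow> 'a set rfmat" where
  "level x f = diag (\<lambda>y. f (card (y \<inter> x)))"

lemma commute_mult: "M * A = A * M \<Longrightarrow> M * B = B * M \<Longrightarrow> M * (A * B) = A * B * M"
  for M A B :: "'b :: ring_1"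
  by (metis mult.assoc)

lemma sum_commute_left:
  fixes M :: "'b :: ring_1"
  assumes "\<And>a. a \<in> A \<Longrightarrow> f a * M = M * f a"
  shows "sum f A * M = M * sum f A"
  using assms by (simp add: sum_distrib_left sum_distrib_right)

lemma up_commute: "up x * up x' = up x' * up x"
  unfolding up_def by (intro sum_commute_left sum_commute_left[symmetric] creation_commute)

lemma down_commute: "down x * down x' = down x' * down x"
  unfolding down_def by (intro sum_commute_left sum_commute_left[symmetric] annihilation_commute)

lemma down_up_commute:
  assumes "x \<inter> x' = {}"
  shows "down x * up x' = up x' * down x"
  unfolding up_def down_def using assms
  by (intro sum_commute_left sum_commute_left[symmetric] annihilation_creation_commute) auto

text \<open>With the next lemma, \<open>up x\<close>, \<open>down x\<close> and the diagonal matrix with entries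
  \<open>|x| - 2 |y \<inter> x|\<close> satisfy the relations of the Lie algebra \<open>sl(2)\<close>.\<close>

lemma down_up_same:
  assumes "finite x"
  shows "down x * up x = up x * down x + level x (\<lambda>k. of_nat (card x) - 2 * of_nat k)"
proof -
  have "down x * up x - up x * down x
      = (\<Sum>a\<in>x. \<Sum>b\<in>x. annihilation a * creation b - creation b * annihilation a)"
    unfolding up_def down_def sum_product sum.swap[of "\<lambda>b a. creation b * annihilation a"]
      sum_subtractf ..
  also have "\<dots> = (\<Sum>a\<in>x. \<Sum>b\<in>x. if b = a then diag (\<lambda>y. if a \<in> y then -1 else 1) else 0)"
    by (intro sum.cong refl) (auto simp: annihilation_creation_same annihilation_creation_commute)
  also have "\<dots> = (\<Sum>a\<in>x. diag (\<lambda>y. if a \<in> y then -1 else 1))"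
    using assms by simp
  also have "\<dots> = level x (\<lambda>k. of_nat (card x) - 2 * of_nat k)"
  proof (rule rfmat_eqI)
    fix y z
    have "(\<Sum>a\<in>x. if a \<in> y then -1 else 1 :: complex)
        = (\<Sum>a\<in>x. 1 - 2 * of_bool (a \<in> y))"
      by (intro sum.cong) auto
    also have "\<dots> = of_nat (card x) - 2 * of_nat (card (y \<inter> x))"
      using assms by (simp add: sum_subtractf sum_distrib_left[symmetric] Int_def conj_commute)
    finally show "entry (\<Sum>a\<in>x. diag (\<lambda>y. if a \<in> y then -1 else 1)) y z
        = entry (level x (\<lambda>k. of_nat (card x) - 2 * of_nat k)) y z"
      by (cases "y = z") (simp_all add: level_def)
  qed
  finally show ?thesis by (simp add: algebra_simps)
qed

lemma level_commute: "level x f * level x' g = level x' g * level x f"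
  by (simp add: level_def diag_commute)

lemma level_diff: "level x f - level x g = level x (\<lambda>k. f k - g k)"
  by (rule rfmat_eqI) (simp add: level_def)

lemma level_add: "level x f + level x g = level x (\<lambda>k. f k + g k)"
  by (rule rfmat_eqI) (simp add: level_def)

lemma level_const: "level x (\<lambda>_. c) = c *\<^sub>c 1"
  by (rule rfmat_eqI) (simp add: level_def)

lemma level_cong:
  assumes "finite x" "\<And>k. k \<le> card x \<Longrightarrow> f k = g k"
  shows "level x f = level x g"
  unfolding level_def using assms by (auto intro!: rfmat_eqI simp: card_mono)

lemma level_up:
  assumes "finite x"
  shows "level x f * up x = up x * level x (\<lambda>k. f (Suc k))"
proof (rule rfmat_eqI)
  fix y z :: "'a set"
  have *: "Suc (card ((y - {a}) \<inter> x)) = card (y \<inter> x)" if "a \<in> x" "a \<in> y" for a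
    using assms that card_Suc_Diff1[of "y \<inter> x" a] by (simp add: Int_Diff Diff_Int_distrib2)
  show "entry (level x f * up x) y z = entry (up x * level x (\<lambda>k. f (Suc k))) y z"
    by (auto simp: up_def level_def sum_distrib_left sum_distrib_right entry_creation * intro!: sum.cong)
qed

lemma down_level:
  assumes "finite x"
  shows "down x * level x f = level x (\<lambda>k. f (Suc k)) * down x"
proof (rule rfmat_eqI)
  fix y z :: "'a set"
  have *: "card (insert a (y \<inter> x)) = Suc (card (y \<inter> x))" if "a \<in> x" "a \<notin> y" for a
    using assms that by simp
  show "entry (down x * level x f) y z = entry (level x (\<lambda>k. f (Suc k)) * down x) y z"
    by (auto simp: down_def level_def sum_distrib_left sum_distrib_right entry_annihilation
        intro!: sum.cong) (metis *)
qed

lemma disjoint_level_up: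
  assumes "x \<inter> x' = {}"
  shows "level x f * up x' = up x' * level x f"
proof (rule rfmat_eqI)
  fix y z :: "'a set"
  have *: "(y - {a}) \<inter> x = y \<inter> x" if "a \<in> x'" for a
    using assms that by auto
  show "entry (level x f * up x') y z = entry (up x' * level x f) y z"
    by (auto simp: up_def level_def sum_distrib_left sum_distrib_right entry_creation * intro!: sum.cong)
qed

lemma disjoint_level_down:
  assumes "x \<inter> x' = {}"
  shows "level x f * down x' = down x' * level x f"
proof (rule rfmat_eqI)
  fix y z :: "'a set"
  have *: "insert a y \<inter> x = y \<inter> x" if "a \<in> x'" for a
    using assms that by auto
  show "entry (level x f * down x') y z = entry (down x' * level x f) y z"
    by (auto simp: down_def level_def sum_distrib_left sum_distrib_right entry_annihilation * intro!: sum.cong)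
qed

text \<open>The projection onto the subsets of a ground set \<open>V\<close>.\<close>

definition ground :: "'a set \<Rightarrow> 'a set rfmat" where
  "ground V = diag (\<lambda>y. of_bool (y \<subseteq> V))"

lemma ground_level: "ground V * level x f = level x f * ground V"
  by (simp add: ground_def level_def diag_commute)

lemma ground_up:
  assumes "x \<subseteq> V"
  shows "ground V * up x = up x * ground V"
  unfolding up_def using assms
  by (intro sum_commute_left[symmetric] rfmat_eqI) (auto simp: ground_def entry_creation)

lemma ground_down:
  assumes "x \<subseteq> V"
  shows "ground V * down x = down x * ground V"
  unfolding down_def using assms
  by (intro sum_commute_left[symmetric] rfmat_eqI) (auto simp: ground_def entry_annihilation)

section \<open>The Casimir element and its idempotents\<close>

text \<open>\<open>cas v r\<close> is the eigenvalue \<open>r (v + 1 - r)\<close> of the Casimir element on the isotypic component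
  of lowest layer \<open>r\<close> for a set of size \<open>v\<close>.\<close>

definition cas :: "nat \<Rightarrow> nat \<Rightarrow> complex" where
  "cas v r = of_nat r * (of_nat v + 1 - of_nat r)"

text \<open>This normalisation commutes with \<open>up x\<close> and \<open>down x\<close>, and it turns the products
  \<open>up x * down x\<close> and \<open>down x * up x\<close> into a scalar minus the Casimir element on every layer.\<close>

definition casimir :: "'a set \<Rightarrow> 'a set rfmat" where
  "casimir x = level x (cas (card x)) - up x * down x"

lemma up_down_casimir: "up x * down x = level x (cas (card x)) - casimir x"
  by (simp add: casimir_def)

lemma down_up_casimir:
  assumes "finite x"
  shows "down x * up x = level x (\<lambda>k. cas (card x) (Suc k)) - casimir x"
  using assms by (simp add: down_up_same casimir_def algebra_simps level_add level_diff)
    (simp add: cas_def algebra_simps)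

lemma casimir_up:
  assumes "finite x"
  shows "casimir x * up x = up x * casimir x"
proof -
  have "casimir x * up x = up x * (level x (\<lambda>k. cas (card x) (Suc k)) - down x * up x)"
    using assms by (simp add: casimir_def algebra_simps level_up)
  then show ?thesis
    using assms by (simp add: down_up_casimir)
qed

lemma casimir_down:
  assumes "finite x"
  shows "casimir x * down x = down x * casimir x"
proof -
  have "down x * casimir x = (level x (\<lambda>k. cas (card x) (Suc k)) - down x * up x) * down x"
    using assms by (simp add: casimir_def algebra_simps down_level)
  then show ?thesis
    using assms by (simp add: down_up_casimir)
qed

lemma casimir_level:
  assumes "finite x"
  shows "casimir x * level x f = level x f * casimir x"
proof -
  have "up x * (down x * level x f) = level x f * (up x * down x)"
    using assms by (simp add: down_level mult.assoc[symmetric] level_up)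
  then show ?thesis
    by (simp add: casimir_def algebra_simps level_commute)
qed

lemma casimir_commuteI:
  assumes "M * up x = up x * M" "M * down x = down x * M" "\<And>f. M * level x f = level x f * M"
  shows "casimir x * M = M * casimir x"
proof -
  have "up x * (down x * M) = M * (up x * down x)"
    by (metis assms(1,2) mult.assoc)
  then show ?thesis
    by (simp add: casimir_def algebra_simps assms(3))
qed

text \<open>The projection onto the sets that meet \<open>x\<close> in exactly \<open>k\<close> points.\<close>

abbreviation layer :: "'a set \<Rightarrow> nat \<Rightarrow> 'a set rfmat" where
  "layer x k \<equiv> level x (\<lambda>l. of_bool (l = k))"

lemma sum_layer:
  assumes "finite x"
  shows "(\<Sum>k\<le>card x. layer x k) = 1"
  using assms by (auto intro!: rfmat_eqI simp: level_def card_mono)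

lemma level_layer: "level x f * layer x k = f k *\<^sub>c layer x k"
  by (auto intro!: rfmat_eqI simp: level_def)

lemma layer_up_Suc:
  assumes "finite x"
  shows "layer x (Suc k) * up x = up x * layer x k"
  using assms by (simp add: level_up)

lemma layer_down:
  assumes "finite x"
  shows "layer x k * down x = down x * layer x (Suc k)"
  using assms by (simp add: down_level)

lemma down_layer_0:
  assumes "finite x"
  shows "down x * layer x 0 = 0"
  using assms by (simp add: down_level level_const)

lemma layer_beyond:
  assumes "finite x" "card x < k"
  shows "layer x k = 0"
proof -
  have "layer x k = level x (\<lambda>_. 0)"
    using assms by (intro level_cong) auto
  then show ?thesis by (simp add: level_const)
qed

lemma up_layer_top:
  assumes "finite x"
  shows "up x * layer x (card x) = 0"
  using assms by (simp add: layer_up_Suc[symmetric] layer_beyond)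

lemma cas_inj:
  assumes "r \<le> v div 2" "r' \<le> v div 2" "cas v r = cas v r'"
  shows "r = r'"
proof -
  have "(of_nat r - of_nat r') * (of_nat v + 1 - of_nat r - of_nat r') = cas v r - cas v r'"
    by (simp add: cas_def algebra_simps)
  then have "of_nat r - of_nat r' = (0 :: complex) \<or> of_nat v + 1 - of_nat r - of_nat r' = (0 :: complex)"
    using assms(3) by simp
  then have "of_nat r = (of_nat r' :: complex) \<or> of_nat (v + 1) = (of_nat (r + r') :: complex)"
    by (auto simp: algebra_simps)
  then have "r = r' \<or> v + 1 = r + r'"
    unfolding of_nat_eq_iff .
  then show ?thesis
    using assms by linarith
qed

lemma cas_diff:
  "cas v k - cas v r = (of_nat k - of_nat r) * (of_nat v + 1 - of_nat k - of_nat r)"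
  by (simp add: cas_def algebra_simps)

lemma cas_reflect: "j \<le> v \<Longrightarrow> cas v (Suc (v - j)) = cas v j"
  by (simp add: cas_def of_nat_diff algebra_simps)

text \<open>The monic polynomial with roots \<open>cas v r\<close> for \<open>r \<in> A\<close>.\<close>

definition cas_poly :: "nat \<Rightarrow> nat set \<Rightarrow> complex poly" where
  "cas_poly v A = (\<Prod>r\<in>A. [:- cas v r, 1:])"

lemma cas_poly_Suc:
  "poly_at (cas_poly v {..Suc k}) C
     = poly_at (cas_poly v {..k}) C * (C - cas v (Suc k) *\<^sub>c 1)"
proof -
  have "cas_poly v {..Suc k} = cas_poly v {..k} * [:- cas v (Suc k), 1:]"
    by (simp add: cas_poly_def mult.commute)
  then show ?thesis
    by (simp only: poly_at_mult) (simp add: poly_at_pCons cscale_distrib)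
qed

lemma cas_poly_0: "poly_at (cas_poly v {0}) C = C - cas v 0 *\<^sub>c 1"
  by (simp add: cas_poly_def poly_at_pCons cscale_distrib)

text \<open>On layer \<open>k\<close> the factor \<open>C - cas k\<close> equals \<open>- up * down\<close>, which passes to layer \<open>k - 1\<close>; so the
  first \<open>k + 1\<close> factors annihilate layer \<open>k\<close>. From the top layer downwards the same argument works
  with \<open>down * up\<close>.\<close>

lemma cas_poly_layer:
  assumes x: "finite x"
  shows "poly_at (cas_poly (card x) {..k}) (casimir x) * layer x k = 0"
proof (induction k)
  case 0
  have "up x * down x * layer x 0 = 0"
    using x by (simp add: mult.assoc down_layer_0)
  then show ?case
    by (simp add: cas_poly_0) (simp add: casimir_def left_diff_distrib level_layer)
next
  case (Suc k)
  let ?p = "poly_at (cas_poly (card x) {..k}) (casimir x)"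
  have "(casimir x - cas (card x) (Suc k) *\<^sub>c 1) * layer x (Suc k) = - (up x * (down x * layer x (Suc k)))"
    by (simp add: casimir_def left_diff_distrib level_layer mult.assoc)
  also have "down x * layer x (Suc k) = layer x k * down x"
    using x by (simp add: layer_down)
  finally have "poly_at (cas_poly (card x) {..Suc k}) (casimir x) * layer x (Suc k)
      = - (?p * up x * layer x k * down x)"
    by (simp add: cas_poly_Suc mult.assoc)
  also have "?p * up x = up x * ?p"
    using x by (intro poly_at_commute casimir_up)
  finally show ?case
    by (simp add: mult.assoc) (simp add: mult.assoc[symmetric] Suc)
qed

lemma cas_poly_layer_top:
  assumes x: "finite x" and "j \<le> card x"
  shows "poly_at (cas_poly (card x) {..j}) (casimir x) * layer x (card x - j) = 0"
  using assms(2)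
proof (induction j)
  case 0
  have "down x * up x * layer x (card x) = 0"
    using x by (simp add: mult.assoc up_layer_top)
  then have "casimir x * layer x (card x) = cas (card x) (Suc (card x)) *\<^sub>c layer x (card x)"
    using x by (simp add: down_up_casimir left_diff_distrib level_layer)
  then show ?case
    using cas_reflect[of 0 "card x"] by (simp add: cas_poly_0 left_diff_distrib)
next
  case (Suc j)
  let ?p = "poly_at (cas_poly (card x) {..j}) (casimir x)"
  let ?k = "card x - Suc j"
  have k: "Suc ?k = card x - j"
    using Suc.prems by simp
  have "casimir x * layer x ?k = cas (card x) (Suc ?k) *\<^sub>c layer x ?k - down x * (up x * layer x ?k)"
    using x by (simp add: down_up_casimir mult.assoc[symmetric] left_diff_distrib level_layer)
  also have "up x * layer x ?k = layer x (card x - j) * up x"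
    unfolding k[symmetric] using x by (simp add: layer_up_Suc)
  also have "cas (card x) (Suc ?k) = cas (card x) (Suc j)"
    using Suc.prems by (intro cas_reflect)
  finally have "poly_at (cas_poly (card x) {..Suc j}) (casimir x) * layer x ?k
      = - (?p * down x * layer x (card x - j) * up x)"
    by (simp add: cas_poly_Suc mult.assoc left_diff_distrib)
  also have "?p * down x = down x * ?p"
    using x by (intro poly_at_commute casimir_down)
  finally show ?case
    using Suc by (simp add: mult.assoc)
qed

lemma cas_poly_casimir:
  assumes x: "finite x"
  shows "poly_at (cas_poly (card x) {..card x div 2}) (casimir x) = 0"
proof -
  let ?h = "card x div 2"
  let ?p = "\<lambda>j. poly_at (cas_poly (card x) {..j}) (casimir x)"
  have dvd: "?p ?h * M = 0" if "j \<le> ?h" "?p j * M = 0" for j M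
  proof -
    have "{..?h} = {Suc j..?h} \<union> {..j}"
      using that(1) by auto
    then have "cas_poly (card x) {..?h} = cas_poly (card x) {Suc j..?h} * cas_poly (card x) {..j}"
      unfolding cas_poly_def by (simp only:) (rule prod.union_disjoint, auto)
    then show ?thesis
      by (simp add: poly_at_mult mult.assoc that(2))
  qed
  \<comment> \<open>A layer is within distance \<open>|x| div 2\<close> of the bottom or of the top.\<close>
  have "?p ?h * layer x k = 0" if "k \<le> card x" for k
  proof (cases "k \<le> ?h")
    case True
    then show ?thesis
      using cas_poly_layer[OF x] by (rule dvd)
  next
    case False
    then have "card x - k \<le> ?h" by linarith
    then show ?thesis
      using cas_poly_layer_top[OF x, of "card x - k"] that dvd by simp
  qed
  then have "?p ?h * (\<Sum>k\<le>card x. layer x k) = 0"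
    by (simp add: sum_distrib_left)
  then show ?thesis
    using x by (simp add: sum_layer)
qed

lemma prod_linear_dvd:
  fixes p :: "complex poly"
  assumes "finite A" "\<And>a. a \<in> A \<Longrightarrow> poly p a = 0"
  shows "(\<Prod>a\<in>A. [:- a, 1:]) dvd p"
  using assms
proof (induction A arbitrary: p rule: finite_induct)
  case (insert a A)
  then obtain q where q: "p = [:- a, 1:] * q"
    by (meson insertI1 poly_eq_0_iff_dvd dvdE)
  have "poly q b = 0" if "b \<in> A" for b
    using insert.prems[of b] insert.hyps that by (auto simp: q)
  then show ?case
    using insert by (simp add: q del: mult_pCons_left)
qed simp

text \<open>The Casimir element is annihilated by a polynomial with simple roots, so a polynomial in it
  depends only on the values at these roots.\<close>

lemma poly_at_casimir_cong:
  assumes "finite x" "\<And>r. r \<le> card x div 2 \<Longrightarrow> poly p (cas (card x) r) = poly q (cas (card x) r)"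
  shows "poly_at p (casimir x) = poly_at q (casimir x)"
proof -
  have "inj_on (cas (card x)) {..card x div 2}"
    by (auto intro: inj_onI cas_inj)
  then have "cas_poly (card x) {..card x div 2} = (\<Prod>a\<in>cas (card x) ` {..card x div 2}. [:- a, 1:])"
    by (simp add: cas_poly_def prod.reindex)
  also have "\<dots> dvd p - q"
    using assms(2) by (intro prod_linear_dvd) auto
  finally obtain g where "p - q = cas_poly (card x) {..card x div 2} * g"
    by (rule dvdE)
  then have "poly_at (p - q) (casimir x) = 0"
    using assms(1) by (simp add: poly_at_mult cas_poly_casimir)
  then show ?thesis
    by (simp add: poly_at_diff)
qed

text \<open>The interpolation polynomial that is 1 at \<open>cas v r\<close> and 0 at the other eigenvalues.\<close>

definition lagrange :: "nat \<Rightarrow> nat \<Rightarrow> complex poly" where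
  "lagrange v r = smult (inverse (poly (cas_poly v ({..v div 2} - {r})) (cas v r)))
     (cas_poly v ({..v div 2} - {r}))"

lemma poly_lagrange:
  assumes "r \<le> v div 2" "r' \<le> v div 2"
  shows "poly (lagrange v r) (cas v r') = of_bool (r' = r)"
proof (cases "r' = r")
  case True
  have "poly (cas_poly v ({..v div 2} - {r})) (cas v r) \<noteq> 0"
    using assms by (auto simp: cas_poly_def poly_prod dest: cas_inj[rotated 2])
  then show ?thesis
    using True by (simp add: lagrange_def)
next
  case False
  then have "poly (cas_poly v ({..v div 2} - {r})) (cas v r') = 0"
    using assms by (auto simp: cas_poly_def poly_prod)
  then show ?thesis
    using False by (simp add: lagrange_def)
qed

text \<open>The projection onto the isotypic component of lowest layer \<open>r\<close>.\<close>

definition isotypic :: "'a set \<Rightarrow> nat \<Rightarrow> 'a set rfmat" where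
  "isotypic x r = poly_at (lagrange (card x) r) (casimir x)"

lemma isotypic_mult:
  assumes "finite x" "r \<le> card x div 2" "r' \<le> card x div 2"
  shows "isotypic x r * isotypic x r' = (if r = r' then isotypic x r else 0)"
proof -
  have "isotypic x r * isotypic x r' = poly_at (lagrange (card x) r * lagrange (card x) r') (casimir x)"
    by (simp add: isotypic_def poly_at_mult)
  also have "\<dots> = poly_at (if r = r' then lagrange (card x) r else 0) (casimir x)"
    using assms by (intro poly_at_casimir_cong) (auto simp: poly_lagrange)
  finally show ?thesis
    by (simp add: isotypic_def)
qed

lemma sum_isotypic:
  assumes "finite x"
  shows "(\<Sum>r\<le>card x div 2. isotypic x r) = 1"
proof -
  have "(\<Sum>r\<le>card x div 2. isotypic x r)
      = poly_at (\<Sum>r\<le>card x div 2. lagrange (card x) r) (casimir x)"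
    by (simp add: isotypic_def poly_at_sum)
  also have "\<dots> = poly_at 1 (casimir x)"
    using assms by (intro poly_at_casimir_cong) (simp_all add: poly_sum poly_lagrange)
  finally show ?thesis
    by simp
qed

lemma casimir_isotypic:
  assumes "finite x" "r \<le> card x div 2"
  shows "casimir x * isotypic x r = cas (card x) r *\<^sub>c isotypic x r"
proof -
  have "casimir x * isotypic x r = poly_at ([:0, 1:] * lagrange (card x) r) (casimir x)"
    by (simp add: isotypic_def poly_at_mult poly_at_pCons del: mult_pCons_left)
  also have "\<dots> = poly_at (smult (cas (card x) r) (lagrange (card x) r)) (casimir x)"
    using assms by (intro poly_at_casimir_cong) (auto simp: poly_lagrange)
  finally show ?thesis
    by (simp add: isotypic_def poly_at_smult)
qed

lemma isotypic_commute: "casimir x * M = M * casimir x \<Longrightarrow> isotypic x r * M = M * isotypic x r"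
  unfolding isotypic_def by (rule poly_at_commute)

lemma isotypic_eigen:
  assumes "r \<le> card x div 2" "casimir x * M = cas (card x) r *\<^sub>c M"
  shows "isotypic x r * M = M"
  using poly_at_eigen[OF assms(2), of "lagrange (card x) r"] assms(1)
  by (simp add: isotypic_def poly_lagrange)

text \<open>The component of lowest layer \<open>r\<close> lives on the layers \<open>r, \<dots>, |x| - r\<close>.\<close>

lemma layer_isotypic_0:
  assumes x: "finite x" and r: "r \<le> card x div 2" and k: "k < r \<or> card x - r < k"
  shows "layer x k * isotypic x r = 0"
proof -
  let ?e = "isotypic x r" and ?c = "cas (card x)"
  have comm: "?e * up x = up x * ?e" "?e * down x = down x * ?e"
    using x by (simp_all add: isotypic_commute casimir_up casimir_down)
  have ne: "?c k \<noteq> ?c r" if "k < r" for k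
    using cas_inj[of k "card x" r] that r by auto
  have low: "layer x k * ?e = 0" if "k < r" for k
    using that
  proof (induction k)
    case 0
    have "0 = up x * (down x * layer x 0) * ?e"
      using x by (simp add: down_layer_0)
    also have "\<dots> = (level x ?c - casimir x) * layer x 0 * ?e"
      by (simp add: mult.assoc[symmetric] up_down_casimir)
    also have "\<dots> = (?c 0 - ?c r) *\<^sub>c (layer x 0 * ?e)"
      using x r by (simp add: left_diff_distrib level_layer casimir_level mult.assoc
          casimir_isotypic cscale_distrib)
    finally show ?case
      using ne[OF 0] by simp
  next
    case (Suc k)
    have "0 = up x * (layer x k * ?e) * down x"
      using Suc by simp
    also have "\<dots> = up x * (down x * layer x (Suc k)) * ?e"
      using x by (simp add: layer_down[symmetric] comm mult.assoc)
    also have "\<dots> = (level x ?c - casimir x) * layer x (Suc k) * ?e"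
      by (simp add: mult.assoc[symmetric] up_down_casimir)
    also have "\<dots> = (?c (Suc k) - ?c r) *\<^sub>c (layer x (Suc k) * ?e)"
      using x r by (simp add: left_diff_distrib level_layer casimir_level mult.assoc
          casimir_isotypic cscale_distrib)
    finally show ?case
      using ne[OF Suc.prems] by simp
  qed
  have high: "layer x (card x - j) * ?e = 0" if "j < r" for j
    using that
  proof (induction j)
    case 0
    have "0 = down x * (up x * layer x (card x)) * ?e"
      using x by (simp add: up_layer_top)
    also have "\<dots> = (level x (\<lambda>k. ?c (Suc k)) - casimir x) * layer x (card x) * ?e"
      using x by (simp add: mult.assoc[symmetric] down_up_casimir)
    also have "\<dots> = (?c (Suc (card x)) - ?c r) *\<^sub>c (layer x (card x) * ?e)"
      using x r by (simp add: left_diff_distrib level_layer casimir_level mult.assoc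
          casimir_isotypic cscale_distrib)
    also have "?c (Suc (card x)) = ?c 0"
      using cas_reflect[of 0 "card x"] by simp
    finally show ?case
      using ne[OF 0] by simp
  next
    case (Suc j)
    let ?k = "card x - Suc j"
    have k: "Suc ?k = card x - j"
      using Suc.prems r by simp
    have "0 = down x * (layer x (Suc ?k) * ?e) * up x"
      unfolding k using Suc by simp
    also have "\<dots> = down x * (up x * layer x ?k) * ?e"
      using x by (simp only: layer_up_Suc[symmetric] comm mult.assoc)
    also have "\<dots> = (level x (\<lambda>k. ?c (Suc k)) - casimir x) * layer x ?k * ?e"
      using x by (simp add: mult.assoc[symmetric] down_up_casimir)
    also have "\<dots> = (?c (Suc ?k) - ?c r) *\<^sub>c (layer x ?k * ?e)"
      using x r by (simp add: left_diff_distrib level_layer casimir_level mult.assoc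
          casimir_isotypic cscale_distrib)
    also have "?c (Suc ?k) = ?c (Suc j)"
      using Suc.prems r by (intro cas_reflect) simp
    finally show ?case
      using ne[OF Suc.prems] by simp
  qed
  consider "k < r" | "card x - r < k" "k \<le> card x" | "card x < k"
    using k by linarith
  then show ?thesis
  proof cases
    case 2
    then show ?thesis
      using high[of "card x - k"] by simp
  qed (use low x in \<open>auto simp: layer_beyond\<close>)
qed

section \<open>Nonvanishing of the isotypic components\<close>

text \<open>Vectors are encoded as matrices with a single nonzero column, the one at the empty set. The
  unit vector of the empty set is the following projection.\<close>

definition vacuum :: "'a set rfmat" where
  "vacuum = diag (\<lambda>y. of_bool (y = {}))"

text \<open>The product over all pairs \<open>(a, b)\<close> of the operators \<open>creation a - creation b\<close>, applied to the
  vacuum. If the pairs are disjoint, this is annihilated by \<open>down x\<close> as soon as \<open>x\<close> contains both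
  or none of the points of each pair.\<close>

fun pair_state :: "('a \<times> 'a) list \<Rightarrow> 'a set rfmat" where
  "pair_state [] = vacuum"
| "pair_state ((a, b) # ps) = (creation a - creation b) * pair_state ps"

text \<open>The points of all pairs, in the order that makes \<open>distinct\<close> express disjointness.\<close>

definition points :: "('a \<times> 'a) list \<Rightarrow> 'a list" where
  "points ps = map fst ps @ map snd ps"

lemma pair_state_support:
  assumes "entry (pair_state ps) y z \<noteq> 0"
  shows "y \<subseteq> set (points ps) \<and> z = {}"
  using assms
proof (induction ps arbitrary: y rule: pair_state.induct)
  case 1
  then show ?case
    by (auto simp: vacuum_def split: if_splits)
next
  case (2 a b ps)
  have "(a \<in> y \<and> entry (pair_state ps) (y - {a}) z \<noteq> 0) \<or> (b \<in> y \<and> entry (pair_state ps) (y - {b}) z \<noteq> 0)"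
    using 2(2) by (auto simp: left_diff_distrib split: if_splits)
  then have "y - {a} \<subseteq> set (points ps) \<and> z = {} \<or> y - {b} \<subseteq> set (points ps) \<and> z = {}"
    using 2(1) by blast
  then show ?case
    by (auto simp: points_def)
qed

lemma pair_state_card:
  assumes "finite x" "\<And>a b. (a, b) \<in> set ps \<Longrightarrow> a \<in> x \<longleftrightarrow> b \<in> x" "entry (pair_state ps) y z \<noteq> 0"
  shows "card (y \<inter> x) = length (filter (\<lambda>p. fst p \<in> x) ps)"
  using assms(2,3)
proof (induction ps arbitrary: y rule: pair_state.induct)
  case 1
  then show ?case
    by (auto simp: vacuum_def split: if_splits)
next
  case (2 a b ps)
  have "(a \<in> y \<and> entry (pair_state ps) (y - {a}) z \<noteq> 0) \<or> (b \<in> y \<and> entry (pair_state ps) (y - {b}) z \<noteq> 0)"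
    using 2(3) by (auto simp: left_diff_distrib split: if_splits)
  then obtain c where c: "c \<in> {a, b}" "c \<in> y" "entry (pair_state ps) (y - {c}) z \<noteq> 0"
    by blast
  have "card ((y - {c}) \<inter> x) = length (filter (\<lambda>p. fst p \<in> x) ps)"
    using 2 c by auto
  moreover have "card (y \<inter> x) = (if c \<in> x then Suc (card ((y - {c}) \<inter> x)) else card ((y - {c}) \<inter> x))"
  proof (cases "c \<in> x")
    case True
    then show ?thesis
      using assms(1) c card_Suc_Diff1[of "y \<inter> x" c] by (simp add: Int_Diff Diff_Int_distrib2)
  next
    case False
    then have "(y - {c}) \<inter> x = y \<inter> x" by auto
    then show ?thesis using False by simp
  qed
  ultimately show ?case
    using c 2(2)[of a b] by auto
qed

lemma pair_state_nonzero:
  assumes "distinct (points ps)"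
  shows "entry (pair_state ps) (fst ` set ps) {} = 1"
  using assms
proof (induction ps rule: pair_state.induct)
  case (2 a b ps)
  have "insert a (fst ` set ps) - {a} = fst ` set ps" "b \<notin> insert a (fst ` set ps)"
    using 2(2) by (auto simp: points_def)
  then show ?case
    using 2 by (simp add: left_diff_distrib points_def)
qed (simp add: vacuum_def)

lemma down_creation:
  assumes "finite x"
  shows "down x * creation a = creation a * down x
    + (if a \<in> x then diag (\<lambda>y. if a \<in> y then -1 else 1) else 0)"
proof -
  have "down x * creation a - creation a * down x
      = (\<Sum>b\<in>x. annihilation b * creation a - creation a * annihilation b)"
    by (simp add: down_def sum_distrib_left sum_distrib_right sum_subtractf)
  also have "\<dots> = (\<Sum>b\<in>x. if b = a then diag (\<lambda>y. if a \<in> y then -1 else 1) else 0)"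
    by (intro sum.cong refl) (auto simp: annihilation_creation_same annihilation_creation_commute)
  finally show ?thesis
    using assms by (simp add: algebra_simps)
qed

lemma down_pair_state:
  assumes "finite x" "distinct (points ps)" "\<And>a b. (a, b) \<in> set ps \<Longrightarrow> a \<in> x \<longleftrightarrow> b \<in> x"
  shows "down x * pair_state ps = 0"
  using assms(2,3)
proof (induction ps rule: pair_state.induct)
  case 1
  show ?case
    by (rule rfmat_eqI)
      (auto simp: down_def sum_distrib_right vacuum_def entry_annihilation intro!: sum.neutral)
next
  case (2 a b ps)
  let ?W = "pair_state ps"
  have IH: "down x * ?W = 0"
    using 2 by (auto simp: points_def)
  have ab: "a \<in> x \<longleftrightarrow> b \<in> x"
    using 2(3) by auto
  have sgn: "diag (\<lambda>y. if c \<in> y then -1 else 1) * ?W = ?W" if "c \<in> {a, b}" for c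
  proof (rule rfmat_eqI)
    fix y z
    have "c \<notin> set (points ps)"
      using 2(2) that by (auto simp: points_def)
    then show "entry (diag (\<lambda>y. if c \<in> y then -1 else 1) * ?W) y z = entry ?W y z"
      using pair_state_support[of ps y z] by auto
  qed
  have "down x * pair_state ((a, b) # ps)
      = (down x * creation a) * ?W - (down x * creation b) * ?W"
    by (simp add: algebra_simps)
  also have "\<dots> = 0"
    using assms(1) ab by (simp add: down_creation ring_distribs mult.assoc IH sgn)
  finally show ?case .
qed

lemma exists_pairs:
  assumes "finite x" "2 * r \<le> card x"
  obtains ps where "length ps = r" "distinct (points ps)" "set (points ps) \<subseteq> x"
proof -
  obtain xs where xs: "set xs = x" "distinct xs"
    using finite_distinct_list[OF assms(1)] by blast
  then have len: "2 * r \<le> length xs"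
    using assms(2) distinct_card by fastforce
  define ps where "ps = zip (take r xs) (take r (drop r xs))"
  have "points ps = take (r + r) xs"
    using len by (simp add: points_def ps_def take_add)
  then show thesis
    using that[of ps] xs len by (auto simp: ps_def dest: in_set_takeD)
qed

text \<open>A common lowest weight vector of two disjoint sets, made from \<open>r\<close> pairs inside \<open>x\<close> and \<open>s\<close>
  pairs inside \<open>x'\<close>.\<close>

lemma exists_lowest_state:
  assumes fin: "finite x" "finite x'" and dis: "x \<inter> x' = {}"
    and r: "2 * r \<le> card x" and s: "2 * s \<le> card x'" and V: "x \<union> x' \<subseteq> V"
  obtains W where "W \<noteq> 0" "W * vacuum = W" "ground V * W = W"
    "down x * W = 0" "down x' * W = 0"
    "\<And>f. level x f * W = f r *\<^sub>c W" "\<And>f. level x' f * W = f s *\<^sub>c W"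
proof -
  obtain ps where ps: "length ps = r" "distinct (points ps)" "set (points ps) \<subseteq> x"
    using exists_pairs[OF fin(1) r] .
  obtain qs where qs: "length qs = s" "distinct (points qs)" "set (points qs) \<subseteq> x'"
    using exists_pairs[OF fin(2) s] .
  define W where "W = pair_state (ps @ qs)"
  have dist: "distinct (points (ps @ qs))"
  proof -
    have d: "set (points ps) \<inter> set (points qs) = {}"
      using ps(3) qs(3) dis by blast
    have "distinct (points (ps @ qs)) \<longleftrightarrow> distinct (points ps @ points qs)"
      unfolding points_def distinct_append by auto
    then show ?thesis
      using ps(2) qs(2) d by simp
  qed
  have mem: "a \<in> set (points zs)" "b \<in> set (points zs)" if "(a, b) \<in> set zs" for a b zs
    using image_eqI[of a fst "(a, b)" "set zs"] image_eqI[of b snd "(a, b)" "set zs"] that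
    by (simp_all add: points_def)
  have inx: "a \<in> x \<and> b \<in> x \<and> a \<notin> x' \<and> b \<notin> x'" if "(a, b) \<in> set ps" for a b
    using mem[OF that] ps(3) dis by blast
  have inx': "a \<in> x' \<and> b \<in> x' \<and> a \<notin> x \<and> b \<notin> x" if "(a, b) \<in> set qs" for a b
    using mem[OF that] qs(3) dis by blast
  have iff: "a \<in> x \<longleftrightarrow> b \<in> x" "a \<in> x' \<longleftrightarrow> b \<in> x'" if "(a, b) \<in> set (ps @ qs)" for a b
    using that inx inx' by auto
  have "filter (\<lambda>p. fst p \<in> x) ps = ps" "filter (\<lambda>p. fst p \<in> x) qs = []"
    "filter (\<lambda>p. fst p \<in> x') ps = []" "filter (\<lambda>p. fst p \<in> x') qs = qs"
    using inx inx' by (fastforce simp: filter_id_conv filter_empty_conv)+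
  then have card: "card (y \<inter> x) = r" "card (y \<inter> x') = s" if "entry W y z \<noteq> 0" for y z
    using pair_state_card[where y = y and z = z and ps = "ps @ qs", OF fin(1) iff(1)]
      pair_state_card[where y = y and z = z and ps = "ps @ qs", OF fin(2) iff(2)] that ps(1) qs(1)
    by (simp_all add: W_def)
  show thesis
  proof
    show "W \<noteq> 0"
      using pair_state_nonzero[OF dist] by (auto simp: W_def)
    show "W * vacuum = W"
    proof (rule rfmat_eqI)
      show "entry (W * vacuum) y z = entry W y z" for y z
        using pair_state_support[of "ps @ qs" y z] by (auto simp: W_def vacuum_def)
    qed
    have sub: "set (points (ps @ qs)) \<subseteq> V"
      using ps(3) qs(3) V by (auto simp: points_def)
    show "ground V * W = W"
    proof (rule rfmat_eqI)
      show "entry (ground V * W) y z = entry W y z" for y z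
        using pair_state_support[of "ps @ qs" y z] sub by (auto simp: W_def ground_def)
    qed
    show "down x * W = 0" "down x' * W = 0"
      unfolding W_def using iff by (intro down_pair_state fin dist; blast)+
    show "level x f * W = f r *\<^sub>c W" for f
    proof (rule rfmat_eqI)
      show "entry (level x f * W) y z = entry (f r *\<^sub>c W) y z" for y z
        using card(1)[of y z] by (auto simp: level_def)
    qed
    show "level x' f * W = f s *\<^sub>c W" for f
    proof (rule rfmat_eqI)
      show "entry (level x' f * W) y z = entry (f s *\<^sub>c W) y z" for y z
        using card(2)[of y z] by (auto simp: level_def)
    qed
  qed
qed

text \<open>Raising inside a component does not vanish before the top layer.\<close>

lemma up_state_nonzero:
  assumes "finite x" "W \<noteq> 0" "casimir x * W = cas (card x) r *\<^sub>c W"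
    "\<And>f. level x f * W = f k *\<^sub>c W" "r \<le> k" "k + r < card x"
  shows "up x * W \<noteq> 0"
proof
  assume "up x * W = 0"
  then have "0 = down x * up x * W"
    by (simp add: mult.assoc)
  also have "\<dots> = (cas (card x) (Suc k) - cas (card x) r) *\<^sub>c W"
    using assms by (simp add: down_up_casimir left_diff_distrib cscale_distrib)
  finally have "(of_nat (Suc k) - of_nat r) * (of_nat (card x) + 1 - of_nat (Suc k) - of_nat r) = (0 :: complex)"
    using assms(2) unfolding cas_diff by simp
  moreover have "of_nat (Suc k) - of_nat r = (of_nat (Suc k - r) :: complex)"
    "of_nat (card x) + 1 - of_nat (Suc k) - of_nat r = (of_nat (card x - k - r) :: complex)"
    using assms(5,6) by (auto simp: of_nat_diff)
  ultimately show False
    using assms(5,6) by (simp only: mult_eq_0_iff of_nat_eq_0_iff) simp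
qed

lemma casimir_lowest:
  assumes "down x * W = 0" "\<And>f. level x f * W = f r *\<^sub>c W"
  shows "casimir x * W = cas (card x) r *\<^sub>c W"
  using assms by (simp add: casimir_def left_diff_distrib mult.assoc)

lemma raise_states:
  assumes x: "finite x" "r + k \<le> card x" "r \<le> k"
    and W: "W \<noteq> 0" "casimir x * W = cas (card x) r *\<^sub>c W" "\<And>f. level x f * W = f r *\<^sub>c W"
  obtains W' j where "W' = up x ^ j * W" "W' \<noteq> 0" "casimir x * W' = cas (card x) r *\<^sub>c W'"
    "\<And>f. level x f * W' = f k *\<^sub>c W'"
proof -
  have "\<exists>W' j. W' = up x ^ j * W \<and> W' \<noteq> 0 \<and> casimir x * W' = cas (card x) r *\<^sub>c W' \<and>
    (\<forall>f. level x f * W' = f k *\<^sub>c W')"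
    using x(3,2)
  proof (induction k rule: dec_induct)
    case base
    show ?case
      using W by (intro exI[of _ W] exI[of _ 0]) simp
  next
    case (step k)
    then obtain W' j where W': "W' = up x ^ j * W" "W' \<noteq> 0" "casimir x * W' = cas (card x) r *\<^sub>c W'"
      "\<And>f. level x f * W' = f k *\<^sub>c W'"
      by auto
    have "casimir x * (up x * W') = up x * (casimir x * W')"
      using x(1) by (simp add: mult.assoc[symmetric] casimir_up)
    moreover have "level x f * (up x * W') = f (Suc k) *\<^sub>c (up x * W')" for f
    proof -
      have "level x f * (up x * W') = up x * (level x (\<lambda>k. f (Suc k)) * W')"
        using x(1) by (simp add: mult.assoc[symmetric] level_up)
      then show ?thesis by (simp add: W'(4))
    qed
    moreover have "up x * W' \<noteq> 0"
      using x(1) W' step by (intro up_state_nonzero) auto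
    ultimately show ?case
      using W' by (intro exI[of _ "up x * W'"] exI[of _ "Suc j"]) (simp add: mult.assoc)
  qed
  then show thesis using that by blast
qed

lemma power_commute_left:
  fixes M :: "'b :: ring_1"
  assumes "M * U = U * M"
  shows "M * (U ^ j * W) = U ^ j * (M * W)"
proof -
  have "M * U ^ j = U ^ j * M"
    by (induction j) (simp_all add: assms mult.assoc, metis assms mult.assoc)
  then show ?thesis
    by (simp add: mult.assoc[symmetric])
qed

text \<open>A nonzero vector in the component \<open>(r, s)\<close> on every admissible pair of layers.\<close>

lemma exists_state:
  assumes fin: "finite x" "finite x'" and dis: "x \<inter> x' = {}" and V: "x \<union> x' \<subseteq> V"
    and r: "r + k \<le> card x" "r \<le> k" and s: "s + l \<le> card x'" "s \<le> l"
  obtains W where "W \<noteq> 0" "W * vacuum = W" "ground V * W = W"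
    "casimir x * W = cas (card x) r *\<^sub>c W" "casimir x' * W = cas (card x') s *\<^sub>c W"
    "\<And>f. level x f * W = f k *\<^sub>c W" "\<And>f. level x' f * W = f l *\<^sub>c W"
proof -
  have "2 * r \<le> card x" "2 * s \<le> card x'"
    using r s by linarith+
  then obtain W0 where W0: "W0 \<noteq> 0" "W0 * vacuum = W0" "ground V * W0 = W0"
    "down x * W0 = 0" "down x' * W0 = 0"
    "\<And>f. level x f * W0 = f r *\<^sub>c W0" "\<And>f. level x' f * W0 = f s *\<^sub>c W0"
    using exists_lowest_state[OF fin dis _ _ V, of r s] by blast
  obtain W1 i where W1: "W1 = up x ^ i * W0" "W1 \<noteq> 0" "casimir x * W1 = cas (card x) r *\<^sub>c W1"
    "\<And>f. level x f * W1 = f k *\<^sub>c W1"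
    using raise_states[OF fin(1) r W0(1) casimir_lowest[OF W0(4,6)] W0(6)] by metis
  have dis': "x' \<inter> x = {}" using dis by auto
  have comm: "ground V * up x = up x * ground V" "ground V * up x' = up x' * ground V"
    "\<And>f. level x f * up x' = up x' * level x f" "\<And>f. level x' f * up x = up x * level x' f"
    "casimir x * up x' = up x' * casimir x"
    "down x' * up x = up x * down x'"
    using V dis dis'
    by (auto simp: ground_up disjoint_level_up down_up_commute up_commute
        intro!: casimir_commuteI)
  have W1': "ground V * W1 = W1" "\<And>f. level x' f * W1 = f s *\<^sub>c W1" "down x' * W1 = 0"
    using comm W0 unfolding W1(1) by (simp_all add: power_commute_left)
  obtain W2 j where W2: "W2 = up x' ^ j * W1" "W2 \<noteq> 0" "casimir x' * W2 = cas (card x') s *\<^sub>c W2"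
    "\<And>f. level x' f * W2 = f l *\<^sub>c W2"
    using raise_states[OF fin(2) s W1(2) casimir_lowest[OF W1'(3,2)] W1'(2)] by metis
  have "ground V * W2 = W2" "\<And>f. level x f * W2 = f k *\<^sub>c W2" "casimir x * W2 = cas (card x) r *\<^sub>c W2"
    using comm W1 W1' unfolding W2(1) by (simp_all add: power_commute_left)
  moreover have "W2 * vacuum = W2"
    by (simp add: W2(1) W1(1) mult.assoc W0(2))
  ultimately show thesis
    using that W2 by blast
qed

section \<open>Systems of matrix units\<close>

text \<open>Nonzero matrices \<open>F q i j\<close>, \<open>i, j < N q\<close>, that multiply like the standard matrix units of
  \<open>\<Oplus>\<^sub>q Mat (N q)\<close>. Such matrices are linearly independent, so their span is a copy of this
  algebra.\<close>

locale matrix_units =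
  fixes Q :: "'q set" and N :: "'q \<Rightarrow> nat" and F :: "'q \<Rightarrow> nat \<Rightarrow> nat \<Rightarrow> 'a rfmat"
  assumes finite_Q: "finite Q"
    and unit_mult: "\<lbrakk>q \<in> Q; q' \<in> Q; i < N q; j < N q; k < N q'; l < N q'\<rbrakk>
      \<Longrightarrow> F q i j * F q' k l = (if q = q' \<and> j = k then F q i l else 0)"
    and unit_nonzero: "\<lbrakk>q \<in> Q; i < N q; j < N q\<rbrakk> \<Longrightarrow> F q i j \<noteq> 0"
begin

text \<open>The image of a matrix \<open>A\<close> in block \<open>q\<close>, and of a family of matrices, under the map that
  sends standard matrix units to the matrices \<open>F q i j\<close>.\<close>

definition block :: "'q \<Rightarrow> complex mat \<Rightarrow> 'a rfmat" where
  "block q A = (\<Sum>i<N q. \<Sum>j<N q. (A $$ (i, j)) *\<^sub>c F q i j)"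

definition assemble :: "('q \<Rightarrow> complex mat) \<Rightarrow> 'a rfmat" where
  "assemble f = (\<Sum>q\<in>Q. block q (f q))"

lemma block_mult_same:
  assumes "q \<in> Q" "A \<in> carrier_mat (N q) (N q)" "B \<in> carrier_mat (N q) (N q)"
  shows "block q A * block q B = block q (A * B)"
proof -
  have "block q A * block q B = (\<Sum>i<N q. \<Sum>j<N q. \<Sum>k<N q. \<Sum>l<N q.
      (A $$ (i, j) * B $$ (k, l)) *\<^sub>c (F q i j * F q k l))"
    unfolding block_def[of q A] sum_distrib_right
    unfolding block_def[of q B] sum_distrib_left by (simp add: mult.commute)
  also have "\<dots> = (\<Sum>i<N q. \<Sum>j<N q. \<Sum>k<N q. \<Sum>l<N q.
      if j = k then (A $$ (i, j) * B $$ (k, l)) *\<^sub>c F q i l else 0)"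
    using assms(1) by (intro sum.cong refl) (auto simp: unit_mult)
  also have "\<dots> = (\<Sum>i<N q. \<Sum>j<N q. \<Sum>l<N q. (A $$ (i, j) * B $$ (j, l)) *\<^sub>c F q i l)"
    by (rule sum.cong[OF refl], rule sum.cong[OF refl], subst sum.swap) simp
  also have "\<dots> = (\<Sum>i<N q. \<Sum>l<N q. \<Sum>j<N q. (A $$ (i, j) * B $$ (j, l)) *\<^sub>c F q i l)"
    by (intro sum.cong refl sum.swap)
  also have "\<dots> = block q (A * B)"
    unfolding block_def
  proof (intro sum.cong refl)
    fix i l assume "i \<in> {..<N q}" "l \<in> {..<N q}"
    then have "(A * B) $$ (i, l) = (\<Sum>j<N q. A $$ (i, j) * B $$ (j, l))"
      using assms(2,3) by (auto simp: scalar_prod_def lessThan_atLeast0 intro!: sum.cong)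
    moreover have "(\<Sum>j\<in>J. c j *\<^sub>c M) = (\<Sum>j\<in>J. c j) *\<^sub>c M" for c J and M :: "'a rfmat"
      by (rule rfmat_eqI) (simp add: sum_distrib_right)
    ultimately show "(\<Sum>j<N q. (A $$ (i, j) * B $$ (j, l)) *\<^sub>c F q i l) = ((A * B) $$ (i, l)) *\<^sub>c F q i l"
      by simp
  qed
  finally show ?thesis .
qed

lemma block_mult_diff:
  assumes "q \<in> Q" "q' \<in> Q" "q \<noteq> q'"
  shows "block q A * block q' B = 0"
  using assms by (simp add: block_def sum_distrib_left sum_distrib_right unit_mult)

lemma assemble_mult:
  assumes "\<And>q. q \<in> Q \<Longrightarrow> f q \<in> carrier_mat (N q) (N q)" "\<And>q. q \<in> Q \<Longrightarrow> g q \<in> carrier_mat (N q) (N q)"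
  shows "assemble f * assemble g = assemble (\<lambda>q. f q * g q)"
proof -
  have "assemble f * assemble g = (\<Sum>q\<in>Q. \<Sum>q'\<in>Q. block q (f q) * block q' (g q'))"
    by (simp add: assemble_def sum_product)
  also have "\<dots> = (\<Sum>q\<in>Q. \<Sum>q'\<in>Q. if q' = q then block q (f q * g q) else 0)"
    using assms by (intro sum.cong refl) (auto simp: block_mult_same block_mult_diff)
  finally show ?thesis
    using finite_Q by (simp add: assemble_def)
qed

lemma assemble_add:
  assumes "\<And>q. q \<in> Q \<Longrightarrow> f q \<in> carrier_mat (N q) (N q)" "\<And>q. q \<in> Q \<Longrightarrow> g q \<in> carrier_mat (N q) (N q)"
  shows "assemble f + assemble g = assemble (\<lambda>q. f q + g q)"
  unfolding assemble_def block_def sum.distrib[symmetric]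
proof (intro sum.cong refl)
  fix q i j assume q: "q \<in> Q" and "i \<in> {..<N q}" "j \<in> {..<N q}"
  then show "(f q $$ (i, j)) *\<^sub>c F q i j + (g q $$ (i, j)) *\<^sub>c F q i j = ((f q + g q) $$ (i, j)) *\<^sub>c F q i j"
    using assms[OF q] by (simp add: cscale_distrib)
qed

lemma assemble_scale:
  assumes "\<And>q. q \<in> Q \<Longrightarrow> f q \<in> carrier_mat (N q) (N q)"
  shows "c *\<^sub>c assemble f = assemble (\<lambda>q. c \<cdot>\<^sub>m f q)"
  unfolding assemble_def block_def cscale_sum
proof (intro sum.cong refl)
  fix q i j assume q: "q \<in> Q" and "i \<in> {..<N q}" "j \<in> {..<N q}"
  then show "c *\<^sub>c (f q $$ (i, j)) *\<^sub>c F q i j = ((c \<cdot>\<^sub>m f q) $$ (i, j)) *\<^sub>c F q i j"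
    using assms[OF q] by simp
qed

lemma assemble_one: "assemble (\<lambda>q. 1\<^sub>m (N q)) = (\<Sum>q\<in>Q. \<Sum>i<N q. F q i i)"
proof -
  have "(\<Sum>j<N q. (1\<^sub>m (N q) $$ (i, j)) *\<^sub>c F q i j) = F q i i" if "i < N q" for q i
  proof -
    have "(\<Sum>j<N q. (1\<^sub>m (N q) $$ (i, j)) *\<^sub>c F q i j) = (\<Sum>j<N q. if j = i then F q i i else 0)"
      using that by (intro sum.cong) auto
    then show ?thesis using that by simp
  qed
  then show ?thesis
    by (simp add: assemble_def block_def)
qed

lemma unit_in_assemble:
  assumes q: "q \<in> Q" and ij: "i < N q" "j < N q"
  shows "\<exists>f. (\<forall>q\<in>Q. f q \<in> carrier_mat (N q) (N q)) \<and> F q i j = assemble f"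
proof (intro exI conjI)
  define f where "f = (\<lambda>q'. mat (N q') (N q') (\<lambda>(k, l). of_bool (q' = q \<and> k = i \<and> l = j) :: complex))"
  show "\<forall>q\<in>Q. f q \<in> carrier_mat (N q) (N q)"
    by (simp add: f_def)
  have "block q' (f q') = (if q' = q then F q i j else 0)" for q'
  proof (cases "q' = q")
    case True
    have "block q (f q) = (\<Sum>k<N q. \<Sum>l<N q. if l = j then if k = i then F q i j else 0 else 0)"
      unfolding block_def f_def by (intro sum.cong refl) auto
    then show ?thesis
      using True ij by simp
  qed (simp add: block_def f_def)
  then show "F q i j = assemble f"
    using q finite_Q by (simp add: assemble_def)
qed

lemma unit_assemble_unit:
  assumes q: "q \<in> Q" and ij: "i < N q" "j < N q"
  shows "F q i i * assemble f * F q j j = (f q $$ (i, j)) *\<^sub>c F q i j"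
proof -
  have blk: "F q i i * block q' B * F q j j = (if q' = q then (B $$ (i, j)) *\<^sub>c F q i j else 0)"
    if q': "q' \<in> Q" for q' B
  proof (cases "q' = q")
    case True
    have "F q i i * block q B * F q j j
        = (\<Sum>k<N q. \<Sum>l<N q. (B $$ (k, l)) *\<^sub>c (F q i i * F q k l * F q j j))"
      by (simp add: block_def sum_distrib_left sum_distrib_right)
    also have "\<dots> = (\<Sum>k<N q. \<Sum>l<N q. if l = j then if k = i then (B $$ (i, j)) *\<^sub>c F q i j else 0 else 0)"
      using q ij by (intro sum.cong refl) (auto simp: unit_mult)
    finally show ?thesis
      using True ij by simp
  next
    case False
    then have "F q i i * block q' B = 0"
      using q q' ij by (simp add: block_def sum_distrib_left unit_mult)
    then show ?thesis using False by simp
  qed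
  have "F q i i * assemble f * F q j j = (\<Sum>q'\<in>Q. F q i i * block q' (f q') * F q j j)"
    by (simp add: assemble_def sum_distrib_left sum_distrib_right)
  also have "\<dots> = (\<Sum>q'\<in>Q. if q' = q then (f q $$ (i, j)) *\<^sub>c F q i j else 0)"
    by (intro sum.cong refl) (auto simp: blk)
  finally show ?thesis
    using q finite_Q by simp
qed

lemma assemble_inj:
  assumes "assemble f = assemble g" "q \<in> Q"
    "f q \<in> carrier_mat (N q) (N q)" "g q \<in> carrier_mat (N q) (N q)"
  shows "f q = g q"
proof (rule eq_matI)
  fix i j assume "i < dim_row (g q)" "j < dim_col (g q)"
  then have ij: "i < N q" "j < N q"
    using assms by auto
  have "(f q $$ (i, j)) *\<^sub>c F q i j = (g q $$ (i, j)) *\<^sub>c F q i j"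
    using unit_assemble_unit[OF assms(2) ij, of f] unit_assemble_unit[OF assms(2) ij, of g] assms(1)
    by simp
  then have "(f q $$ (i, j) - g q $$ (i, j)) *\<^sub>c F q i j = 0"
    by (simp add: cscale_distrib)
  then show "f q $$ (i, j) = g q $$ (i, j)"
    using unit_nonzero[OF assms(2) ij] by simp
qed (use assms in auto)

lemma assemble_closed:
  assumes "0 \<in> S" "\<And>M N. M \<in> S \<Longrightarrow> N \<in> S \<Longrightarrow> M + N \<in> S" "\<And>c M. M \<in> S \<Longrightarrow> c *\<^sub>c M \<in> S"
    and "\<And>q i j. q \<in> Q \<Longrightarrow> i < N q \<Longrightarrow> j < N q \<Longrightarrow> F q i j \<in> S"
  shows "assemble f \<in> S"
proof -
  \<comment> \<open>Stated twice because the index type is fixed inside the proof.\<close>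
  have sum_nat: "sum g A \<in> S" if "\<And>a. a \<in> A \<Longrightarrow> g a \<in> S" for g :: "nat \<Rightarrow> 'a rfmat" and A
    using that by (induction A rule: infinite_finite_induct) (auto intro: assms)
  have sum_q: "sum g A \<in> S" if "\<And>a. a \<in> A \<Longrightarrow> g a \<in> S" for g :: "'q \<Rightarrow> 'a rfmat" and A
    using that by (induction A rule: infinite_finite_induct) (auto intro: assms)
  show ?thesis
    unfolding assemble_def block_def by (intro sum_nat sum_q assms) auto
qed

end

section \<open>Two commuting families on a pair of complementary sets\<close>

text \<open>The base point \<open>x\<close> of the Johnson scheme, of size \<open>d\<close>, and its complement \<open>x'\<close>, of size
  \<open>m = n - d\<close>.\<close>

locale johnson_pair =
  fixes n d m :: nat and x x' :: "nat set"
  assumes x_sub: "x \<subseteq> {1..n}" and x'_def: "x' = {1..n} - x"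
    and card_x: "card x = d" and card_x': "card x' = m" and d_less_m: "d < m"
begin

lemma fin [simp]: "finite x" "finite x'"
  using x_sub x'_def finite_subset by auto

lemma disj: "x \<inter> x' = {}" "x' \<inter> x = {}"
  by (auto simp: x'_def)

lemma union: "x \<union> x' = {1..n}"
  using x_sub by (auto simp: x'_def)

text \<open>\<open>lay i\<close> projects onto the \<open>d\<close>-subsets of \<open>{1..n}\<close> that have \<open>i\<close> points outside \<open>x\<close>; it is
  the dual idempotent \<open>E\<^sup>*\<^sub>i\<close>. It is zero for \<open>i > d\<close>.\<close>

definition lay :: "nat \<Rightarrow> nat set rfmat" where
  "lay i = ground {1..n} * (level x (\<lambda>k. of_bool (k + i = d)) * layer x' i)"

text \<open>\<open>R\<close> moves one point of a subset from \<open>x\<close> to \<open>x'\<close>, and \<open>L\<close> moves one back.\<close>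

definition R :: "nat set rfmat" where "R = down x * up x'"
definition L :: "nat set rfmat" where "L = up x * down x'"

lemma lay_diag:
  "lay i = diag (\<lambda>y. of_bool (y \<subseteq> {1..n} \<and> card (y \<inter> x) + i = d \<and> card (y \<inter> x') = i))"
  by (rule rfmat_eqI) (simp add: lay_def ground_def level_def)

lemma lay_mult: "lay i * lay j = (if i = j then lay i else 0)"
  by (rule rfmat_eqI) (auto simp: lay_diag)

lemma lay_mult_left: "lay i * (lay j * M) = (if i = j then lay i * M else 0)"
  by (simp add: mult.assoc[symmetric] lay_mult)

lemma lay_beyond: "d < i \<Longrightarrow> lay i = 0"
  by (rule rfmat_eqI) (auto simp: lay_diag)

lemma level_x_lay: "level x f * lay i = f (d - i) *\<^sub>c lay i"
  by (rule rfmat_eqI) (auto simp: lay_diag level_def)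

lemma level_x'_lay: "level x' f * lay i = f i *\<^sub>c lay i"
  by (rule rfmat_eqI) (auto simp: lay_diag level_def)

lemma ground_comm:
  "ground {1..n} * up x = up x * ground {1..n}" "ground {1..n} * up x' = up x' * ground {1..n}"
  "ground {1..n} * down x = down x * ground {1..n}" "ground {1..n} * down x' = down x' * ground {1..n}"
  using union by (intro ground_up ground_down; blast)+

lemma down_x_level: "down x * level x (\<lambda>k. of_bool (k + i = d))
    = level x (\<lambda>k. of_bool (k + Suc i = d)) * down x"
  using down_level[OF fin(1), of "\<lambda>k. of_bool (k + i = d)"] by simp

lemma up_x_level: "up x * level x (\<lambda>k. of_bool (k + Suc i = d))
    = level x (\<lambda>k. of_bool (k + i = d)) * up x"
  using level_up[OF fin(1), of "\<lambda>k. of_bool (k + i = d)"] by simp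

lemma R_lay: "R * lay i = lay (Suc i) * R"
proof -
  have "R * lay i = ground {1..n} * (down x * level x (\<lambda>k. of_bool (k + i = d))) * (up x' * layer x' i)"
  proof -
    have "R * ground {1..n} = ground {1..n} * R"
      unfolding R_def by (intro commute_mult[symmetric] ground_comm)
    then have "R * lay i = ground {1..n} * (down x * (up x' * level x (\<lambda>k. of_bool (k + i = d))) * layer x' i)"
      by (simp add: lay_def R_def mult.assoc[symmetric])
    then show ?thesis
      by (simp add: disjoint_level_up[OF disj(1), symmetric] mult.assoc)
  qed
  also have "\<dots> = ground {1..n} * level x (\<lambda>k. of_bool (k + Suc i = d)) * (down x * layer x' (Suc i)) * up x'"
    using layer_up_Suc[OF fin(2), of i] by (simp add: down_x_level mult.assoc)
  also have "down x * layer x' (Suc i) = layer x' (Suc i) * down x"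
    by (simp add: disjoint_level_down[OF disj(2)])
  finally show ?thesis
    by (simp add: lay_def R_def mult.assoc)
qed

lemma lay_L: "lay i * L = L * lay (Suc i)"
proof -
  have g: "L * ground {1..n} = ground {1..n} * L"
    unfolding L_def by (intro commute_mult[symmetric] ground_comm)
  have "L * lay (Suc i) = ground {1..n} * (up x * (down x' * level x (\<lambda>k. of_bool (k + Suc i = d)))) * layer x' (Suc i)"
    using g by (simp add: lay_def L_def mult.assoc[symmetric])
  also have "\<dots> = ground {1..n} * (up x * level x (\<lambda>k. of_bool (k + Suc i = d))) * (down x' * layer x' (Suc i))"
    by (simp add: disjoint_level_down[OF disj(1), symmetric] mult.assoc)
  also have "\<dots> = ground {1..n} * level x (\<lambda>k. of_bool (k + i = d)) * (up x * layer x' i) * down x'"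
    using layer_down[OF fin(2), of i] by (simp only: up_x_level mult.assoc)
  also have "up x * layer x' i = layer x' i * up x"
    by (simp add: disjoint_level_up[OF disj(2)])
  finally show ?thesis
    by (simp add: lay_def L_def mult.assoc)
qed

lemma L_lay_0: "L * lay 0 = 0"
proof -
  have "lay 0 = layer x' 0 * lay 0"
    by (simp add: level_x'_lay)
  then have "L * lay 0 = up x * (down x' * layer x' 0) * lay 0"
    by (simp add: L_def mult.assoc)
  then show ?thesis
    by (simp add: down_layer_0)
qed

lemma R_pow_lay: "R ^ j * lay i = lay (i + j) * R ^ j"
proof (induction j)
  case (Suc j)
  have "R ^ Suc j * lay i = R * (R ^ j * lay i)"
    by (simp add: mult.assoc)
  also have "\<dots> = R * lay (i + j) * R ^ j"
    by (simp add: Suc mult.assoc)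
  finally show ?case
    by (simp add: R_lay mult.assoc)
qed simp

lemma lay_L_pow: "lay i * L ^ j = L ^ j * lay (i + j)"
proof (induction j)
  case (Suc j)
  have "lay i * L ^ Suc j = lay i * L ^ j * L"
    by (simp add: power_Suc2 mult.assoc del: power_Suc)
  also have "\<dots> = L ^ j * (lay (i + j) * L)"
    by (simp add: Suc mult.assoc)
  finally show ?case
    by (simp add: lay_L power_Suc2 mult.assoc del: power_Suc)
qed simp

lemma commutes:
  "up x * up x' = up x' * up x" "down x * down x' = down x' * down x"
  "down x * up x' = up x' * down x" "down x' * up x = up x * down x'"
  using disj by (auto intro: up_commute down_commute down_up_commute)

lemma casimir_x:
  "casimir x * up x = up x * casimir x" "casimir x * up x' = up x' * casimir x"
  "casimir x * down x = down x * casimir x" "casimir x * down x' = down x' * casimir x"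
  "casimir x * ground {1..n} = ground {1..n} * casimir x"
  "casimir x * level x f = level x f * casimir x"
  "casimir x * level x' f = level x' f * casimir x"
  using disj ground_comm
  by (auto intro!: casimir_commuteI simp: casimir_up casimir_down casimir_level commutes
      disjoint_level_up disjoint_level_down level_commute ground_level)

lemma casimir_x':
  "casimir x' * up x = up x * casimir x'" "casimir x' * up x' = up x' * casimir x'"
  "casimir x' * down x = down x * casimir x'" "casimir x' * down x' = down x' * casimir x'"
  "casimir x' * ground {1..n} = ground {1..n} * casimir x'"
  "casimir x' * level x f = level x f * casimir x'"
  "casimir x' * level x' f = level x' f * casimir x'"
  using disj ground_comm
  by (auto intro!: casimir_commuteI simp: casimir_up casimir_down casimir_level commutes
      disjoint_level_up disjoint_level_down level_commute ground_level)

lemma casimir_comm: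
  "casimir x * R = R * casimir x" "casimir x * L = L * casimir x" "casimir x * lay i = lay i * casimir x"
  "casimir x' * R = R * casimir x'" "casimir x' * L = L * casimir x'" "casimir x' * lay i = lay i * casimir x'"
  "casimir x' * casimir x = casimir x * casimir x'"
  unfolding R_def L_def lay_def
  by (intro commute_mult casimir_x casimir_x' casimir_commuteI[symmetric] casimir_x'[symmetric])+

text \<open>The projection onto the component \<open>(r, s)\<close>, written for the pair \<open>q = (r, s)\<close>, and the set
  of all such pairs.\<close>

definition G :: "nat \<times> nat \<Rightarrow> nat set rfmat" where
  "G q = isotypic x (fst q) * isotypic x' (snd q)"

definition Q :: "(nat \<times> nat) set" where
  "Q = {..d div 2} \<times> {..m div 2}"

lemma isotypic_cross: "isotypic x r * isotypic x' s = isotypic x' s * isotypic x r"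
  by (intro isotypic_commute isotypic_commute[symmetric] casimir_comm(7)[symmetric])

lemma G_comm:
  "G q * R = R * G q" "G q * L = L * G q" "G q * lay i = lay i * G q"
  unfolding G_def by (intro commute_mult[symmetric] isotypic_commute[symmetric] casimir_comm)+

lemma G_mult: "q \<in> Q \<Longrightarrow> q' \<in> Q \<Longrightarrow> G q * G q' = (if q = q' then G q else 0)"
proof -
  assume "q \<in> Q" "q' \<in> Q"
  then have le: "fst q \<le> card x div 2" "fst q' \<le> card x div 2" "snd q \<le> card x' div 2" "snd q' \<le> card x' div 2"
    by (auto simp: Q_def card_x card_x')
  have "G q * G q' = isotypic x (fst q) * (isotypic x' (snd q) * isotypic x (fst q')) * isotypic x' (snd q')"
    by (simp add: G_def mult.assoc)
  also have "\<dots> = (isotypic x (fst q) * isotypic x (fst q')) * (isotypic x' (snd q) * isotypic x' (snd q'))"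
    unfolding isotypic_cross[symmetric] by (simp add: mult.assoc)
  also have "\<dots> = (if q = q' then G q else 0)"
    using le by (auto simp: isotypic_mult G_def prod_eq_iff)
  finally show ?thesis .
qed

lemma sum_G: "(\<Sum>q\<in>Q. G q) = 1"
proof -
  have "(\<Sum>q\<in>Q. G q) = (\<Sum>r\<le>d div 2. isotypic x r) * (\<Sum>s\<le>m div 2. isotypic x' s)"
    by (simp add: Q_def G_def sum_product sum.cartesian_product case_prod_beta)
  then show ?thesis
    using sum_isotypic[OF fin(1)] sum_isotypic[OF fin(2)] by (simp add: card_x card_x')
qed

lemma casimir_G:
  assumes "q \<in> Q"
  shows "casimir x * G q = cas d (fst q) *\<^sub>c G q" "casimir x' * G q = cas m (snd q) *\<^sub>c G q"
proof -
  have le: "fst q \<le> card x div 2" "snd q \<le> card x' div 2"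
    using assms by (auto simp: Q_def card_x card_x')
  show "casimir x * G q = cas d (fst q) *\<^sub>c G q"
    using casimir_isotypic[OF fin(1) le(1)] by (simp add: G_def mult.assoc[symmetric] card_x)
  have "G q = isotypic x' (snd q) * isotypic x (fst q)"
    by (simp add: G_def isotypic_cross)
  then show "casimir x' * G q = cas m (snd q) *\<^sub>c G q"
    using casimir_isotypic[OF fin(2) le(2)] by (simp add: mult.assoc[symmetric] card_x')
qed

text \<open>The component \<open>q\<close> lives on the layers \<open>lo q, \<dots>, hi q\<close>. Their number is \<open>N q\<close>, with value 0
  by truncated subtraction if there are none.\<close>

definition lo :: "nat \<times> nat \<Rightarrow> nat" where "lo q = max (fst q) (snd q)"
definition hi :: "nat \<times> nat \<Rightarrow> nat" where "hi q = min (d - fst q) (m - snd q)"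
definition N :: "nat \<times> nat \<Rightarrow> nat" where "N q = hi q + 1 - lo q"

lemma lay_G_0:
  assumes q: "q \<in> Q" and i: "i < lo q \<or> hi q < i"
  shows "lay i * G q = 0"
proof (cases "d < i")
  case True
  then show ?thesis by (simp add: lay_beyond)
next
  case False
  have le: "fst q \<le> card x div 2" "snd q \<le> card x' div 2"
    using q by (auto simp: Q_def card_x card_x')
  have lay: "lay i = ground {1..n} * (layer x (d - i) * layer x' i)"
    unfolding lay_def using False
    by (intro arg_cong2[where f = "(*)"] arg_cong2[where f = level] refl) (auto simp: fun_eq_iff)
  consider "d - i < fst q \<or> card x - fst q < d - i" | "i < snd q \<or> card x' - snd q < i"
    using i False le by (force simp: lo_def hi_def card_x card_x')
  then show ?thesis
  proof cases
    case 1
    have "lay i * G q = ground {1..n} * layer x' i * (layer x (d - i) * isotypic x (fst q)) * isotypic x' (snd q)"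
      by (simp add: lay G_def mult.assoc[symmetric]) (simp add: mult.assoc level_commute)
    then show ?thesis
      using layer_isotypic_0[OF fin(1) le(1) 1] by simp
  next
    case 2
    have "lay i * G q = ground {1..n} * layer x (d - i) * (layer x' i * isotypic x' (snd q)) * isotypic x (fst q)"
      by (simp add: lay G_def mult.assoc isotypic_cross)
    then show ?thesis
      using layer_isotypic_0[OF fin(2) le(2) 2] by simp
  qed
qed

lemma cas_d_lay: "i \<le> d \<Longrightarrow> cas d (d - i) = cas d (Suc i)" "i \<le> d \<Longrightarrow> cas d (Suc (d - i)) = cas d i"
  by (simp_all add: cas_def of_nat_diff algebra_simps)

lemma L_R_lay: "L * R * lay i = (cas d (Suc i) *\<^sub>c 1 - casimir x) * ((cas m (Suc i) *\<^sub>c 1 - casimir x') * lay i)"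
proof (cases "i \<le> d")
  case True
  have "L * R * lay i = (up x * down x) * ((down x' * up x') * lay i)"
    by (simp add: L_def R_def mult.assoc) (metis commutes(2) mult.assoc)
  also have "(down x' * up x') * lay i = (cas m (Suc i) *\<^sub>c 1 - casimir x') * lay i"
    by (simp add: down_up_casimir left_diff_distrib level_x'_lay card_x')
  also have "\<dots> = lay i * (cas m (Suc i) *\<^sub>c 1 - casimir x')"
    by (simp add: left_diff_distrib right_diff_distrib casimir_comm)
  also have "up x * down x * \<dots> = (cas d (Suc i) *\<^sub>c 1 - casimir x) * \<dots>"
    using True by (simp add: mult.assoc[symmetric] up_down_casimir)
      (simp add: left_diff_distrib level_x_lay card_x cas_d_lay)
  also have "lay i * (cas m (Suc i) *\<^sub>c 1 - casimir x') = (cas m (Suc i) *\<^sub>c 1 - casimir x') * lay i"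
    by (simp add: left_diff_distrib right_diff_distrib casimir_comm)
  finally show ?thesis .
qed (simp add: lay_beyond)

lemma R_L_lay: "R * L * lay i = (cas d i *\<^sub>c 1 - casimir x) * ((cas m i *\<^sub>c 1 - casimir x') * lay i)"
proof (cases "i \<le> d")
  case True
  have "R * L * lay i = (down x * up x) * ((up x' * down x') * lay i)"
    by (simp add: L_def R_def mult.assoc) (metis commutes(1) mult.assoc)
  also have "(up x' * down x') * lay i = (cas m i *\<^sub>c 1 - casimir x') * lay i"
    by (simp add: up_down_casimir left_diff_distrib level_x'_lay card_x')
  also have "\<dots> = lay i * (cas m i *\<^sub>c 1 - casimir x')"
    by (simp add: left_diff_distrib right_diff_distrib casimir_comm)
  also have "down x * up x * \<dots> = (cas d i *\<^sub>c 1 - casimir x) * \<dots>"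
    using True by (simp add: mult.assoc[symmetric] down_up_casimir)
      (simp add: left_diff_distrib level_x_lay card_x cas_d_lay)
  also have "lay i * (cas m i *\<^sub>c 1 - casimir x') = (cas m i *\<^sub>c 1 - casimir x') * lay i"
    by (simp add: left_diff_distrib right_diff_distrib casimir_comm)
  finally show ?thesis .
qed (simp add: lay_beyond)

text \<open>The scalar by which \<open>L * R\<close> acts on layer \<open>i\<close> of component \<open>q\<close>, and \<open>R * L\<close> on layer
  \<open>i + 1\<close>.\<close>

definition step :: "nat \<times> nat \<Rightarrow> nat \<Rightarrow> complex" where
  "step q i = (cas d (Suc i) - cas d (fst q)) * (cas m (Suc i) - cas m (snd q))"

lemma L_R_lay_G:
  assumes "q \<in> Q"
  shows "L * R * lay i * G q = step q i *\<^sub>c (lay i * G q)"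
proof -
  have "L * R * lay i * G q = (cas d (Suc i) *\<^sub>c 1 - casimir x) * ((cas m (Suc i) *\<^sub>c 1 - casimir x') * G q) * lay i"
    unfolding L_R_lay by (simp add: mult.assoc G_comm)
  also have "(cas m (Suc i) *\<^sub>c 1 - casimir x') * G q = (cas m (Suc i) - cas m (snd q)) *\<^sub>c G q"
    using assms by (simp add: left_diff_distrib casimir_G cscale_distrib)
  also have "(cas d (Suc i) *\<^sub>c 1 - casimir x) * \<dots> = step q i *\<^sub>c G q"
    using assms by (simp add: left_diff_distrib casimir_G cscale_distrib step_def mult.commute)
      (simp add: algebra_simps cscale_distrib casimir_G)
  finally show ?thesis
    by (simp add: G_comm)
qed

lemma step_nonzero:
  assumes "lo q \<le> i" "i < hi q"
  shows "step q i \<noteq> 0"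
proof -
  have ne: "cas v (Suc i) - cas v r \<noteq> 0" if "r \<le> i" "i < v - r" for v r
  proof -
    have "cas v (Suc i) - cas v r = of_nat (Suc i - r) * of_nat (v - i - r)"
      unfolding cas_diff using that by (simp add: of_nat_diff)
    then show ?thesis
      using that by (simp only: mult_eq_0_iff of_nat_eq_0_iff) simp
  qed
  show ?thesis
    using assms ne[of "fst q" d] ne[of "snd q" m] by (simp add: step_def lo_def hi_def)
qed

lemma L_pow_R_pow:
  assumes q: "q \<in> Q"
  shows "L ^ j * R ^ j * lay i * G q = (\<Prod>t<j. step q (i + t)) *\<^sub>c (lay i * G q)"
proof (induction j)
  case (Suc j)
  have "L ^ Suc j * R ^ Suc j * lay i * G q = L ^ j * (L * R * (R ^ j * lay i) * G q)"
    by (simp only: power_Suc2[of L] power_Suc[of R] mult.assoc)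
  also have "R ^ j * lay i = lay (i + j) * R ^ j"
    by (rule R_pow_lay)
  also have "L * R * (lay (i + j) * R ^ j) * G q = (L * R * lay (i + j) * G q) * R ^ j"
    using power_commute_left[OF G_comm(1), of q j 1] by (simp add: mult.assoc)
  also have "\<dots> = step q (i + j) *\<^sub>c (lay (i + j) * R ^ j * G q)"
    using power_commute_left[OF G_comm(1), of q j 1] arg_cong[OF L_R_lay_G[OF q, of "i + j"], of "\<lambda>A. A * R ^ j"]
    by (simp add: mult.assoc)
  also have "lay (i + j) * R ^ j = R ^ j * lay i"
    by (rule R_pow_lay[symmetric])
  finally show ?case
    using Suc by (simp add: mult.assoc mult.commute)
qed simp

text \<open>The matrix units of the component \<open>q\<close>: lower from layer \<open>lo q + j\<close> to the lowest layer, then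
  raise to layer \<open>lo q + i\<close>. The scalar makes \<open>F q j j\<close> idempotent.\<close>

definition F :: "nat \<times> nat \<Rightarrow> nat \<Rightarrow> nat \<Rightarrow> nat set rfmat" where
  "F q i j = inverse (\<Prod>t<j. step q (lo q + t)) *\<^sub>c (R ^ i * (lay (lo q) * G q) * L ^ j)"

lemma R_L_lay_G:
  assumes "q \<in> Q"
  shows "R * L * lay (Suc i) * G q = step q i *\<^sub>c (lay (Suc i) * G q)"
proof -
  have "R * L * lay (Suc i) * G q = (cas d (Suc i) *\<^sub>c 1 - casimir x) * ((cas m (Suc i) *\<^sub>c 1 - casimir x') * G q) * lay (Suc i)"
    unfolding R_L_lay by (simp add: mult.assoc G_comm)
  also have "(cas m (Suc i) *\<^sub>c 1 - casimir x') * G q = (cas m (Suc i) - cas m (snd q)) *\<^sub>c G q"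
    using assms by (simp add: left_diff_distrib casimir_G cscale_distrib)
  also have "(cas d (Suc i) *\<^sub>c 1 - casimir x) * \<dots> = step q i *\<^sub>c G q"
    using assms by (simp add: left_diff_distrib casimir_G cscale_distrib step_def mult.commute)
      (simp add: algebra_simps cscale_distrib casimir_G)
  finally show ?thesis
    by (simp add: G_comm)
qed

lemma R_pow_L_pow:
  assumes q: "q \<in> Q"
  shows "R ^ i * L ^ i * lay (a + i) * G q = (\<Prod>t<i. step q (a + t)) *\<^sub>c (lay (a + i) * G q)"
proof (induction i arbitrary: a)
  case (Suc i)
  have "R ^ Suc i * L ^ Suc i * lay (a + Suc i) * G q = R ^ i * (R * L * (L ^ i * lay (Suc a + i)) * G q)"
    by (simp only: power_Suc2[of R] power_Suc[of L] mult.assoc add_Suc_shift)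
  also have "L ^ i * lay (Suc a + i) = lay (Suc a) * L ^ i"
    by (rule lay_L_pow[symmetric])
  also have "R * L * (lay (Suc a) * L ^ i) * G q = step q a *\<^sub>c (lay (Suc a) * L ^ i * G q)"
    using power_commute_left[OF G_comm(2), of q i 1] arg_cong[OF R_L_lay_G[OF q, of a], of "\<lambda>A. A * L ^ i"]
    by (simp add: mult.assoc)
  also have "lay (Suc a) * L ^ i = L ^ i * lay (Suc a + i)"
    by (rule lay_L_pow)
  finally have "R ^ Suc i * L ^ Suc i * lay (a + Suc i) * G q
      = step q a *\<^sub>c (R ^ i * L ^ i * lay (Suc a + i) * G q)"
    by (simp add: mult.assoc)
  also have "\<dots> = (step q a * (\<Prod>t<i. step q (Suc a + t))) *\<^sub>c (lay (Suc a + i) * G q)"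
    unfolding Suc by simp
  finally show ?case
    by (simp add: prod.lessThan_Suc_shift del: prod.lessThan_Suc)
qed simp

lemma step_prod_nonzero:
  assumes "j < N q"
  shows "(\<Prod>t<j. step q (lo q + t)) \<noteq> 0"
  using assms step_nonzero[of q] by (auto simp: N_def)

lemma F_diag:
  assumes q: "q \<in> Q" and i: "i < N q"
  shows "F q i i = lay (lo q + i) * G q"
proof -
  have "R ^ i * (lay (lo q) * G q) * L ^ i = R ^ i * (lay (lo q) * L ^ i) * G q"
    using power_commute_left[OF G_comm(2), of q i 1] by (simp add: mult.assoc)
  also have "\<dots> = R ^ i * L ^ i * lay (lo q + i) * G q"
    by (simp add: lay_L_pow mult.assoc)
  also have "\<dots> = (\<Prod>t<i. step q (lo q + t)) *\<^sub>c (lay (lo q + i) * G q)"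
    by (rule R_pow_L_pow[OF q])
  finally show ?thesis
    unfolding F_def using step_prod_nonzero[OF i] by simp
qed

lemma lay_G_nonzero:
  assumes q: "q \<in> Q" and i: "lo q \<le> i" "i \<le> hi q"
  shows "lay i * G q \<noteq> 0"
proof -
  have le: "fst q \<le> card x div 2" "snd q \<le> card x' div 2"
    using q by (auto simp: Q_def card_x card_x')
  have b: "fst q \<le> i" "snd q \<le> i" "i \<le> d - fst q" "i \<le> m - snd q"
    using i by (auto simp: lo_def hi_def)
  then have "fst q + (d - i) \<le> card x" "fst q \<le> d - i" "snd q + i \<le> card x'"
    using le by (auto simp: card_x card_x')
  then obtain W where W: "W \<noteq> 0" "W * vacuum = W" "ground {1..n} * W = W"
    "casimir x * W = cas (card x) (fst q) *\<^sub>c W" "casimir x' * W = cas (card x') (snd q) *\<^sub>c W"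
    "\<And>f. level x f * W = f (d - i) *\<^sub>c W" "\<And>f. level x' f * W = f i *\<^sub>c W"
    using exists_state[OF fin disj(1) equalityD1[OF union] _ _ _ b(2)] by metis
  have "G q * W = W"
    using isotypic_eigen[OF le(1) W(4)] isotypic_eigen[OF le(2) W(5)] by (simp add: G_def mult.assoc)
  moreover have "lay i * W = W"
    using W b by (simp add: lay_def mult.assoc)
  ultimately show ?thesis
    using W(1) by (metis mult.assoc mult_zero_left)
qed

lemma F_mult:
  assumes q: "q \<in> Q" "q' \<in> Q" and j: "j < N q"
  shows "F q i j * F q' k l = (if q = q' \<and> j = k then F q i l else 0)"
proof -
  let ?c = "\<lambda>q j. \<Prod>t<j. step q (lo q + t)"
  let ?M = "R ^ i * (lay (lo q) * G q) * L ^ j * (R ^ k * (lay (lo q') * G q') * L ^ l)"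
  have "?M = R ^ i * (lay (lo q) * (L ^ j * (R ^ k * lay (lo q'))) * (G q * G q')) * L ^ l"
    using power_commute_left[OF G_comm(2), of q j] power_commute_left[OF G_comm(1), of q k]
    by (simp add: mult.assoc) (simp add: mult.assoc[symmetric] G_comm)
  also have "lay (lo q) * (L ^ j * (R ^ k * lay (lo q'))) = L ^ j * (lay (lo q + j) * lay (lo q' + k)) * R ^ k"
    unfolding R_pow_lay by (simp add: mult.assoc[symmetric] lay_L_pow)
  \<comment> \<open>For \<open>q = q'\<close> and \<open>j \<noteq> k\<close> the middle part vanishes, as it multiplies two different layers.\<close>
  finally have M: "?M = R ^ i * (L ^ j * (lay (lo q + j) * lay (lo q' + k)) * R ^ k * (G q * G q')) * L ^ l" .
  show ?thesis
  proof (cases "q = q' \<and> j = k")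
    case True
    have "?M = R ^ i * (L ^ j * (lay (lo q + j) * R ^ j) * G q) * L ^ l"
      unfolding M using True q by (simp add: lay_mult G_mult mult.assoc)
    also have "lay (lo q + j) * R ^ j = R ^ j * lay (lo q)"
      by (rule R_pow_lay[symmetric])
    also have "L ^ j * (R ^ j * lay (lo q)) * G q = ?c q j *\<^sub>c (lay (lo q) * G q)"
      using L_pow_R_pow[OF q(1), of j "lo q"] by (simp add: mult.assoc)
    finally have "?M = ?c q j *\<^sub>c (R ^ i * (lay (lo q) * G q) * L ^ l)"
      by simp
    moreover have "F q i j * F q' k l = (inverse (?c q j) * inverse (?c q' l)) *\<^sub>c ?M"
      by (simp add: F_def mult.commute)
    ultimately show ?thesis
      using True step_prod_nonzero[OF j] by (simp add: F_def)
  next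
    case False
    then have "?M = 0"
      unfolding M using q by (auto simp: lay_mult G_mult)
    then show ?thesis
      unfolding if_not_P[OF False] by (simp add: F_def)
  qed
qed

sublocale matrix_units Q N F
proof
  show "finite Q" by (simp add: Q_def)
  fix q i j assume q: "q \<in> Q" and ij: "i < N q" "j < N q"
  have "F q i j * F q j i = lay (lo q + i) * G q"
    using F_mult[OF q q, of j i j i] ij F_diag[OF q, of i] by simp
  moreover have "lay (lo q + i) * G q \<noteq> 0"
    using ij by (intro lay_G_nonzero q) (auto simp: N_def)
  ultimately show "F q i j \<noteq> 0" by auto
qed (rule F_mult)

text \<open>The projection onto \<open>johnson_points n d\<close>, the unit element of the Terwilliger algebra.\<close>

definition P :: "nat set rfmat" where
  "P = diag (\<lambda>y. of_bool (y \<subseteq> {1..n} \<and> card y = d))"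

lemma card_split: "y \<subseteq> {1..n} \<Longrightarrow> card y = card (y \<inter> x) + card (y \<inter> x')"
proof -
  assume "y \<subseteq> {1..n}"
  then have y: "y = (y \<inter> x) \<union> (y \<inter> x')" using union by auto
  show ?thesis
    by (subst y, subst card_Un_disjoint) (use disj in auto)
qed

lemma P_lay: "P * lay i = lay i" "lay i * P = lay i"
  by (auto intro!: rfmat_eqI simp: P_def lay_diag card_split)

lemma sum_lay: "(\<Sum>i\<le>d. lay i) = P"
proof (rule rfmat_eqI)
  fix y z
  have "(\<Sum>i\<le>d. of_bool (y \<subseteq> {1..n} \<and> card (y \<inter> x) + i = d \<and> card (y \<inter> x') = i) :: complex)
      = (\<Sum>i\<le>d. if i = card (y \<inter> x') then of_bool (y \<subseteq> {1..n} \<and> card y = d) else 0)"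
    by (intro sum.cong) (auto simp: card_split)
  also have "\<dots> = of_bool (y \<subseteq> {1..n} \<and> card y = d)"
    by (auto simp: card_split)
  finally show "entry (\<Sum>i\<le>d. lay i) y z = entry P y z"
    by (cases "y = z") (simp_all add: lay_diag P_def)
qed

lemma hi_le: "hi q \<le> d"
  by (simp add: hi_def)

lemma assemble_one_P: "assemble (\<lambda>q. 1\<^sub>m (N q)) = P"
proof -
  have "(\<Sum>i<N q. F q i i) = (\<Sum>i\<le>d. lay i * G q)" if q: "q \<in> Q" for q
  proof -
    have "(\<Sum>i<N q. F q i i) = (\<Sum>i<N q. lay (lo q + i) * G q)"
      using q by (intro sum.cong refl) (simp add: F_diag)
    also have "\<dots> = (\<Sum>i\<in>{lo q..<lo q + N q}. lay i * G q)"
      by (rule sum.reindex_bij_witness[of _ "\<lambda>i. i - lo q" "\<lambda>i. lo q + i"]) auto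
    also have "\<dots> = (\<Sum>i\<le>d. lay i * G q)"
      using hi_le[of q] by (intro sum.mono_neutral_left) (auto simp: N_def intro!: lay_G_0 q)
    finally show ?thesis .
  qed
  then have "assemble (\<lambda>q. 1\<^sub>m (N q)) = (\<Sum>q\<in>Q. \<Sum>i\<le>d. lay i * G q)"
    by (simp add: assemble_one)
  also have "\<dots> = (\<Sum>i\<le>d. lay i) * (\<Sum>q\<in>Q. G q)"
    by (subst sum.swap) (simp add: sum_product)
  finally show ?thesis
    by (simp add: sum_lay sum_G)
qed

text \<open>The set of all linear combinations of the matrix units.\<close>

definition units_span :: "nat set rfmat set" where
  "units_span = assemble ` {f. \<forall>q\<in>Q. f q \<in> carrier_mat (N q) (N q)}"

lemma units_span_mult: "A \<in> units_span \<Longrightarrow> B \<in> units_span \<Longrightarrow> A * B \<in> units_span"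
  unfolding units_span_def by (auto simp: assemble_mult intro!: imageI mult_carrier_mat)

lemma units_span_add: "A \<in> units_span \<Longrightarrow> B \<in> units_span \<Longrightarrow> A + B \<in> units_span"
  unfolding units_span_def by (auto simp: assemble_add intro!: imageI)

lemma units_span_scale: "A \<in> units_span \<Longrightarrow> c *\<^sub>c A \<in> units_span"
  unfolding units_span_def by (auto simp: assemble_scale intro!: imageI)

lemma units_span_F: "q \<in> Q \<Longrightarrow> i < N q \<Longrightarrow> j < N q \<Longrightarrow> F q i j \<in> units_span"
  using unit_in_assemble[of q i j] unfolding units_span_def by blast

lemma units_span_P: "P \<in> units_span"
  unfolding units_span_def assemble_one_P[symmetric] by (intro imageI) auto

lemma units_span_0: "0 \<in> units_span"
  using units_span_scale[OF units_span_P, of 0] by simp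

lemma units_span_sum: "(\<And>i. i \<in> I \<Longrightarrow> f i \<in> units_span) \<Longrightarrow> sum f I \<in> units_span"
  by (induction I rule: infinite_finite_induct) (auto simp: units_span_0 units_span_add)

lemma units_span_lay_G: "q \<in> Q \<Longrightarrow> lay i * G q \<in> units_span"
proof (cases "lo q \<le> i \<and> i \<le> hi q")
  case True
  assume q: "q \<in> Q"
  have j: "i - lo q < N q"
    using True unfolding N_def by linarith
  have "lay i * G q = F q (i - lo q) (i - lo q)"
    using F_diag[OF q j] True by simp
  then show ?thesis
    using units_span_F[OF q j j] by simp
qed (auto simp: lay_G_0 units_span_0)

lemma sum_lay_G: "(\<Sum>q\<in>Q. lay i * G q) = lay i"
  using sum_G by (simp add: sum_distrib_left[symmetric])

lemma units_spanI_lay: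
  assumes "\<And>q. q \<in> Q \<Longrightarrow> M * (lay i * G q) \<in> units_span"
  shows "M * lay i \<in> units_span"
proof -
  have "M * lay i = (\<Sum>q\<in>Q. M * (lay i * G q))"
    by (subst sum_lay_G[symmetric]) (simp add: sum_distrib_left)
  then show ?thesis
    using assms by (simp add: units_span_sum)
qed

lemma units_span_lay: "lay i \<in> units_span"
  using units_spanI_lay[of 1 i] units_span_lay_G by simp

lemma units_span_casimir:
  "casimir x * lay i \<in> units_span" "casimir x' * lay i \<in> units_span"
proof -
  have *: "C * (lay i * G q) = lay i * (C * G q)" if "C * lay i = lay i * C" for C q
    by (metis mult.assoc that)
  show "casimir x * lay i \<in> units_span" "casimir x' * lay i \<in> units_span"
    by (intro units_spanI_lay, subst *, simp add: casimir_comm,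
        simp add: casimir_G units_span_scale units_span_lay_G)+
qed

text \<open>Multiplied by \<open>R\<close> or \<open>L\<close> from the left, a diagonal matrix unit becomes a multiple of the next
  or the previous matrix unit in its column, or zero at the end of the block.\<close>

lemma units_span_R: "R * lay i \<in> units_span"
proof (rule units_spanI_lay)
  fix q assume q: "q \<in> Q"
  show "R * (lay i * G q) \<in> units_span"
  proof (cases "lo q \<le> i \<and> i < hi q")
    case True
    let ?j = "i - lo q"
    have j: "?j < N q" "Suc ?j < N q" using True by (auto simp: N_def)
    have "R * (lay i * G q) = R * F q ?j ?j"
      using F_diag[OF q j(1)] True by simp
    also have "\<dots> = F q (Suc ?j) ?j"
      by (simp add: F_def mult.assoc)
    finally show ?thesis
      using units_span_F[OF q j(2,1)] by simp
  next
    case False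
    have "R * (lay i * G q) = 0"
    proof (cases "lo q \<le> i \<and> i \<le> hi q")
      case True
      then have "lay (Suc i) * G q = 0"
        using False by (intro lay_G_0 q) auto
      moreover have "R * (lay i * G q) = lay (Suc i) * G q * R"
        by (simp add: mult.assoc[symmetric] R_lay) (simp add: mult.assoc G_comm)
      ultimately show ?thesis by simp
    qed (auto simp: lay_G_0 q)
    then show ?thesis by (simp add: units_span_0)
  qed
qed

lemma units_span_L: "L * lay i \<in> units_span"
proof (rule units_spanI_lay)
  fix q assume q: "q \<in> Q"
  show "L * (lay i * G q) \<in> units_span"
  proof (cases "lo q < i \<and> i \<le> hi q")
    case True
    define j where "j = i - Suc (lo q)"
    have j: "Suc j < N q" "j < N q" "i = lo q + Suc j" using True by (auto simp: N_def j_def)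
    have "L * (lay i * G q) = L * F q (Suc j) (Suc j)"
      using F_diag[OF q j(1)] j(3) by simp
    also have "\<dots> = inverse (\<Prod>t<Suc j. step q (lo q + t)) *\<^sub>c (L * R * (R ^ j * lay (lo q)) * G q * L ^ Suc j)"
      unfolding F_def by (simp add: mult.assoc)
    also have "L * R * (R ^ j * lay (lo q)) * G q = L * R * lay (lo q + j) * G q * R ^ j"
      using power_commute_left[OF G_comm(1), of q j 1] by (simp add: R_pow_lay mult.assoc)
    also have "\<dots> = step q (lo q + j) *\<^sub>c (lay (lo q + j) * R ^ j * G q)"
      using power_commute_left[OF G_comm(1), of q j 1]
        arg_cong[OF L_R_lay_G[OF q, of "lo q + j"], of "\<lambda>A. A * R ^ j"]
      by (simp add: mult.assoc)
    also have "lay (lo q + j) * R ^ j = R ^ j * lay (lo q)"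
      by (rule R_pow_lay[symmetric])
    also have "inverse (\<Prod>t<Suc j. step q (lo q + t)) *\<^sub>c
        (step q (lo q + j) *\<^sub>c (R ^ j * lay (lo q) * G q) * L ^ Suc j)
      = step q (lo q + j) *\<^sub>c F q j (Suc j)"
      by (simp add: F_def mult.assoc mult.commute)
    finally show ?thesis
      using units_span_scale[OF units_span_F[OF q j(2,1)]] by simp
  next
    case False
    have "L * (lay i * G q) = 0"
    proof (cases "lo q \<le> i \<and> i \<le> hi q")
      case True
      then have i: "i = lo q" using False by auto
      show ?thesis
      proof (cases i)
        case 0
        then show ?thesis by (simp add: mult.assoc[symmetric] L_lay_0)
      next
        case (Suc k)
        have "lay k * G q = 0"
          using i Suc by (intro lay_G_0 q) auto
        moreover have "L * (lay i * G q) = lay k * G q * L"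
          using Suc by (simp add: mult.assoc[symmetric] lay_L[symmetric]) (simp add: mult.assoc G_comm)
        ultimately show ?thesis by simp
      qed
    qed (auto simp: lay_G_0 q)
    then show ?thesis by (simp add: units_span_0)
  qed
qed

end

section \<open>The association matrices\<close>

lemma entry_down_pow:
  fixes V :: "'a set"
  assumes V: "finite V"
  shows "entry (down V ^ k) y z = fact k * of_bool (y \<subseteq> z \<and> z - y \<subseteq> V \<and> card (z - y) = k)"
proof (induction k arbitrary: y)
  case 0
  have "finite (z - y)" if "z - y \<subseteq> V" using that V finite_subset by blast
  then show ?case by auto
next
  case (Suc k)
  let ?c = "y \<subseteq> z \<and> z - y \<subseteq> V \<and> card (z - y) = Suc k"
  have iff: "(insert a y \<subseteq> z \<and> z - insert a y \<subseteq> V \<and> card (z - insert a y) = k) \<longleftrightarrow> a \<in> z \<and> ?c"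
    if a: "a \<in> V" "a \<notin> y" for a
  proof (cases "a \<in> z \<and> z - y \<subseteq> V")
    case True
    then have "finite (z - y)" using V finite_subset by blast
    then have "card (z - y) = Suc (card (z - insert a y))"
      using True a card_Suc_Diff1[of "z - y" a] by (simp add: Diff_insert[symmetric] del: card_Diff_insert)
    then show ?thesis using True by auto
  qed (use a in auto)
  have "entry (down V ^ Suc k) y z = (\<Sum>a\<in>V. if a \<notin> y then entry (down V ^ k) (insert a y) z else 0)"
    unfolding power_Suc down_def[of V] sum_distrib_right by simp
  also have "\<dots> = (\<Sum>a\<in>V. if a \<notin> y \<and> a \<in> z \<and> ?c then fact k else 0)"
    unfolding Suc using iff by (intro sum.cong refl) auto
  also have "\<dots> = fact (Suc k) * of_bool ?c"
  proof (cases ?c)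
    case True
    then have "{a \<in> V. a \<notin> y \<and> a \<in> z \<and> ?c} = z - y" by auto
    then have "(\<Sum>a\<in>V. if a \<notin> y \<and> a \<in> z \<and> ?c then fact k else 0) = of_nat (card (z - y)) * (fact k :: complex)"
      using V by (simp add: sum.inter_filter[symmetric])
    then show ?thesis using True by simp
  next
    case False
    then have "(\<Sum>a\<in>V. if a \<notin> y \<and> a \<in> z \<and> ?c then fact k else 0) = (0 :: complex)"
      by (intro sum.neutral) auto
    then show ?thesis using False by (simp only: of_bool_eq mult_zero_right)
  qed
  finally show ?case .
qed

lemma entry_up_pow:
  fixes V :: "'a set"
  assumes V: "finite V"
  shows "entry (up V ^ k) y z = fact k * of_bool (z \<subseteq> y \<and> y - z \<subseteq> V \<and> card (y - z) = k)"
proof (induction k arbitrary: y)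
  case 0
  have "finite (y - z)" if "y - z \<subseteq> V" using that V finite_subset by blast
  then show ?case by auto
next
  case (Suc k)
  let ?c = "z \<subseteq> y \<and> y - z \<subseteq> V \<and> card (y - z) = Suc k"
  have iff: "(z \<subseteq> y - {a} \<and> y - {a} - z \<subseteq> V \<and> card (y - {a} - z) = k) \<longleftrightarrow> a \<notin> z \<and> ?c"
    if a: "a \<in> V" "a \<in> y" for a
  proof (cases "a \<notin> z \<and> y - z \<subseteq> V")
    case True
    then have "finite (y - z)" using V finite_subset by blast
    moreover have "y - {a} - z = y - z - {a}" by auto
    ultimately have "card (y - z) = Suc (card (y - {a} - z))"
      using True a card_Suc_Diff1[of "y - z" a] by simp
    then show ?thesis using True by auto
  qed (use a in auto)
  have "entry (up V ^ Suc k) y z = (\<Sum>a\<in>V. if a \<in> y then entry (up V ^ k) (y - {a}) z else 0)"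
    unfolding power_Suc up_def[of V] sum_distrib_right by simp
  also have "\<dots> = (\<Sum>a\<in>V. if a \<in> y \<and> a \<notin> z \<and> ?c then fact k else 0)"
    unfolding Suc using iff by (intro sum.cong refl) auto
  also have "\<dots> = fact (Suc k) * of_bool ?c"
  proof (cases ?c)
    case True
    then have "{a \<in> V. a \<in> y \<and> a \<notin> z \<and> ?c} = y - z" by auto
    then have "(\<Sum>a\<in>V. if a \<in> y \<and> a \<notin> z \<and> ?c then fact k else 0) = of_nat (card (y - z)) * (fact k :: complex)"
      using V by (simp add: sum.inter_filter[symmetric])
    then show ?thesis using True by simp
  next
    case False
    then have "(\<Sum>a\<in>V. if a \<in> y \<and> a \<notin> z \<and> ?c then fact k else 0) = (0 :: complex)"
      by (intro sum.neutral) auto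
    then show ?thesis using False by (simp only: of_bool_eq mult_zero_right)
  qed
  finally show ?case .
qed

lemma entry_up_down_pow:
  assumes V: "finite V" and y: "y \<subseteq> V" "card y = d" and z: "z \<subseteq> V" "card z = d" and k: "k \<le> d"
  shows "entry (up V ^ k * down V ^ k) y z = (fact k)\<^sup>2 * of_nat (card (y \<inter> z) choose (d - k))"
proof -
  have fin: "finite y" "finite z"
    using V y z finite_subset by auto
  have card_iff: "card (u - w) = k \<longleftrightarrow> card w = d - k" if "w \<subseteq> u" "card u = d" "finite u" for u w :: "'a set"
    using that k card_mono[of u w] by (auto simp: card_Diff_subset finite_subset)
  have "entry (up V ^ k * down V ^ k) y z
      = (\<Sum>w\<in>Pow y. entry (up V ^ k) y w * entry (down V ^ k) w z)"
    using fin V by (intro entry_mult) (auto simp: entry_up_pow)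
  also have "\<dots> = (\<Sum>w\<in>Pow y. if w \<subseteq> y \<inter> z \<and> card w = d - k then (fact k)\<^sup>2 else 0)"
  proof (rule sum.cong[OF refl])
    fix w assume "w \<in> Pow y"
    then have "w \<subseteq> y" by simp
    then show "entry (up V ^ k) y w * entry (down V ^ k) w z
        = (if w \<subseteq> y \<inter> z \<and> card w = d - k then (fact k)\<^sup>2 else 0)"
      using y z fin V card_iff[of w y] card_iff[of w z]
      by (auto simp: entry_up_pow entry_down_pow power2_eq_square)
  qed
  also have "\<dots> = of_nat (card {w \<in> Pow y. w \<subseteq> y \<inter> z \<and> card w = d - k}) * (fact k)\<^sup>2"
    using fin by (simp add: sum.inter_filter[symmetric])
  also have "{w \<in> Pow y. w \<subseteq> y \<inter> z \<and> card w = d - k} = {w. w \<subseteq> y \<inter> z \<and> card w = d - k}"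
    by auto
  also have "card \<dots> = card (y \<inter> z) choose (d - k)"
    using fin by (intro n_subsets) simp
  finally show ?thesis by simp
qed

text \<open>The association matrix \<open>A\<^sub>l\<close> as an element of the ring of row-finite matrices.\<close>

definition assoc :: "nat \<Rightarrow> nat \<Rightarrow> nat \<Rightarrow> nat set rfmat" where
  "assoc n d l = Rfmat (assoc_matrix n d l)"

lemma finite_johnson_points: "finite (johnson_points n d)"
  by (rule finite_subset[of _ "Pow {1..n}"]) (auto simp: johnson_points_def)

lemma entry_assoc: "entry (assoc n d l) = assoc_matrix n d l"
  unfolding assoc_def
  by (rule entry_Rfmat, rule finite_subset[OF _ finite_johnson_points[of n d]])
    (auto simp: assoc_matrix_def johnson_rel_def)

context johnson_pair
begin

abbreviation V :: "nat set" where "V \<equiv> {1..n}"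

lemma P_alt: "P = ground V * layer V d"
  by (auto intro!: rfmat_eqI simp: P_def ground_def level_def Int_absorb2)

lemma P_idem: "P * P = P"
  by (rule rfmat_eqI) (simp add: P_def)

text \<open>Up to the factor \<open>(k!)\<^sup>2\<close>, the \<open>(y, z)\<close> entry of \<open>T k\<close> counts the common subsets of \<open>y\<close> and
  \<open>z\<close> of size \<open>d - k\<close>. So \<open>T k\<close> is a triangular combination of the association matrices, while
  \<open>T_Suc\<close> shows that it is a polynomial in the Casimir element of \<open>{1..n}\<close> times \<open>P\<close>.\<close>

definition T :: "nat \<Rightarrow> nat set rfmat" where
  "T k = up V ^ k * down V ^ k * P"

lemma casimir_V_P: "casimir V * P = P * casimir V"
  unfolding P_alt
  by (intro commute_mult casimir_level casimir_commuteI ground_up ground_down ground_level) auto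

lemma down_pow_P: "k \<le> d \<Longrightarrow> layer V (d - k) * (down V ^ k * P) = down V ^ k * P"
proof (induction k)
  case 0
  have "layer V d * P = P"
    by (auto intro!: rfmat_eqI simp: P_def level_def Int_absorb2)
  then show ?case by simp
next
  case (Suc k)
  have "layer V (d - Suc k) * (down V ^ Suc k * P) = layer V (d - Suc k) * down V * (down V ^ k * P)"
    by (simp add: mult.assoc)
  also have "layer V (d - Suc k) * down V = down V * layer V (d - k)"
    using Suc.prems by (simp add: layer_down Suc_diff_Suc)
  finally show ?case
    using Suc by (simp add: mult.assoc)
qed

lemma T_0: "T 0 = P" by (simp add: T_def)

lemma T_Suc:
  assumes "k \<le> d"
  shows "T (Suc k) = cas n (d - k) *\<^sub>c T k - casimir V * T k"
proof -
  have "T (Suc k) = up V ^ k * ((up V * down V) * (layer V (d - k) * (down V ^ k * P)))"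
    unfolding down_pow_P[OF assms]
    by (simp only: T_def power_Suc2[of "up V"] power_Suc[of "down V"] mult.assoc)
  also have "\<dots> = up V ^ k * ((level V (cas n) * layer V (d - k) - casimir V * layer V (d - k)) * (down V ^ k * P))"
    by (simp add: up_down_casimir left_diff_distrib mult.assoc)
  also have "\<dots> = cas n (d - k) *\<^sub>c (up V ^ k * (layer V (d - k) * (down V ^ k * P)))
      - up V ^ k * (casimir V * (layer V (d - k) * (down V ^ k * P)))"
    by (simp add: level_layer left_diff_distrib right_diff_distrib mult.assoc)
  also have "\<dots> = cas n (d - k) *\<^sub>c T k - up V ^ k * (casimir V * (down V ^ k * P))"
    unfolding down_pow_P[OF assms] by (simp add: T_def mult.assoc)
  also have "up V ^ k * (casimir V * (down V ^ k * P)) = casimir V * T k"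
    using power_commute_left[OF casimir_up, of V k "down V ^ k * P"] by (simp add: T_def mult.assoc)
  finally show ?thesis .
qed

lemma P_T: "k \<le> d \<Longrightarrow> P * T k = T k"
proof (induction k)
  case (Suc k)
  have "P * (casimir V * T k) = casimir V * (P * T k)"
    by (simp add: mult.assoc[symmetric] casimir_V_P del: One_nat_def)
  then show ?case
    using Suc by (simp add: T_Suc right_diff_distrib)
qed (simp add: T_0 P_idem)

lemma T_assoc:
  assumes k: "k \<le> d"
  shows "T k = (fact k)\<^sup>2 *\<^sub>c (\<Sum>l\<le>k. of_nat ((d - l) choose (d - k)) *\<^sub>c assoc n d l)"
proof (rule rfmat_eqI)
  fix y z
  have T: "T k = P * (up V ^ k * down V ^ k) * P"
    using P_T[OF k] by (simp add: T_def mult.assoc)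
  show "entry (T k) y z = entry ((fact k)\<^sup>2 *\<^sub>c (\<Sum>l\<le>k. of_nat ((d - l) choose (d - k)) *\<^sub>c assoc n d l)) y z"
  proof (cases "y \<in> johnson_points n d \<and> z \<in> johnson_points n d")
    case True
    then have yz: "y \<subseteq> V" "card y = d" "z \<subseteq> V" "card z = d"
      by (auto simp: johnson_points_def)
    have c: "card (y \<inter> z) \<le> d"
      using card_mono[of y "y \<inter> z"] yz finite_subset[of y V] by auto
    have "(\<Sum>l\<le>k. of_nat ((d - l) choose (d - k)) * assoc_matrix n d l y z)
        = (\<Sum>l\<le>k. if l = d - card (y \<inter> z) then of_nat (card (y \<inter> z) choose (d - k)) else 0)"
      using True k c by (intro sum.cong refl) (auto simp: assoc_matrix_def johnson_rel_def)
    also have "\<dots> = of_nat (card (y \<inter> z) choose (d - k))"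
      using k c by (auto simp: binomial_eq_0)
    finally show ?thesis
      unfolding T using yz entry_up_down_pow[OF _ yz k] by (simp add: P_def entry_assoc)
  next
    case False
    have "assoc_matrix n d l y z = 0" for l
      using False by (auto simp: assoc_matrix_def johnson_rel_def)
    moreover have "entry (T k) y z = 0"
      unfolding T using False by (auto simp: P_def johnson_points_def)
    ultimately show ?thesis
      by (simp add: entry_assoc)
  qed
qed

lemma up_down_V: "up V * down V = up x * down x + up x' * down x' + R + L"
proof -
  have "up V = up x + up x'" "down V = down x + down x'"
    unfolding up_def down_def union[symmetric] by (simp_all add: sum.union_disjoint disj)
  then show ?thesis
    by (simp add: R_def L_def ring_distribs commutes algebra_simps)
qed

lemma assoc_1:
  assumes "0 < d"
  shows "assoc n d 1 = up V * down V * P - of_nat d *\<^sub>c P"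
proof -
  have "assoc n d 0 = P"
    using T_assoc[of 0] by (simp add: T_0)
  moreover have "d choose (d - 1) = d"
    using assms binomial_symmetric[of 1 d] by simp
  ultimately show ?thesis
    using T_assoc[of 1] assms by (simp add: T_def)
qed

lemma up_down_x_lay: "up x * down x * lay i = cas d (Suc i) *\<^sub>c lay i - casimir x * lay i"
proof (cases "i \<le> d")
  case True
  then show ?thesis
    by (simp add: up_down_casimir left_diff_distrib level_x_lay card_x cas_d_lay)
qed (simp add: lay_beyond)

lemma up_down_x'_lay: "up x' * down x' * lay i = cas m i *\<^sub>c lay i - casimir x' * lay i"
  by (simp add: up_down_casimir left_diff_distrib level_x'_lay card_x')

lemma units_span_diff: "A \<in> units_span \<Longrightarrow> B \<in> units_span \<Longrightarrow> A - B \<in> units_span"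
  using units_span_add[of A "(- 1) *\<^sub>c B"] units_span_scale[of B "- 1"] by (simp add: cscale_distrib)

lemma units_span_casimir_V: "casimir V * P \<in> units_span"
proof -
  have "casimir V * lay i = level V (cas n) * lay i - up V * down V * lay i" for i
    by (simp add: casimir_def left_diff_distrib)
  moreover have "level V (cas n) * lay i = cas n d *\<^sub>c lay i" for i
    by (auto intro!: rfmat_eqI simp: level_def lay_diag Int_absorb2 card_split)
  ultimately have "casimir V * lay i \<in> units_span" for i
    unfolding up_down_V
    by (simp only: ring_distribs up_down_x_lay up_down_x'_lay)
      (intro units_span_add units_span_diff units_span_scale units_span_lay
        units_span_R units_span_L units_span_casimir)
  then have "(\<Sum>i\<le>d. casimir V * lay i) \<in> units_span"
    by (intro units_span_sum)
  then show ?thesis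
    by (simp add: sum_lay[symmetric] sum_distrib_left)
qed

lemma units_span_T: "k \<le> d \<Longrightarrow> T k \<in> units_span"
proof (induction k)
  case (Suc k)
  have "casimir V * T k = casimir V * P * T k"
    using Suc by (simp add: mult.assoc P_T)
  then show ?case
    using Suc
    by (simp add: T_Suc units_span_diff units_span_scale units_span_mult units_span_casimir_V
        del: One_nat_def)
qed (simp add: T_0 units_span_P)

lemma units_span_assoc: "l \<le> d \<Longrightarrow> assoc n d l \<in> units_span"
proof (induction l rule: less_induct)
  case (less l)
  let ?S = "\<Sum>i<l. of_nat ((d - i) choose (d - l)) *\<^sub>c assoc n d i"
  have "inverse ((fact l)\<^sup>2) *\<^sub>c T l = ?S + assoc n d l"
    using less.prems by (simp add: T_assoc lessThan_Suc_atMost[symmetric])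
  then have "assoc n d l = inverse ((fact l)\<^sup>2) *\<^sub>c T l - ?S"
    by (simp add: algebra_simps)
  moreover have "?S \<in> units_span"
    using less by (intro units_span_sum units_span_scale) auto
  ultimately show ?case
    using units_span_T[OF less.prems] by (simp add: units_span_diff units_span_scale)
qed

section \<open>Generating the matrix units\<close>

lemma lay_shift:
  "lay i * R * lay j = (if i = Suc j then R * lay j else 0)"
  "lay i * L * lay j = (if Suc i = j then L * lay j else 0)"
  "lay i * (up x * down x) * lay j = (if i = j then up x * down x * lay i else 0)"
  "lay i * (up x' * down x') * lay j = (if i = j then up x' * down x' * lay i else 0)"
proof -
  show "lay i * R * lay j = (if i = Suc j then R * lay j else 0)"
    by (simp add: mult.assoc R_lay lay_mult_left)
  show "lay i * L * lay j = (if Suc i = j then L * lay j else 0)"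
    by (simp add: lay_L mult.assoc lay_mult)
  have "lay i * (up x * down x) = up x * down x * lay i"
    by (simp add: up_down_casimir left_diff_distrib right_diff_distrib casimir_comm)
      (simp add: lay_diag level_def diag_commute)
  then show "lay i * (up x * down x) * lay j = (if i = j then up x * down x * lay i else 0)"
    by (simp add: mult.assoc lay_mult)
  have "lay i * (up x' * down x') = up x' * down x' * lay i"
    by (simp add: up_down_casimir left_diff_distrib right_diff_distrib casimir_comm)
      (simp add: lay_diag level_def diag_commute)
  then show "lay i * (up x' * down x') * lay j = (if i = j then up x' * down x' * lay i else 0)"
    by (simp add: mult.assoc lay_mult)
qed

lemma lay_assoc_lay:
  assumes "0 < d"
  shows "lay i * assoc n d 1 * lay j =
    (if i = Suc j then R * lay j else 0) + (if Suc i = j then L * lay j else 0) +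
    (if i = j then up x * down x * lay i + up x' * down x' * lay i - of_nat d *\<^sub>c lay i else 0)"
proof -
  have "lay i * assoc n d 1 * lay j = lay i * (up V * down V) * lay j - of_nat d *\<^sub>c (lay i * lay j)"
    using assms
    by (simp add: assoc_1 left_diff_distrib right_diff_distrib mult.assoc P_lay del: One_nat_def)
  also have "\<dots> = (if i = Suc j then R * lay j else 0) + (if Suc i = j then L * lay j else 0) +
    (if i = j then up x * down x * lay i + up x' * down x' * lay i - of_nat d *\<^sub>c lay i else 0)"
    unfolding up_down_V by (simp add: distrib_left distrib_right lay_shift lay_mult)
  finally show ?thesis .
qed

text \<open>The commutator of \<open>L\<close> and \<open>R\<close> on a layer is affine in the two Casimir elements. Since
  \<open>m \<noteq> d\<close>, it is not a function of their sum alone.\<close>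

lemma commutator_lay:
  "L * R * lay i - R * L * lay i =
    (cas d (Suc i) * cas m (Suc i) - cas d i * cas m i) *\<^sub>c lay i
    - (of_nat m - 2 * of_nat i) *\<^sub>c (casimir x * lay i)
    - (of_nat d - 2 * of_nat i) *\<^sub>c (casimir x' * lay i)"
proof -
  have d: "cas v (Suc i) = cas v i + (of_nat v - 2 * of_nat i)" for v
    by (simp add: cas_def algebra_simps)
  show ?thesis
    unfolding L_R_lay R_L_lay d
    by (simp add: left_diff_distrib right_diff_distrib cscale_distrib algebra_simps)
qed

text \<open>A set of matrices closed under the algebra operations that contains the dual idempotents and
  \<open>A\<^sub>1\<close> contains all matrix units. Cutting \<open>A\<^sub>1\<close> by the layers gives \<open>R\<close>, \<open>L\<close> and the sum of the
  two Casimir elements; the commutator of \<open>L\<close> and \<open>R\<close> then separates these two, and interpolation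
  gives the projections onto the components.\<close>

lemma generates:
  assumes d: "0 < d"
    and mult: "\<And>A B. A \<in> S \<Longrightarrow> B \<in> S \<Longrightarrow> A * B \<in> S"
    and add: "\<And>A B. A \<in> S \<Longrightarrow> B \<in> S \<Longrightarrow> A + B \<in> S"
    and scale: "\<And>c A. A \<in> S \<Longrightarrow> c *\<^sub>c A \<in> S"
    and lay: "\<And>i. i \<le> d \<Longrightarrow> lay i \<in> S"
    and A1: "assoc n d 1 \<in> S"
  shows "units_span \<subseteq> S"
proof -
  have zero: "0 \<in> S"
    using scale[OF A1, of 0] by simp
  have diff: "A - B \<in> S" if "A \<in> S" "B \<in> S" for A B
    using add[OF that(1) scale[OF that(2), of "- 1"]] by (simp add: cscale_distrib)
  have lay': "lay i \<in> S" for i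
    using lay[of i] zero lay_beyond[of i] by (cases "i \<le> d") auto
  have R: "R * lay i \<in> S" for i
    using mult[OF mult[OF lay' A1] lay', of "Suc i" i] lay_assoc_lay[OF d, of "Suc i" i] by simp
  have Ls: "L * lay (Suc i) \<in> S" for i
    using mult[OF mult[OF lay' A1] lay', of i "Suc i"] lay_assoc_lay[OF d, of i "Suc i"] by simp
  have L: "L * lay i \<in> S" for i
    using Ls zero L_lay_0 by (cases i) auto
  have LR: "L * R * lay i \<in> S" for i
  proof -
    have "L * R * lay i = (L * lay (Suc i)) * (R * lay i)"
      by (simp add: mult.assoc R_lay lay_mult_left)
    then show ?thesis using mult L R by simp
  qed
  have RL: "R * L * lay i \<in> S" for i
  proof (cases i)
    case 0
    then show ?thesis using zero by (simp add: mult.assoc L_lay_0)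
  next
    case (Suc k)
    then have "R * L * lay i = (R * lay k) * (L * lay i)"
      by (simp add: mult.assoc lay_L[symmetric] lay_mult_left)
    then show ?thesis using mult L R by simp
  qed
  have sum: "casimir x * lay i + casimir x' * lay i \<in> S" for i
  proof -
    have "casimir x * lay i + casimir x' * lay i
        = (cas d (Suc i) + cas m i - of_nat d) *\<^sub>c lay i - lay i * assoc n d 1 * lay i"
      using lay_assoc_lay[OF d, of i i] unfolding up_down_x_lay up_down_x'_lay
      by (simp add: cscale_distrib algebra_simps)
    then show ?thesis
      using diff scale mult lay' A1 by simp
  qed
  have Cx: "casimir x * lay i \<in> S" for i
  proof -
    \<comment> \<open>The commutator plus \<open>d - 2 i\<close> times the sum of the Casimir elements is a scalar minus
      \<open>m - d\<close> times \<open>casimir x\<close>.\<close>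
    define c where "c = (of_nat m - of_nat d :: complex)"
    have "c \<noteq> 0" using d_less_m by (simp add: c_def)
    have "c *\<^sub>c (casimir x * lay i)
      = (cas d (Suc i) * cas m (Suc i) - cas d i * cas m i) *\<^sub>c lay i
        - (of_nat d - 2 * of_nat i) *\<^sub>c (casimir x * lay i + casimir x' * lay i)
        - (L * R * lay i - R * L * lay i)"
      unfolding commutator_lay c_def by (simp add: cscale_distrib algebra_simps)
    also have "\<dots> \<in> S"
      by (intro diff scale sum LR RL lay')
    finally have "inverse c *\<^sub>c c *\<^sub>c (casimir x * lay i) \<in> S"
      by (rule scale)
    then show ?thesis
      using \<open>c \<noteq> 0\<close> by simp
  qed
  have Cx': "casimir x' * lay i \<in> S" for i
    using diff[OF sum Cx, of i i] by simp
  have poly: "poly_at p C * lay i \<in> S"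
    if "C * lay i \<in> S" "C * lay i = lay i * C" for p C i
  proof (induction p)
    case (pCons a p)
    have "lay i * (poly_at p C * lay i) = poly_at p C * lay i"
      using poly_at_commute[OF that(2), of p] by (simp add: lay_mult_left lay_mult)
    then have "poly_at (pCons a p) C * lay i = a *\<^sub>c lay i + C * lay i * (poly_at p C * lay i)"
      by (simp add: poly_at_pCons distrib_right mult.assoc)
    then show ?case
      using add scale mult that(1) lay' pCons by simp
  qed (simp add: zero)
  have G: "lay i * G q \<in> S" for i q
  proof -
    have "lay i * G q = (isotypic x (fst q) * lay i) * (isotypic x' (snd q) * lay i)"
    proof -
      have "isotypic x' (snd q) * lay i = lay i * isotypic x' (snd q)"
        by (intro isotypic_commute casimir_comm)
      then have "(isotypic x (fst q) * lay i) * (isotypic x' (snd q) * lay i)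
          = isotypic x (fst q) * lay i * isotypic x' (snd q)"
        by (simp add: mult.assoc lay_mult_left)
      moreover have "isotypic x (fst q) * lay i = lay i * isotypic x (fst q)"
        by (intro isotypic_commute casimir_comm)
      ultimately show ?thesis by (simp only: G_def mult.assoc)
    qed
    moreover have "isotypic x (fst q) * lay i \<in> S" "isotypic x' (snd q) * lay i \<in> S"
      unfolding isotypic_def by (intro poly Cx Cx' casimir_comm)+
    ultimately show ?thesis using mult by simp
  qed
  have Rp: "R ^ i * (lay a * G q) \<in> S" for i a q
  proof (induction i)
    case (Suc i)
    have "lay (a + i) * (R ^ i * (lay a * G q)) = R ^ i * (lay a * G q)"
      using R_pow_lay[of i a] by (simp add: mult.assoc[symmetric]) (simp add: mult.assoc lay_mult lay_mult_left)
    then have "R ^ Suc i * (lay a * G q) = (R * lay (a + i)) * (R ^ i * (lay a * G q))"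
      by (simp add: mult.assoc)
    then show ?case using mult R Suc by simp
  qed (simp add: G)
  have RpLp: "R ^ i * (lay a * G q) * L ^ j \<in> S" for i j a q
  proof (induction j)
    case (Suc j)
    have "R ^ i * (lay a * G q) * L ^ j = R ^ i * G q * (L ^ j * lay (a + j))"
      by (simp only: lay_L_pow[symmetric] G_comm(3)[symmetric] mult.assoc)
    then have "R ^ i * (lay a * G q) * L ^ j * lay (a + j) = R ^ i * (lay a * G q) * L ^ j"
      by (simp add: mult.assoc lay_mult)
    then have "R ^ i * (lay a * G q) * L ^ Suc j = (R ^ i * (lay a * G q) * L ^ j) * (L * lay (Suc (a + j)))"
      unfolding lay_L[symmetric] by (simp add: mult.assoc[symmetric] power_Suc2 del: power_Suc)
    then show ?case using mult L Suc by simp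
  qed (simp add: Rp)
  show ?thesis
    unfolding units_span_def
    by (auto intro!: assemble_closed zero add scale simp: F_def RpLp)
qed

end

section \<open>The primitive idempotents of the Johnson scheme\<close>

lemma inner_on_diff_left: "inner_on X (\<lambda>y. u y - u' y) w = inner_on X u w - inner_on X u' w"
  by (simp add: inner_on_def left_diff_distrib sum_subtractf)

lemma inner_on_sum_left: "inner_on X (\<lambda>y. \<Sum>i\<in>I. f i y) w = (\<Sum>i\<in>I. inner_on X (f i) w)"
  unfolding inner_on_def sum_distrib_right by (rule sum.swap)

lemma inner_on_self_eq_0:
  assumes "finite X" "u \<in> vectors_on X" "inner_on X u u = 0"
  shows "u = (\<lambda>_. 0)"
proof -
  have "inner_on X u u = of_real (\<Sum>y\<in>X. (cmod (u y))\<^sup>2)"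
    by (simp add: inner_on_def complex_norm_square[symmetric])
  then have "(\<Sum>y\<in>X. (cmod (u y))\<^sup>2) = 0"
    using assms(3) by (metis of_real_eq_0_iff)
  then have "\<forall>y\<in>X. u y = 0"
    using assms(1) by (simp add: sum_nonneg_eq_0_iff)
  then show ?thesis
    using assms(2) by (auto simp: vectors_on_def)
qed

lemma mat_vec_diff: "mat_vec X M (\<lambda>y. u y - u' y) = (\<lambda>y. mat_vec X M u y - mat_vec X M u' y)"
  by (simp add: mat_vec_def right_diff_distrib sum_subtractf)

lemma eigenspace_on_diff:
  "u \<in> eigenspace_on X M \<theta> \<Longrightarrow> u' \<in> eigenspace_on X M \<theta> \<Longrightarrow> (\<lambda>y. u y - u' y) \<in> eigenspace_on X M \<theta>"
  by (auto simp: eigenspace_on_def vectors_on_def mat_vec_diff right_diff_distrib)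

lemma orth_projection_unique:
  assumes X: "finite X" and P: "is_orth_projection X W P" and P': "is_orth_projection X W P'"
    and diff: "\<And>u u'. u \<in> W \<Longrightarrow> u' \<in> W \<Longrightarrow> (\<lambda>y. u y - u' y) \<in> W" and W: "W \<subseteq> vectors_on X"
  shows "P = P'"
proof -
  have eq: "mat_vec X P u = mat_vec X P' u" if u: "u \<in> vectors_on X" for u
  proof -
    let ?D = "\<lambda>y. mat_vec X P u y - mat_vec X P' u y"
    have D: "?D \<in> W"
      using P P' u by (intro diff) (auto simp: is_orth_projection_def)
    have "inner_on X (\<lambda>y. u y - mat_vec X P u y) ?D = 0" "inner_on X (\<lambda>y. u y - mat_vec X P' u y) ?D = 0"
      using P P' u D unfolding is_orth_projection_def by blast+
    then have "inner_on X ?D ?D = 0"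
      unfolding inner_on_diff_left by simp
    then have "?D = (\<lambda>_. 0)"
      using D W by (intro inner_on_self_eq_0[OF X]) auto
    then show ?thesis
      by (metis eq_iff_diff_eq_0 ext)
  qed
  \<comment> \<open>Unit vectors recover the entries.\<close>
  have ent: "mat_vec X M (\<lambda>w. of_bool (w = z)) y = M y z" if "z \<in> X" for M y z
  proof -
    have "mat_vec X M (\<lambda>w. of_bool (w = z)) y = (\<Sum>w\<in>X. if w = z then M y z else 0)"
      unfolding mat_vec_def by (intro sum.cong) auto
    then show ?thesis
      using X that by simp
  qed
  show ?thesis
  proof (intro ext)
    fix y z
    show "P y z = P' y z"
    proof (cases "z \<in> X")
      case True
      then have "(\<lambda>w. of_bool (w = z)) \<in> vectors_on X"
        by (auto simp: vectors_on_def)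
      then show ?thesis
        using eq ent[OF True, of P y] ent[OF True, of P' y] by simp
    next
      case False
      then show ?thesis
        using P P' by (simp add: is_orth_projection_def matrices_on_def)
    qed
  qed
qed

lemma orth_projection_nonzero:
  assumes X: "finite X" and P: "is_orth_projection X W P"
    and diff: "\<And>u u'. u \<in> W \<Longrightarrow> u' \<in> W \<Longrightarrow> (\<lambda>y. u y - u' y) \<in> W" and W: "W \<subseteq> vectors_on X"
    and w: "w \<in> W" "w \<noteq> (\<lambda>_. 0)"
  shows "orth_projection X W \<noteq> (\<lambda>_ _. 0)"
proof
  assume 0: "orth_projection X W = (\<lambda>_ _. 0)"
  have "orth_projection X W = P"
    unfolding orth_projection_def
  proof (rule the_equality)
    show "is_orth_projection X W P" by (rule P)
    fix P' assume P': "is_orth_projection X W P'"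
    show "P' = P"
      by (rule orth_projection_unique[OF X P' P _ W]) (rule diff)
  qed
  then have "P = (\<lambda>_ _. 0)"
    using 0 by simp
  then have "mat_vec X P w = (\<lambda>_. 0)"
    by (simp add: mat_vec_def)
  moreover have "inner_on X (\<lambda>y. w y - mat_vec X P w y) w = 0"
    using P w W unfolding is_orth_projection_def by blast
  ultimately have "inner_on X w w = 0"
    by simp
  then show False
    using inner_on_self_eq_0[OF X] w W by blast
qed

text \<open>A vector is encoded as the matrix that has it as its column at the empty set.\<close>

definition column :: "('a set \<Rightarrow> complex) \<Rightarrow> 'a set rfmat" where
  "column u = Rfmat (\<lambda>y z. if z = {} then u y else 0)"

lemma entry_column: "entry (column u) y z = (if z = {} then u y else 0)"
  unfolding column_def by (subst entry_Rfmat) (auto intro: finite_subset[of _ "{{}}"])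

lemma mult_column:
  assumes "finite X" "u \<in> vectors_on X"
  shows "M * column u = column (\<lambda>y. \<Sum>z\<in>X. entry M y z * u z)"
proof (rule rfmat_eqI)
  fix y z
  have "entry (M * column u) y z = (\<Sum>w\<in>{w. entry M y w \<noteq> 0} \<union> X. entry M y w * entry (column u) w z)"
    using assms(1) by (intro entry_mult) (auto simp: finite_row)
  also have "\<dots> = (\<Sum>w\<in>X. entry M y w * entry (column u) w z)"
    using assms by (intro sum.mono_neutral_right) (auto simp: finite_row entry_column vectors_on_def)
  finally show "entry (M * column u) y z = entry (column (\<lambda>y. \<Sum>z\<in>X. entry M y z * u z)) y z"
    by (simp add: entry_column)
qed

lemma column_inject: "column u = column u' \<longleftrightarrow> u = u'"
  by (metis entry_column ext)

lemma entry_up_down: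
  assumes y: "y \<in> johnson_points v k" and z: "z \<in> johnson_points v k"
  shows "entry (up {1..v} * down {1..v}) y z = of_nat k * of_bool (y = z) + johnson_adjacency v k y z"
proof (cases "k = 0")
  case True
  then have "y = {}" "z = {}"
    using y z finite_subset[of _ "{1..v}"] by (auto simp: johnson_points_def)
  moreover have "entry (up {1..v} * down {1..v}) {} {} = 0"
    using entry_up_pow[of "{1..v}" 1 "{}"] by (subst entry_mult[of "{}"]) auto
  ultimately show ?thesis
    using True by (simp add: johnson_adjacency_def)
next
  case False
  have yz: "y \<subseteq> {1..v}" "card y = k" "z \<subseteq> {1..v}" "card z = k" "finite y" "finite z"
    using y z finite_subset[of _ "{1..v}"] by (auto simp: johnson_points_def)
  have "entry (up {1..v} * down {1..v}) y z = of_nat (card (y \<inter> z) choose (k - 1))"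
    using entry_up_down_pow[of "{1..v}" y k z 1] yz False by simp
  also have "\<dots> = of_nat k * of_bool (y = z) + johnson_adjacency v k y z"
  proof (cases "y = z")
    case True
    then show ?thesis
      using yz False binomial_symmetric[of 1 k] by (simp add: johnson_adjacency_def)
  next
    case ne: False
    have "card (y \<inter> z) \<noteq> k"
      using ne yz by (metis card_subset_eq inf_le1 inf_le2)
    then have "card (y \<inter> z) < k"
      using yz card_mono[of y "y \<inter> z"] by auto
    then show ?thesis
      using ne y z by (auto simp: johnson_adjacency_def binomial_eq_0)
  qed
  finally show ?thesis .
qed

lemma johnson_eigenvalue_cas:
  "of_int (johnson_eigenvalue v k j) = cas v k - cas v j - of_nat k"
  by (simp add: johnson_eigenvalue_def cas_def algebra_simps)

lemma vectors_on_johnson_iff: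
  "u \<in> vectors_on (johnson_points v k) \<longleftrightarrow>
     ground {1..v} * column u = column u \<and> layer {1..v} k * column u = column u"
proof -
  have eq: "diag f * column u = column u \<longleftrightarrow> (\<forall>y. f y = 1 \<or> u y = 0)" for f :: "nat set \<Rightarrow> complex"
  proof -
    have "diag f * column u = column (\<lambda>y. f y * u y)"
      by (rule rfmat_eqI) (simp add: entry_column)
    then show ?thesis
      by (auto simp: column_inject fun_eq_iff)
  qed
  show ?thesis
    unfolding ground_def level_def eq
    by (auto simp: vectors_on_def johnson_points_def Int_absorb2) (metis Int_absorb2)+
qed

lemma up_down_column:
  assumes "u \<in> vectors_on (johnson_points v k)"
  shows "up {1..v} * down {1..v} * column u
    = of_nat k *\<^sub>c column u + column (mat_vec (johnson_points v k) (johnson_adjacency v k) u)"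
proof -
  let ?V = "{1..v}" and ?X = "johnson_points v k" and ?UD = "up {1..v} * down {1..v}"
  let ?h = "\<lambda>y. \<Sum>z\<in>?X. entry ?UD y z * u z"
  have gl: "ground ?V * column u = column u" "layer ?V k * column u = column u"
    using assms by (simp_all only: vectors_on_johnson_iff)
  have "layer ?V k * ?UD = ?UD * layer ?V k"
    by (simp add: up_down_casimir left_diff_distrib right_diff_distrib level_commute casimir_level)
  moreover have "ground ?V * ?UD = ?UD * ground ?V"
    by (intro commute_mult ground_up ground_down) auto
  ultimately have "ground ?V * (?UD * column u) = ?UD * (ground ?V * column u)"
    "layer ?V k * (?UD * column u) = ?UD * (layer ?V k * column u)"
    by (simp_all only: mult.assoc[symmetric])
  then have "ground ?V * (?UD * column u) = ?UD * column u" "layer ?V k * (?UD * column u) = ?UD * column u"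
    by (simp_all only: gl)
  moreover have h: "?UD * column u = column ?h"
    by (rule mult_column[OF finite_johnson_points assms])
  ultimately have "?h \<in> vectors_on ?X"
    by (simp only: vectors_on_johnson_iff)
  then have "?h = (\<lambda>y. of_nat k * u y + mat_vec ?X (johnson_adjacency v k) u y)"
  proof (intro ext)
    fix y assume hX: "?h \<in> vectors_on ?X"
    show "?h y = of_nat k * u y + mat_vec ?X (johnson_adjacency v k) u y"
    proof (cases "y \<in> ?X")
      case True
      have "?h y = (\<Sum>z\<in>?X. (if z = y then of_nat k * u y else 0) + johnson_adjacency v k y z * u z)"
          by (intro sum.cong refl) (auto simp: entry_up_down[OF True] distrib_right simp del: One_nat_def)
      then show ?thesis
        using True finite_johnson_points by (simp add: sum.distrib mat_vec_def)
    next
      case False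
      then have "?h y = 0" "u y = 0"
        using hX assms unfolding vectors_on_def by blast+
      moreover have "johnson_adjacency v k y z = 0" for z
        using False by (simp add: johnson_adjacency_def)
      ultimately show ?thesis
        by (simp add: mat_vec_def)
    qed
  qed
  then show ?thesis
    unfolding h by (auto intro!: rfmat_eqI simp: entry_column)
qed

text \<open>The eigenspaces in question are those of the Casimir element of \<open>{1..v}\<close> on layer \<open>k\<close>.\<close>

lemma eigenspace_iff:
  "u \<in> eigenspace_on (johnson_points v k) (johnson_adjacency v k) (of_int (johnson_eigenvalue v k j))
    \<longleftrightarrow> u \<in> vectors_on (johnson_points v k) \<and> casimir {1..v} * column u = cas v j *\<^sub>c column u"
proof (cases "u \<in> vectors_on (johnson_points v k)")
  case True
  let ?Au = "mat_vec (johnson_points v k) (johnson_adjacency v k) u"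
  have "layer {1..v} k * column u = column u"
    using True by (simp only: vectors_on_johnson_iff)
  then have "level {1..v} (cas v) * column u = cas v k *\<^sub>c column u"
    using mult.assoc[of "level {1..v} (cas v)" "layer {1..v} k" "column u"]
    by (simp only: level_layer cscale_simps)
  then have "casimir {1..v} * column u = cas v k *\<^sub>c column u - (of_nat k *\<^sub>c column u + column ?Au)"
    by (simp add: casimir_def left_diff_distrib up_down_column[OF True, simplified])
  also have "\<dots> = column (\<lambda>y. cas v k * u y - of_nat k * u y - ?Au y)"
    by (rule rfmat_eqI) (simp add: entry_column)
  finally have 1: "casimir {1..v} * column u = column (\<lambda>y. cas v k * u y - of_nat k * u y - ?Au y)" .
  have 2: "cas v j *\<^sub>c column u = column (\<lambda>y. cas v j * u y)"
    by (rule rfmat_eqI) (simp add: entry_column)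
  have "casimir {1..v} * column u = cas v j *\<^sub>c column u \<longleftrightarrow>
      (\<forall>y. ?Au y = (cas v k - cas v j - of_nat k) * u y)"
    unfolding 1 2 column_inject by (auto simp: fun_eq_iff algebra_simps)
  then show ?thesis
    using True by (auto simp: eigenspace_on_def johnson_eigenvalue_cas fun_eq_iff)
qed (simp add: eigenspace_on_def)

lemma eigenspaces_orthogonal:
  assumes "finite X" "\<And>y z. M z y = cnj (M y z)" "\<theta> \<noteq> cnj \<theta>'"
    "u \<in> eigenspace_on X M \<theta>" "w \<in> eigenspace_on X M \<theta>'"
  shows "inner_on X u w = 0"
proof -
  have "\<theta> * inner_on X u w = inner_on X (mat_vec X M u) w"
    using assms(4) by (simp add: eigenspace_on_def inner_on_def sum_distrib_left mult.assoc)
  also have "\<dots> = inner_on X u (mat_vec X M w)"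
    unfolding inner_on_def mat_vec_def sum_distrib_left sum_distrib_right cnj_sum
    by (subst sum.swap) (simp add: assms(2)[symmetric] mult_ac)
  also have "\<dots> = cnj \<theta>' * inner_on X u w"
    using assms(5) by (simp add: eigenspace_on_def inner_on_def sum_distrib_left mult_ac)
  finally show ?thesis
    using assms(3) by simp
qed

text \<open>The isotypic projection, restricted to layer \<open>k\<close>, is orthogonal because the other components
  lie in eigenspaces of the same symmetric matrix for different eigenvalues.\<close>

lemma johnson_orth_projection_exists:
  assumes j: "j \<le> v div 2"
  shows "\<exists>M. is_orth_projection (johnson_points v k)
    (eigenspace_on (johnson_points v k) (johnson_adjacency v k) (of_int (johnson_eigenvalue v k j))) M"
proof -
  let ?V = "{1..v}" and ?X = "johnson_points v k"
  let ?E = "\<lambda>r. eigenspace_on ?X (johnson_adjacency v k) (of_int (johnson_eigenvalue v k r))"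
  let ?e = "\<lambda>r u y. \<Sum>z\<in>?X. entry (isotypic ?V r) y z * u z"
  define M where "M = (\<lambda>y z. if y \<in> ?X \<and> z \<in> ?X then entry (isotypic ?V j) y z else 0)"
  have e: "?e r u \<in> ?E r" "isotypic ?V r * column u = column (?e r u)"
    if u: "u \<in> vectors_on ?X" and r: "r \<le> v div 2" for u r
  proof -
    show 1: "isotypic ?V r * column u = column (?e r u)"
      by (rule mult_column[OF finite_johnson_points u])
    have "isotypic ?V r * ground ?V = ground ?V * isotypic ?V r"
      "isotypic ?V r * layer ?V k = layer ?V k * isotypic ?V r"
      by (intro isotypic_commute casimir_level casimir_commuteI ground_up ground_down ground_level; simp)+
    then have "ground ?V * column (?e r u) = isotypic ?V r * (ground ?V * column u)"
      "layer ?V k * column (?e r u) = isotypic ?V r * (layer ?V k * column u)"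
      unfolding 1[symmetric] by (simp_all only: mult.assoc[symmetric])
    then have "ground ?V * column (?e r u) = column (?e r u)" "layer ?V k * column (?e r u) = column (?e r u)"
      using u unfolding vectors_on_johnson_iff by (simp_all only: 1)
    moreover have "casimir ?V * column (?e r u) = cas v r *\<^sub>c column (?e r u)"
      using r casimir_isotypic[of ?V r] unfolding 1[symmetric] by (simp add: mult.assoc[symmetric])
    ultimately show "?e r u \<in> ?E r"
      by (simp only: eigenspace_iff vectors_on_johnson_iff simp_thms)
  qed
  have Mu: "mat_vec ?X M u = ?e j u" if u: "u \<in> vectors_on ?X" for u
  proof
    fix y
    show "mat_vec ?X M u y = ?e j u y"
    proof (cases "y \<in> ?X")
      case True
      then show ?thesis
        by (auto simp: mat_vec_def M_def intro!: sum.cong)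
    next
      case False
      then have "?e j u y = 0"
        using e(1)[OF u j] unfolding eigenspace_on_def vectors_on_def by blast
      then show ?thesis
        using False by (simp add: mat_vec_def M_def)
    qed
  qed
  have "is_orth_projection ?X (?E j) M"
    unfolding is_orth_projection_def
  proof (intro conjI ballI)
    show "M \<in> matrices_on ?X"
      by (auto simp: matrices_on_def M_def)
    fix u assume u: "u \<in> vectors_on ?X"
    show "mat_vec ?X M u \<in> ?E j"
      unfolding Mu[OF u] by (rule e(1)[OF u j])
    fix w assume w: "w \<in> ?E j"
    have "column u = (\<Sum>r\<le>v div 2. isotypic ?V r) * column u"
      using sum_isotypic[of ?V] by simp
    also have "\<dots> = (\<Sum>r\<le>v div 2. column (?e r u))"
      using e(2)[OF u] by (simp add: sum_distrib_right)
    finally have col: "column u = (\<Sum>r\<le>v div 2. column (?e r u))" .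
    have decomp: "u y = (\<Sum>r\<le>v div 2. ?e r u y)" for y
    proof -
      have "u y = entry (column u) y {}"
        by (simp add: entry_column)
      also have "\<dots> = entry (\<Sum>r\<le>v div 2. column (?e r u)) y {}"
        unfolding col ..
      also have "\<dots> = (\<Sum>r\<le>v div 2. ?e r u y)"
        by (simp add: entry_column)
      finally show ?thesis .
    qed
    have diff_eq: "a - b = c" if "a = b + c" for a b c :: complex
      using that by simp
    have remove: "(\<Sum>r\<le>v div 2. ?e r u y) = ?e j u y + (\<Sum>r\<in>{..v div 2} - {j}. ?e r u y)" for y
      by (rule sum.remove) (use j in auto)
    have "u y - ?e j u y = (\<Sum>r\<in>{..v div 2} - {j}. ?e r u y)" for y
      by (rule diff_eq[OF trans[OF decomp remove]])
    then have "inner_on ?X (\<lambda>y. u y - mat_vec ?X M u y) w = (\<Sum>r\<in>{..v div 2} - {j}. inner_on ?X (?e r u) w)"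
      unfolding Mu[OF u] by (simp only: inner_on_sum_left)
    also have "\<dots> = 0"
    proof (rule sum.neutral, rule ballI)
      fix r assume r: "r \<in> {..v div 2} - {j}"
      have "of_int (johnson_eigenvalue v k r) \<noteq> (of_int (johnson_eigenvalue v k j) :: complex)"
        using cas_inj[of r v j] r j by (auto simp: johnson_eigenvalue_cas)
      then show "inner_on ?X (?e r u) w = 0"
        using r by (intro eigenspaces_orthogonal[OF finite_johnson_points _ _ e(1)[OF u] w])
          (auto simp: johnson_adjacency_def Int_commute)
    qed
    finally show "inner_on ?X (\<lambda>y. u y - mat_vec ?X M u y) w = 0" .
  qed
  then show ?thesis by blast
qed

lemma johnson_eigenvector_exists:
  assumes "j \<le> k" "k \<le> v" "j \<le> v - k"
  shows "\<exists>u. u \<noteq> (\<lambda>_. 0) \<and>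
    u \<in> eigenspace_on (johnson_points v k) (johnson_adjacency v k) (of_int (johnson_eigenvalue v k j))"
proof -
  have *: "{1..v} \<union> {} \<subseteq> {1..v}" "j + k \<le> card {1..v}" "0 + 0 \<le> card {}" "0 \<le> (0 :: nat)"
    using assms by auto
  obtain W where W: "W \<noteq> 0" "W * vacuum = W" "ground {1..v} * W = W"
    "casimir {1..v} * W = cas (card {1..v}) j *\<^sub>c W"
    "\<And>f. level {1..v} f * W = f k *\<^sub>c W"
    using exists_state[OF finite_atLeastAtMost finite.emptyI Int_empty_right *(1,2) assms(1) *(3,4)]
    by metis
  define u where "u = (\<lambda>y. entry W y {})"
  have col: "column u = W"
  proof (rule rfmat_eqI)
    fix y z
    have "entry W y z = entry (W * vacuum) y z"
      using W(2) by simp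
    also have "\<dots> = (if z = {} then entry W y z else 0)"
      by (simp add: vacuum_def)
    finally show "entry (column u) y z = entry W y z"
      by (cases "z = {}") (simp_all add: entry_column u_def)
  qed
  have "u \<in> vectors_on (johnson_points v k)"
    unfolding vectors_on_johnson_iff col using W(3) W(5)[of "\<lambda>l. of_bool (l = k)"] by simp
  moreover have "u \<noteq> (\<lambda>_. 0)"
  proof
    assume "u = (\<lambda>_. 0)"
    then have "column u = 0" by (intro rfmat_eqI) (simp add: entry_column)
    then show False using W(1) col by simp
  qed
  ultimately show ?thesis
    unfolding eigenspace_iff using W(4) col by auto
qed

lemma johnson_idempotent_nonzero_iff:
  assumes k: "k \<le> v"
  shows "johnson_idempotent v k j \<noteq> (\<lambda>_ _. 0) \<longleftrightarrow> j \<le> k \<and> j \<le> v - k"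
proof (cases "j \<le> min k (v - k)")
  case True
  let ?E = "eigenspace_on (johnson_points v k) (johnson_adjacency v k) (of_int (johnson_eigenvalue v k j))"
  have "j \<le> v div 2" using True by auto
  then obtain M where M: "is_orth_projection (johnson_points v k) ?E M"
    using johnson_orth_projection_exists by blast
  obtain u where u: "u \<noteq> (\<lambda>_. 0)" "u \<in> ?E"
    using johnson_eigenvector_exists[of j k v] True k by auto
  have "orth_projection (johnson_points v k) ?E \<noteq> (\<lambda>_ _. 0)"
    by (rule orth_projection_nonzero[OF finite_johnson_points M eigenspace_on_diff _ u(2,1)])
      (auto simp: eigenspace_on_def)
  then show ?thesis
    using True by (simp add: johnson_idempotent_def)
qed (auto simp: johnson_idempotent_def)

lemma tensor_eq_0_iff: "tensor A B = (\<lambda>_ _. 0) \<longleftrightarrow> A = (\<lambda>_ _. 0) \<or> B = (\<lambda>_ _. 0)"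
  by (auto simp: tensor_def fun_eq_iff)

lemma (in johnson_pair) d_num_eq:
  "nat (d_num n d r s + 1) = N (r, s)"
proof -
  have "d + m = card (x \<union> x')"
    using disj by (simp add: card_Un_disjoint card_x card_x')
  then have m: "n - d = m" by (simp add: union)
  have "{i \<in> {0..d}. tensor (johnson_idempotent d (d - i) r) (johnson_idempotent (n - d) i s) \<noteq> (\<lambda>_ _. 0)}
      = {lo (r, s)..hi (r, s)}"
  proof (rule Set.set_eqI)
    fix i
    show "i \<in> {i \<in> {0..d}. tensor (johnson_idempotent d (d - i) r) (johnson_idempotent (n - d) i s) \<noteq> (\<lambda>_ _. 0)}
      \<longleftrightarrow> i \<in> {lo (r, s)..hi (r, s)}"
    proof (cases "i \<le> d")
      case True
      moreover have "i \<le> m" using True d_less_m by simp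
      ultimately show ?thesis
        by (auto simp: tensor_eq_0_iff m johnson_idempotent_nonzero_iff lo_def hi_def)
    qed (auto simp: hi_def)
  qed
  then show ?thesis
    by (simp add: d_num_def N_def)
qed

section \<open>The isomorphism\<close>

lemma calg_isomorphic_sym:
  assumes h: "h \<in> calg_iso B A"
    and one: "\<one>\<^bsub>B\<^esub> \<in> carrier B"
    and mult: "\<And>a b. a \<in> carrier B \<Longrightarrow> b \<in> carrier B \<Longrightarrow> a \<otimes>\<^bsub>B\<^esub> b \<in> carrier B"
    and add: "\<And>a b. a \<in> carrier B \<Longrightarrow> b \<in> carrier B \<Longrightarrow> a \<oplus>\<^bsub>B\<^esub> b \<in> carrier B"
    and smult: "\<And>c a. a \<in> carrier B \<Longrightarrow> c \<odot>\<^bsub>B\<^esub> a \<in> carrier B"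
  shows "A \<simeq>\<^sub>\<complex> B"
proof -
  define g where "g = inv_into (carrier B) h"
  have bij: "bij_betw h (carrier B) (carrier A)" and hom: "h \<in> ring_hom B A"
    and sc: "\<And>c a. a \<in> carrier B \<Longrightarrow> h (c \<odot>\<^bsub>B\<^esub> a) = c \<odot>\<^bsub>A\<^esub> h a"
    using h by (auto simp: calg_iso_def)
  have gB: "g a \<in> carrier B" and hg: "h (g a) = a" if "a \<in> carrier A" for a
    using that bij by (auto simp: g_def bij_betw_def f_inv_into_f intro: inv_into_into)
  have gI: "g (h b) = b" if "b \<in> carrier B" for b
    using that bij by (simp add: g_def bij_betw_inv_into_left)
  have "g \<in> calg_iso A B"
    unfolding calg_iso_def
  proof (intro CollectI conjI allI ballI)
    show "bij_betw g (carrier A) (carrier B)"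
      unfolding g_def by (rule bij_betw_inv_into[OF bij])
    show "g \<in> ring_hom A B"
    proof (rule ring_hom_memI)
      fix a b assume a: "a \<in> carrier A" and b: "b \<in> carrier A"
      show "g a \<in> carrier B" by (rule gB[OF a])
      show "g (a \<otimes>\<^bsub>A\<^esub> b) = g a \<otimes>\<^bsub>B\<^esub> g b"
        using gI[OF mult[OF gB[OF a] gB[OF b]]] ring_hom_mult[OF hom gB[OF a] gB[OF b]] hg a b by simp
      show "g (a \<oplus>\<^bsub>A\<^esub> b) = g a \<oplus>\<^bsub>B\<^esub> g b"
        using gI[OF add[OF gB[OF a] gB[OF b]]] ring_hom_add[OF hom gB[OF a] gB[OF b]] hg a b by simp
    next
      show "g \<one>\<^bsub>A\<^esub> = \<one>\<^bsub>B\<^esub>"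
        using gI[OF one] ring_hom_one[OF hom] by simp
    qed
    fix c a assume a: "a \<in> carrier A"
    show "g (c \<odot>\<^bsub>A\<^esub> a) = c \<odot>\<^bsub>B\<^esub> g a"
      using gI[OF smult[OF gB[OF a]]] sc[OF gB[OF a]] hg[OF a] by simp
  qed
  then show ?thesis
    by (auto simp: calg_isomorphic_def)
qed

context johnson_pair
begin

lemma assemble_cong: "(\<And>q. q \<in> Q \<Longrightarrow> f q = g q) \<Longrightarrow> assemble f = assemble g"
  unfolding assemble_def by (rule sum.cong) auto

lemma units_span_unit:
  assumes "A \<in> units_span"
  shows "P * A = A" "A * P = A"
proof -
  obtain f where f: "\<And>q. q \<in> Q \<Longrightarrow> f q \<in> carrier_mat (N q) (N q)" "A = assemble f"
    using assms by (auto simp: units_span_def)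
  have "assemble (\<lambda>q. 1\<^sub>m (N q) * f q) = assemble f"
    by (rule assemble_cong, rule left_mult_one_mat, rule f(1))
  moreover have "assemble (\<lambda>q. f q * 1\<^sub>m (N q)) = assemble f"
    by (rule assemble_cong, rule right_mult_one_mat, rule f(1))
  ultimately show "P * A = A" "A * P = A"
    using f by (simp_all add: assemble_one_P[symmetric] assemble_mult)
qed

lemma entry_matrices_on:
  assumes "P * M = M" "M * P = M"
  shows "entry M \<in> matrices_on (johnson_points n d)"
proof -
  have "entry M y z = 0" if "y \<notin> johnson_points n d \<or> z \<notin> johnson_points n d" for y z
  proof -
    have "entry M y z = entry (P * M * P) y z"
      by (simp only: assms)
    also have "\<dots> = 0"
      using that by (auto simp: P_def johnson_points_def simp del: One_nat_def)
    finally show ?thesis .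
  qed
  then show ?thesis
    by (simp add: matrices_on_def)
qed

lemma entry_mult_Mat_on:
  assumes "M * P = M"
  shows "entry (M * M') = entry M \<otimes>\<^bsub>Mat_on (johnson_points n d)\<^esub> entry M'"
proof (intro ext)
  fix y z
  have "w \<in> johnson_points n d" if "entry M y w \<noteq> 0" for w
  proof -
    have "entry (M * P) y w \<noteq> 0"
      using that by (subst assms)
    then show ?thesis
      by (auto simp: P_def johnson_points_def simp del: One_nat_def split: if_splits)
  qed
  then have "entry (M * M') y z = (\<Sum>w\<in>johnson_points n d. entry M y w * entry M' w z)"
    by (intro entry_mult finite_johnson_points)
  then show "entry (M * M') y z = (entry M \<otimes>\<^bsub>Mat_on (johnson_points n d)\<^esub> entry M') y z"
    by (simp add: Mat_on_def)
qed

lemma entry_Mat_on_ops: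
  "entry P = \<one>\<^bsub>Mat_on (johnson_points n d)\<^esub>"
  "entry (M + M') = entry M \<oplus>\<^bsub>Mat_on (johnson_points n d)\<^esub> entry M'"
  "entry (c *\<^sub>c M) = c \<odot>\<^bsub>Mat_on (johnson_points n d)\<^esub> entry M"
  by (auto simp: Mat_on_def P_def johnson_points_def intro!: ext)

lemma dual_idempotent_lay:
  assumes i: "i \<le> d"
  shows "dual_idempotent n d x i = entry (lay i)"
proof (intro ext)
  fix y z
  have "x \<in> johnson_points n d"
    using x_sub card_x by (simp add: johnson_points_def)
  moreover have "card (x \<inter> y) = d - i \<longleftrightarrow> card (y \<inter> x) + i = d"
    using i by (auto simp: Int_commute)
  ultimately have "(x, y) \<in> johnson_rel n d i \<longleftrightarrow>
      y \<subseteq> {1..n} \<and> card y = d \<and> card (y \<inter> x) + i = d"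
    by (auto simp: johnson_rel_def johnson_points_def)
  also have "\<dots> \<longleftrightarrow> y \<subseteq> {1..n} \<and> card (y \<inter> x) + i = d \<and> card (y \<inter> x') = i"
    using card_split[of y] by (cases "y \<subseteq> {1..n}") (simp_all del: One_nat_def, linarith)
  finally show "dual_idempotent n d x i y z = entry (lay i) y z"
    by (simp add: dual_idempotent_def lay_diag)
qed

text \<open>The Terwilliger algebra is the span of the matrix units.\<close>

lemma terwilliger_carrier:
  assumes d: "0 < d"
  shows "carrier (terwilliger_algebra n d x) = entry ` units_span"
proof -
  let ?A = "Mat_on (johnson_points n d)"
  let ?gens = "assoc_matrix n d ` {0..d} \<union> dual_idempotent n d x ` {0..d}"
  have gens: "?gens = (\<lambda>l. entry (assoc n d l)) ` {0..d} \<union> (\<lambda>i. entry (lay i)) ` {0..d}"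
    by (auto simp: entry_assoc dual_idempotent_lay)
  have carrier: "carrier (terwilliger_algebra n d x) = \<Inter>{S. is_subalgebra ?A S \<and> ?gens \<subseteq> S}"
    by (simp add: terwilliger_algebra_def generated_subalgebra_def)
  have "is_subalgebra ?A (entry ` units_span)"
    unfolding is_subalgebra_def
  proof (intro conjI ballI allI)
    show "entry ` units_span \<subseteq> carrier ?A"
      using entry_matrices_on units_span_unit by (auto simp: Mat_on_def)
    show "\<one>\<^bsub>?A\<^esub> \<in> entry ` units_span"
      using units_span_P by (simp add: entry_Mat_on_ops(1)[symmetric])
    fix a assume "a \<in> entry ` units_span"
    then obtain M where M: "M \<in> units_span" "a = entry M" by blast
    show "c \<odot>\<^bsub>?A\<^esub> a \<in> entry ` units_span" for c
      using M units_span_scale by (simp add: entry_Mat_on_ops(3)[symmetric])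
    fix b assume "b \<in> entry ` units_span"
    then obtain M' where M': "M' \<in> units_span" "b = entry M'" by blast
    show "a \<oplus>\<^bsub>?A\<^esub> b \<in> entry ` units_span"
      using M M' units_span_add by (simp add: entry_Mat_on_ops(2)[symmetric])
    show "a \<otimes>\<^bsub>?A\<^esub> b \<in> entry ` units_span"
      using M M' units_span_mult
      by (simp add: entry_mult_Mat_on[OF units_span_unit(2)[OF M(1)], symmetric])
  qed
  moreover have "?gens \<subseteq> entry ` units_span"
    unfolding gens using units_span_assoc units_span_lay by auto
  ultimately have "carrier (terwilliger_algebra n d x) \<subseteq> entry ` units_span"
    unfolding carrier by (intro Inter_lower CollectI conjI)
  moreover have "entry ` units_span \<subseteq> carrier (terwilliger_algebra n d x)"
    unfolding carrier
  proof (rule Inter_greatest)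
    fix S assume "S \<in> {S. is_subalgebra ?A S \<and> ?gens \<subseteq> S}"
    then have S: "is_subalgebra ?A S" "?gens \<subseteq> S"
      by (auto simp only: mem_Collect_eq)
    have ops: "\<And>a b. a \<in> S \<Longrightarrow> b \<in> S \<Longrightarrow> a \<oplus>\<^bsub>?A\<^esub> b \<in> S" "\<And>a b. a \<in> S \<Longrightarrow> b \<in> S \<Longrightarrow> a \<otimes>\<^bsub>?A\<^esub> b \<in> S"
      "\<And>c a. a \<in> S \<Longrightarrow> c \<odot>\<^bsub>?A\<^esub> a \<in> S"
      using S(1) by (auto simp: is_subalgebra_def)
    \<comment> \<open>Entries multiply as in \<open>Mat_on\<close> only for matrices supported on the \<open>d\<close>-subsets.\<close>
    define S' where "S' = {M. P * M = M \<and> M * P = M \<and> entry M \<in> S}"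
    have "units_span \<subseteq> S'"
    proof (rule generates[OF d])
      show "A * B \<in> S'" if "A \<in> S'" "B \<in> S'" for A B
      proof -
        have "P * (A * B) = A * B" "A * B * P = A * B"
          using that by (auto simp: S'_def mult.assoc[symmetric]) (simp add: mult.assoc)
        then show ?thesis
          using that ops(2) by (auto simp: S'_def entry_mult_Mat_on)
      qed
      show "A + B \<in> S'" if "A \<in> S'" "B \<in> S'" for A B
        using that ops(1) by (auto simp: S'_def entry_Mat_on_ops(2) distrib_left distrib_right)
      show "c *\<^sub>c A \<in> S'" if "A \<in> S'" for c A
        using that ops(3) by (auto simp: S'_def entry_Mat_on_ops(3))
      show "lay i \<in> S'" if "i \<le> d" for i
        using that S(2) units_span_unit[OF units_span_lay] unfolding gens by (auto simp: S'_def)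
      show "assoc n d 1 \<in> S'"
        using d S(2) units_span_unit[OF units_span_assoc[of 1]] unfolding gens by (auto simp: S'_def)
    qed
    then show "entry ` units_span \<subseteq> S" by (auto simp: S'_def)
  qed
  ultimately show ?thesis
    by (rule equalityI)
qed

text \<open>The direct sum of matrix algebras, with the block sizes \<open>N (r, s)\<close>.\<close>

definition block_sum :: "(nat \<Rightarrow> nat \<Rightarrow> complex mat) calgebra" where
  "block_sum = direct_sum {0..d div 2} (\<lambda>r. direct_sum {0..m div 2} (\<lambda>s. Mat (N (r, s))))"

lemma block_sum_simps:
  "carrier block_sum = (\<Pi>\<^sub>E r\<in>{0..d div 2}. \<Pi>\<^sub>E s\<in>{0..m div 2}. carrier_mat (N (r, s)) (N (r, s)))"
  "\<one>\<^bsub>block_sum\<^esub> = (\<lambda>r\<in>{0..d div 2}. \<lambda>s\<in>{0..m div 2}. 1\<^sub>m (N (r, s)))"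
  "f \<otimes>\<^bsub>block_sum\<^esub> g = (\<lambda>r\<in>{0..d div 2}. \<lambda>s\<in>{0..m div 2}. f r s * g r s)"
  "f \<oplus>\<^bsub>block_sum\<^esub> g = (\<lambda>r\<in>{0..d div 2}. \<lambda>s\<in>{0..m div 2}. f r s + g r s)"
  "c \<odot>\<^bsub>block_sum\<^esub> f = (\<lambda>r\<in>{0..d div 2}. \<lambda>s\<in>{0..m div 2}. c \<cdot>\<^sub>m f r s)"
  by (simp_all add: block_sum_def direct_sum_def module_mat_simps)

lemma block_sum_closed:
  "\<one>\<^bsub>block_sum\<^esub> \<in> carrier block_sum"
  "f \<in> carrier block_sum \<Longrightarrow> g \<in> carrier block_sum \<Longrightarrow> f \<otimes>\<^bsub>block_sum\<^esub> g \<in> carrier block_sum"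
  "f \<in> carrier block_sum \<Longrightarrow> g \<in> carrier block_sum \<Longrightarrow> f \<oplus>\<^bsub>block_sum\<^esub> g \<in> carrier block_sum"
  "f \<in> carrier block_sum \<Longrightarrow> c \<odot>\<^bsub>block_sum\<^esub> f \<in> carrier block_sum"
proof -
  have *: "(\<lambda>r\<in>{0..d div 2}. \<lambda>s\<in>{0..m div 2}. F r s) \<in> carrier block_sum"
    if "\<And>r s. r \<le> d div 2 \<Longrightarrow> s \<le> m div 2 \<Longrightarrow> F r s \<in> carrier_mat (N (r, s)) (N (r, s))" for F
    using that by (auto simp: block_sum_simps)
  have mem: "f r s \<in> carrier_mat (N (r, s)) (N (r, s))"
    if "f \<in> carrier block_sum" "r \<le> d div 2" "s \<le> m div 2" for f r s
    using that by (auto simp: block_sum_simps PiE_iff)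
  show "\<one>\<^bsub>block_sum\<^esub> \<in> carrier block_sum"
    unfolding block_sum_simps(2) by (rule *) simp
  show "f \<otimes>\<^bsub>block_sum\<^esub> g \<in> carrier block_sum" if "f \<in> carrier block_sum" "g \<in> carrier block_sum"
    unfolding block_sum_simps(3) by (rule *) (use mem that in \<open>auto intro!: mult_carrier_mat\<close>)
  show "f \<oplus>\<^bsub>block_sum\<^esub> g \<in> carrier block_sum" if "f \<in> carrier block_sum" "g \<in> carrier block_sum"
    unfolding block_sum_simps(4) by (rule *) (use mem that in auto)
  show "c \<odot>\<^bsub>block_sum\<^esub> f \<in> carrier block_sum" if "f \<in> carrier block_sum"
    unfolding block_sum_simps(5) by (rule *) (use mem that in auto)
qed

text \<open>The isomorphism from the direct sum onto the Terwilliger algebra.\<close>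

definition realize :: "(nat \<Rightarrow> nat \<Rightarrow> complex mat) \<Rightarrow> nat set matrix_on" where
  "realize f = entry (assemble (\<lambda>q. f (fst q) (snd q)))"

lemma block_sum_carrier_mat:
  "f \<in> carrier block_sum \<Longrightarrow> q \<in> Q \<Longrightarrow> f (fst q) (snd q) \<in> carrier_mat (N q) (N q)"
  by (auto simp: block_sum_simps PiE_iff Q_def)

lemma realize_span:
  assumes "f \<in> carrier block_sum"
  shows "assemble (\<lambda>q. f (fst q) (snd q)) \<in> units_span"
  unfolding units_span_def using block_sum_carrier_mat[OF assms] by (intro imageI) blast

lemma realize_bij: "bij_betw realize (carrier block_sum) (entry ` units_span)"
  unfolding bij_betw_def
proof
  show "inj_on realize (carrier block_sum)"
  proof (rule inj_onI)
    fix f g assume fg: "f \<in> carrier block_sum" "g \<in> carrier block_sum" "realize f = realize g"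
    then have "assemble (\<lambda>q. f (fst q) (snd q)) = assemble (\<lambda>q. g (fst q) (snd q))"
      by (simp add: realize_def entry_inject)
    then have eq: "f (fst q) (snd q) = g (fst q) (snd q)" if "q \<in> Q" for q
      using that block_sum_carrier_mat[OF fg(1) that] block_sum_carrier_mat[OF fg(2) that]
      by (rule assemble_inj[where f = "\<lambda>q. f (fst q) (snd q)" and g = "\<lambda>q. g (fst q) (snd q)"])
    show "f = g"
    proof (rule PiE_ext[OF fg(1,2)[unfolded block_sum_simps]])
      fix r assume r: "r \<in> {0..d div 2}"
      show "f r = g r"
      proof (rule PiE_ext)
        show "f r \<in> (\<Pi>\<^sub>E s\<in>{0..m div 2}. carrier_mat (N (r, s)) (N (r, s)))"
          "g r \<in> (\<Pi>\<^sub>E s\<in>{0..m div 2}. carrier_mat (N (r, s)) (N (r, s)))"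
          using fg(1,2) r unfolding block_sum_simps by (blast dest: PiE_mem)+
        show "f r s = g r s" if "s \<in> {0..m div 2}" for s
          using eq[of "(r, s)"] r that by (simp add: Q_def)
      qed
    qed
  qed
  show "realize ` carrier block_sum = entry ` units_span"
  proof (intro equalityI subsetI)
    fix a assume "a \<in> realize ` carrier block_sum"
    then show "a \<in> entry ` units_span"
      using realize_span by (auto simp: realize_def)
  next
    fix a assume "a \<in> entry ` units_span"
    then obtain g where g: "\<And>q. q \<in> Q \<Longrightarrow> g q \<in> carrier_mat (N q) (N q)" "a = entry (assemble g)"
      by (auto simp: units_span_def)
    define f where "f = (\<lambda>r\<in>{0..d div 2}. \<lambda>s\<in>{0..m div 2}. g (r, s))"
    have "f \<in> carrier block_sum"
      using g(1) by (auto simp: f_def block_sum_simps Q_def)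
    moreover have "realize f = a"
      unfolding realize_def g(2) by (intro arg_cong[where f = entry] assemble_cong) (auto simp: f_def Q_def)
    ultimately show "a \<in> realize ` carrier block_sum" by blast
  qed
qed

lemma realize_iso:
  assumes d: "0 < d"
  shows "realize \<in> calg_iso block_sum (terwilliger_algebra n d x)"
proof -
  let ?T = "terwilliger_algebra n d x" and ?A = "Mat_on (johnson_points n d)"
  have ops: "a \<otimes>\<^bsub>?T\<^esub> b = a \<otimes>\<^bsub>?A\<^esub> b" "\<one>\<^bsub>?T\<^esub> = \<one>\<^bsub>?A\<^esub>" "a \<oplus>\<^bsub>?T\<^esub> b = a \<oplus>\<^bsub>?A\<^esub> b"
    "c \<odot>\<^bsub>?T\<^esub> a = c \<odot>\<^bsub>?A\<^esub> a" for a b c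
    by (simp_all add: terwilliger_algebra_def generated_subalgebra_def)
  have Q: "fst q \<le> d div 2" "snd q \<le> m div 2" if "q \<in> Q" for q
    using that by (auto simp: Q_def)
  have "realize \<in> ring_hom block_sum ?T"
  proof (rule ring_hom_memI)
    fix f g assume f: "f \<in> carrier block_sum" and g: "g \<in> carrier block_sum"
    let ?f = "\<lambda>q. f (fst q) (snd q)" and ?g = "\<lambda>q. g (fst q) (snd q)"
    note car = block_sum_carrier_mat[OF f] block_sum_carrier_mat[OF g]
    show "realize f \<in> carrier ?T"
      using realize_span[OF f] by (simp add: terwilliger_carrier[OF d] realize_def)
    have "realize (f \<otimes>\<^bsub>block_sum\<^esub> g) = entry (assemble (\<lambda>q. ?f q * ?g q))"
      unfolding realize_def using Q
      by (intro arg_cong[where f = entry] assemble_cong) (simp add: block_sum_simps)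
    also have "\<dots> = entry (assemble ?f * assemble ?g)"
      using car by (simp add: assemble_mult)
    also have "\<dots> = realize f \<otimes>\<^bsub>?T\<^esub> realize g"
      unfolding ops realize_def by (rule entry_mult_Mat_on[OF units_span_unit(2)[OF realize_span[OF f]]])
    finally show "realize (f \<otimes>\<^bsub>block_sum\<^esub> g) = realize f \<otimes>\<^bsub>?T\<^esub> realize g" .
    have "realize (f \<oplus>\<^bsub>block_sum\<^esub> g) = entry (assemble (\<lambda>q. ?f q + ?g q))"
      unfolding realize_def using Q
      by (intro arg_cong[where f = entry] assemble_cong) (simp add: block_sum_simps)
    also have "\<dots> = entry (assemble ?f + assemble ?g)"
      using car by (simp add: assemble_add)
    finally show "realize (f \<oplus>\<^bsub>block_sum\<^esub> g) = realize f \<oplus>\<^bsub>?T\<^esub> realize g"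
      unfolding ops realize_def entry_Mat_on_ops .
  next
    have "realize \<one>\<^bsub>block_sum\<^esub> = entry (assemble (\<lambda>q. 1\<^sub>m (N q)))"
      unfolding realize_def using Q
      by (intro arg_cong[where f = entry] assemble_cong) (simp add: block_sum_simps)
    then show "realize \<one>\<^bsub>block_sum\<^esub> = \<one>\<^bsub>?T\<^esub>"
      unfolding ops assemble_one_P entry_Mat_on_ops .
  qed
  moreover have "realize (c \<odot>\<^bsub>block_sum\<^esub> f) = c \<odot>\<^bsub>?T\<^esub> realize f" if f: "f \<in> carrier block_sum" for c f
  proof -
    have "realize (c \<odot>\<^bsub>block_sum\<^esub> f) = entry (assemble (\<lambda>q. c \<cdot>\<^sub>m f (fst q) (snd q)))"
      unfolding realize_def using Q
      by (intro arg_cong[where f = entry] assemble_cong) (simp add: block_sum_simps)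
    also have "\<dots> = entry (c *\<^sub>c assemble (\<lambda>q. f (fst q) (snd q)))"
      using block_sum_carrier_mat[OF f] by (simp add: assemble_scale)
    finally show ?thesis
      unfolding ops realize_def entry_Mat_on_ops .
  qed
  ultimately show ?thesis
    using realize_bij by (simp add: calg_iso_def terwilliger_carrier[OF d])
qed

end

theorem theorem4p4:
  fixes n d :: nat and x :: "nat set"
  assumes "0 < n" and "0 < d" and "2 * d < n" and "n < 3 * d"
    and "x \<in> johnson_points n d"
  shows "terwilliger_algebra n d x \<simeq>\<^sub>\<complex>
    direct_sum {0..d div 2} (\<lambda>r.
      direct_sum {0..(n - d) div 2} (\<lambda>s. Mat (nat (d_num n d r s + 1))))"
proof -
  have x: "x \<subseteq> {1..n}" "card x = d"
    using assms(5) by (auto simp: johnson_points_def)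
  interpret johnson_pair n d "n - d" x "{1..n} - x"
  proof
    show "card ({1..n} - x) = n - d"
      using x by (subst card_Diff_subset) (auto intro: finite_subset)
  qed (use x assms(3) in auto)
  have "terwilliger_algebra n d x \<simeq>\<^sub>\<complex> block_sum"
    by (rule calg_isomorphic_sym[OF realize_iso[OF assms(2)] block_sum_closed])
  then show ?thesis
    by (simp add: block_sum_def d_num_eq)
qed

end
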